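(* Let $i,j,k\in\mathbb{N}\cup\{0\}$ be distinct. The virtual knot invariant $\phi_{i,j,k}$ is a finite-type invariant of degree two; that is, it is a finite-type invariant of degree $\leq 2$ but not of degree $\leq 1$.
   Context: A virtual knot diagram is an oriented immersed circle in $\mathbb{R}^2$ with finitely many transverse double points, each marked as a classical crossing (with over/under information) or as a virtual crossing. Virtual knots are virtual knot diagrams modulo the extended Reidemeister moves. The Gauss diagram of a diagram is a counterclockwise oriented circle with, for each classical crossing, a chord joining its two preimages, directed from over to under (an "arrow") and decorated with the sign of the crossing. Two arrows intersect if their chords cross in the disk. Finite type: a singular virtual knot diagram is a virtual knot diagram in which some double points are marked as singular crossings. If $K$ has $n+1$ singular crossings and $\sigma\in\{0,1\}^{n+1}$, $K_\sigma$ is obtained by replacing the $l$-th singular crossing with a negative classical crossing if $\sigma_l=1$ and a positive one if $\sigma_l=0$; $|\sigma|$ is the number of nonzero entries. A virtual knot invariant $v$ with values in an abelian group is finite-type of degree $\leq n$ if $\sum_{\sigma}(-1)^{|\sigma|}v(K_\sigma)=0$ for all diagrams $K$ with $n+1$ singular crossings. Definition of $\phi_{i,j,k}$: if arrows $x$ and $c$ intersect, $int_c(x)=+1$ if, with $c$ drawn pointing upward, $x$ crosses $c$ from left to right, and $-1$ otherwise. Let $D$ be a Gauss diagram and $D'$ a subdiagram consisting of two non-intersecting arrows; $sign(D')$ is the product of their signs. The chords cut the disk into a middle region (adjacent to both arrows) and two outer regions (each adjacent to one arrow). The outer arc of an arrow is the circle arc bounding its outer region. An arrow of $D'$ is of type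 t if traversing its outer arc counterclockwise goes from its tail to its head, and of type h otherwise. For two regions $A_p,A_q$ let $C_{p,q}$ be the set of arrows of $D$ (not in $D'$) with one endpoint on the boundary arcs of $A_p$ and one on those of $A_q$, let $a_{pq}$ be the arrow of $D'$ separating them if they are adjacent and either arrow of $D'$ if both are outer, and label the pair of regions with $w_{pq}=\left|\sum_{c\in C_{p,q}}sign(c)\,int_{a_{pq}}(c)\right|$. Put $\langle F_{i,j,k},D'\rangle=sign(D')$ if one of the following holds, and $0$ otherwise: (M) $D'$ has one t-arrow and one h-arrow, the pair (outer region of the t-arrow, middle) has label $i$, the pair (middle, outer region of the h-arrow) has label $j$, and the pair of outer regions has label $k$; (TT) both arrows are of type t, the pair of outer regions has label $i$, and the two (middle, outer) pairs have labels $j,k$ in some order; (HH) both arrows are of type h, the pair of outer regions has label $j$, and the two (middle, outer) pairs have labels $i,k$ in some order. Then $\phi_{i,j,k}(K)=\sum_{D'\subset D}\langle F_{i,j,k},D'\rangle$, the sum over all subdiagrams with two non-intersecting arrows of a Gauss diagram $D$ of $K$. For distinct $i,j,k$ this is an invariant of virtual knots. *)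

theory Defs
  imports "HOL-Analysis.Analysis"
begin

section \<open>Singular virtual knot diagrams\<close>

text \<open>
  The plane is the complex plane and the circle is the reals modulo 1, with fundamental domain
  \<open>{0..<1}\<close>. A diagram is a 1-periodic immersion \<open>curve\<close> together with a label \<open>mark t\<close> for the
  passage of the curve at time \<open>t\<close>. Only the labels at the preimages of double points carry
  information; over/under information is recorded by which of the two passages is \<open>Over\<close>.
\<close>

datatype passage = Over | Under | Virtual | Singular

datatype diagram = Diagram (curve: "real \<Rightarrow> complex") (mark: "real \<Rightarrow> passage")

definition vel :: "diagram \<Rightarrow> real \<Rightarrow> complex" where
  "vel K t = vector_derivative (curve K) (at t)"

text \<open>The determinant of two plane vectors: positive iff \<open>(z, w)\<close> is a positively oriented basis.\<close>

definition cross2 :: "complex \<Rightarrow> complex \<Rightarrow> real" where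
  "cross2 z w = Re z * Im w - Im z * Re w"

definition crossing :: "diagram \<Rightarrow> real \<Rightarrow> real \<Rightarrow> bool" where
  "crossing K s t \<longleftrightarrow> s \<in> {0..<1} \<and> t \<in> {0..<1} \<and> s \<noteq> t \<and> curve K s = curve K t"

definition singular_diagram :: "diagram \<Rightarrow> bool" where
  "singular_diagram K \<longleftrightarrow>
     (\<forall>t. curve K (t + 1) = curve K t \<and> mark K (t + 1) = mark K t) \<and>
     curve K C1_differentiable_on UNIV \<and> (\<forall>t. vel K t \<noteq> 0) \<and>
     finite {(s, t). crossing K s t} \<and>
     (\<forall>s t. crossing K s t \<longrightarrow> cross2 (vel K s) (vel K t) \<noteq> 0) \<and>
     (\<forall>s t u. crossing K s t \<and> crossing K s u \<longrightarrow> t = u) \<and>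
     (\<forall>s t. crossing K s t \<longrightarrow>
        (mark K s, mark K t) \<in>
          {(Over, Under), (Under, Over), (Virtual, Virtual), (Singular, Singular)})"

definition singular_points :: "diagram \<Rightarrow> complex set" where
  "singular_points K = {curve K s |s t. crossing K s t \<and> mark K s = Singular}"

definition virtual_diagram :: "diagram \<Rightarrow> bool" where
  "virtual_diagram K \<longleftrightarrow> singular_diagram K \<and> singular_points K = {}"

text \<open>
  A classical crossing is positive iff (direction of the over passage, direction of the under
  passage) is a positively oriented basis. \<open>resolve K S\<close> replaces the singular crossings in \<open>S\<close> by
  negative classical crossings and all other singular crossings by positive ones. In the
  existential, \<open>s\<close> is forced to be a parameter of the other passage through the double point,
  because \<open>cross2 (vel K t) (vel K t) = 0\<close>.
\<close>

definition resolve :: "diagram \<Rightarrow> complex set \<Rightarrow> diagram" where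
  "resolve K S = Diagram (curve K) (\<lambda>t.
     if mark K t = Singular then
       if \<exists>s. curve K s = curve K t \<and>
              (if curve K t \<in> S then cross2 (vel K t) (vel K s) < 0
               else cross2 (vel K t) (vel K s) > 0)
       then Over else Under
     else mark K t)"


section \<open>Virtual knots: extended Reidemeister moves\<close>

text \<open>
  Planar isotopy and reparametrization. Every orientation preserving \<open>C\<^sup>1\<close> diffeomorphism of the
  plane is isotopic to the identity, so diffeomorphisms are used in place of isotopies.
\<close>

definition plane_diffeo :: "(complex \<Rightarrow> complex) \<Rightarrow> bool" where
  "plane_diffeo h \<longleftrightarrow> bij h \<and>
     (\<exists>h'. (\<forall>z. (h has_derivative h' z) (at z)) \<and>
           (\<forall>w. continuous_on UNIV (\<lambda>z. h' z w)) \<and>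
           (\<forall>z. cross2 (h' z 1) (h' z \<i>) > 0))"

definition circle_diffeo :: "(real \<Rightarrow> real) \<Rightarrow> bool" where
  "circle_diffeo r \<longleftrightarrow> r C1_differentiable_on UNIV \<and>
     (\<forall>t. r (t + 1) = r t + 1) \<and> (\<forall>t. vector_derivative r (at t) > 0)"

definition isotopic :: "diagram \<Rightarrow> diagram \<Rightarrow> bool" where
  "isotopic D E \<longleftrightarrow> (\<exists>h r. plane_diffeo h \<and> circle_diffeo r \<and>
     (\<forall>t. curve E t = h (curve D (r t))) \<and>
     (\<forall>s t. crossing E s t \<longrightarrow> mark E s = mark D (r s)))"

text \<open>
  \<open>D\<close> and \<open>E\<close> agree except inside a closed disc \<open>B\<close>, which both meet exactly in the \<open>n\<close> strands
  parametrized by the disjoint intervals \<open>I 0, \<dots>, I (n - 1)\<close>. That no interval contains the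
  base point 0 is no restriction, since the parameter can be shifted by \<open>circle_diffeo\<close>.
\<close>

definition local_change :: "nat \<Rightarrow> (nat \<Rightarrow> real set) \<Rightarrow> diagram \<Rightarrow> diagram \<Rightarrow> bool" where
  "local_change n I D E \<longleftrightarrow>
     (\<forall>m<n. \<exists>l u. 0 < l \<and> l < u \<and> u < 1 \<and> I m = {l..u}) \<and>
     (\<forall>m<n. \<forall>m'<n. m \<noteq> m' \<longrightarrow> I m \<inter> I m' = {}) \<and>
     (\<exists>B. B homeomorphic (cball 0 1 :: complex set) \<and>
        (\<forall>t\<in>{0..<1}.
           if t \<in> (\<Union>m<n. I m) then curve D t \<in> B \<and> curve E t \<in> B
           else curve E t = curve D t \<and> mark E t = mark D t \<and> curve D t \<notin> B))"

text \<open>First moves, classical or virtual: a kink of any kind is created on one strand.\<close>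

definition move1 :: "diagram \<Rightarrow> diagram \<Rightarrow> bool" where
  "move1 D E \<longleftrightarrow> (\<exists>I. local_change 1 I D E \<and>
     inj_on (curve D) (I 0) \<and>
     (\<exists>a b. {(s, t). s \<in> I 0 \<and> t \<in> I 0 \<and> s < t \<and> curve E s = curve E t} = {(a, b)}))"

text \<open>
  Second moves, classical or virtual: two strands with no crossing become two strands crossing
  each other exactly twice. That the two crossings have opposite orientation (hence opposite signs
  in the classical case) is automatic for strands in a disc that can be pulled apart; it is listed
  so that the effect of the move on crossings is explicit.
\<close>

definition move2 :: "diagram \<Rightarrow> diagram \<Rightarrow> bool" where
  "move2 D E \<longleftrightarrow> (\<exists>I. local_change 2 I D E \<and>
     inj_on (curve D) (I 0 \<union> I 1) \<and>
     inj_on (curve E) (I 0) \<and> inj_on (curve E) (I 1) \<and>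
     (\<exists>a a' b b'. a \<noteq> a' \<and>
        {(s, t). s \<in> I 0 \<and> t \<in> I 1 \<and> curve E s = curve E t} = {(a, b), (a', b')} \<and>
        cross2 (vel E a) (vel E b) * cross2 (vel E a') (vel E b') < 0 \<and>
        (mark E a = Over \<and> mark E a' = Over \<or> mark E a = Virtual \<and> mark E a' = Virtual)))"

text \<open>
  Three strands \<open>I 0, I 1, I 2\<close>, any two of which cross exactly once; \<open>p m n\<close> is the parameter on
  strand \<open>m\<close> of its crossing with strand \<open>n\<close>.
\<close>

definition triangle :: "diagram \<Rightarrow> (nat \<Rightarrow> real set) \<Rightarrow> (nat \<Rightarrow> nat \<Rightarrow> real) \<Rightarrow> bool" where
  "triangle D I p \<longleftrightarrow>
     (\<forall>m<3. inj_on (curve D) (I m)) \<and>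
     (\<forall>m<3. \<forall>n<3. m \<noteq> n \<longrightarrow>
        {(s, t). s \<in> I m \<and> t \<in> I n \<and> curve D s = curve D t} = {(p m n, p n m)})"

text \<open>
  Going around the triangle, strand \<open>m\<close> is followed from its crossing with strand \<open>m - 1\<close> to its
  crossing with strand \<open>m + 1\<close> (indices modulo 3), in its own direction or against it, and one
  turns to the same side at all three corners. This holds automatically for three strands in a disc
  any two of which cross once.
\<close>

definition convex_triangle :: "diagram \<Rightarrow> (nat \<Rightarrow> nat \<Rightarrow> real) \<Rightarrow> bool" where
  "convex_triangle D p \<longleftrightarrow>
     (let d = (\<lambda>m. sgn (p m ((m + 1) mod 3) - p m ((m + 2) mod 3)));
          turn = (\<lambda>m. d m * d ((m + 1) mod 3) *
                    sgn (cross2 (vel D (p m ((m + 1) mod 3))) (vel D (p ((m + 1) mod 3) m))))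
      in turn 0 = turn 1 \<and> turn 1 = turn 2)"

text \<open>
  Third moves: classical (strand 0 on top, strand 2 at the bottom), virtual, and mixed (strand 2
  entirely virtual). The numbering of the strands is arbitrary. The two moves with
  exactly two classical crossings are not allowed. The order of the two crossings is reversed on
  each strand. Equality of the orientations of corresponding crossings is automatic, because they
  are determined by the position of the end points of the strands on the boundary of the disc.
\<close>

definition move3 :: "diagram \<Rightarrow> diagram \<Rightarrow> bool" where
  "move3 D E \<longleftrightarrow> (\<exists>I p q. local_change 3 I D E \<and>
     triangle D I p \<and> triangle E I q \<and> convex_triangle D p \<and> convex_triangle E q \<and>
     (\<forall>m<3. \<forall>n<3. \<forall>k<3. m \<noteq> n \<and> n \<noteq> k \<and> m \<noteq> k \<longrightarrow> (p m n < p m k \<longleftrightarrow> q m k < q m n)) \<and>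
     (\<forall>m<3. \<forall>n<3. m \<noteq> n \<longrightarrow> mark E (q m n) = mark D (p m n) \<and>
        sgn (cross2 (vel E (q m n)) (vel E (q n m))) =
        sgn (cross2 (vel D (p m n)) (vel D (p n m)))) \<and>
     (mark D (p 0 1) = Over \<and> mark D (p 0 2) = Over \<and> mark D (p 1 2) = Over \<or>
      mark D (p 0 1) = Virtual \<and> mark D (p 0 2) = Virtual \<and> mark D (p 1 2) = Virtual \<or>
      mark D (p 0 1) = Over \<and> mark D (p 0 2) = Virtual \<and> mark D (p 1 2) = Virtual))"

definition elementary_move :: "diagram \<Rightarrow> diagram \<Rightarrow> bool" where
  "elementary_move D E \<longleftrightarrow> virtual_diagram D \<and> virtual_diagram E \<and>
     (isotopic D E \<or> move1 D E \<or> move2 D E \<or> move3 D E)"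

definition same_virtual_knot :: "diagram \<Rightarrow> diagram \<Rightarrow> bool" where
  "same_virtual_knot = equivclp elementary_move"

definition virtual_knot_invariant :: "(diagram \<Rightarrow> 'a) \<Rightarrow> bool" where
  "virtual_knot_invariant v \<longleftrightarrow>
     (\<forall>D E. virtual_diagram D \<and> virtual_diagram E \<and> same_virtual_knot D E \<longrightarrow> v D = v E)"


section \<open>Finite type invariants\<close>

text \<open>A subset \<open>S\<close> of the singular points encodes the \<open>\<sigma>\<close> that is 1 exactly on \<open>S\<close>.\<close>

definition finite_type_le :: "nat \<Rightarrow> (diagram \<Rightarrow> 'a::ab_group_add) \<Rightarrow> bool" where
  "finite_type_le n v \<longleftrightarrow> virtual_knot_invariant v \<and>
     (\<forall>K. singular_diagram K \<and> card (singular_points K) = n + 1 \<longrightarrow>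
        (\<Sum>S\<in>Pow (singular_points K).
           if even (card S) then v (resolve K S) else - v (resolve K S)) = 0)"


section \<open>Gauss diagrams\<close>

datatype arrow = Arrow (tail: real) (head: real) (asign: int)

definition gauss_diagram :: "diagram \<Rightarrow> arrow set" where
  "gauss_diagram K =
     {Arrow s t (if cross2 (vel K s) (vel K t) > 0 then 1 else - 1) |s t.
        crossing K s t \<and> mark K s = Over \<and> mark K t = Under}"

text \<open>The open arc of the circle traversed when going counterclockwise from \<open>a\<close> to \<open>b\<close>.\<close>

definition arc_ccw :: "real \<Rightarrow> real \<Rightarrow> real set" where
  "arc_ccw a b = (if a < b then {a<..<b} else {a<..<1} \<union> {0..<b})"

definition intersects :: "arrow \<Rightarrow> arrow \<Rightarrow> bool" where
  "intersects x c \<longleftrightarrow>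
     (tail x \<in> arc_ccw (tail c) (head c) \<and> head x \<in> arc_ccw (head c) (tail c) \<or>
      head x \<in> arc_ccw (tail c) (head c) \<and> tail x \<in> arc_ccw (head c) (tail c))"

text \<open>
  For intersecting \<open>x\<close> and \<open>c\<close>: when \<open>c\<close> points upward, the arc going counterclockwise from its
  tail to its head is on the right.
\<close>

definition int_num :: "arrow \<Rightarrow> arrow \<Rightarrow> int" where
  "int_num c x = (if head x \<in> arc_ccw (tail c) (head c) then 1 else - 1)"

text \<open>For non-intersecting \<open>a\<close> and \<open>b\<close>: the side of \<open>a\<close> that does not contain \<open>b\<close>.\<close>

definition outer_arc :: "arrow \<Rightarrow> arrow \<Rightarrow> real set" where
  "outer_arc a b =
     (if tail b \<in> arc_ccw (tail a) (head a) then arc_ccw (head a) (tail a)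
      else arc_ccw (tail a) (head a))"

definition middle_arcs :: "arrow \<Rightarrow> arrow \<Rightarrow> real set" where
  "middle_arcs a b =
     {0..<1} - (outer_arc a b \<union> outer_arc b a \<union> {tail a, head a, tail b, head b})"

definition type_t :: "arrow \<Rightarrow> arrow \<Rightarrow> bool" where
  "type_t a b \<longleftrightarrow> outer_arc a b = arc_ccw (tail a) (head a)"

definition type_h :: "arrow \<Rightarrow> arrow \<Rightarrow> bool" where
  "type_h a b \<longleftrightarrow> \<not> type_t a b"

definition connecting :: "arrow set \<Rightarrow> real set \<Rightarrow> real set \<Rightarrow> arrow set" where
  "connecting D P Q = {c \<in> D. tail c \<in> P \<and> head c \<in> Q \<or> tail c \<in> Q \<and> head c \<in> P}"

definition label :: "arrow set \<Rightarrow> arrow \<Rightarrow> real set \<Rightarrow> real set \<Rightarrow> nat" where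
  "label D a P Q = nat \<bar>\<Sum>c\<in>connecting D P Q. asign c * int_num a c\<bar>"

text \<open>
  For the subdiagram \<open>{a, b}\<close> of \<open>D\<close>: \<open>w_mid D a b\<close> is the label of the pair (outer region of
  \<open>a\<close>, middle region), \<open>w_out D a b\<close> that of the pair of outer regions. The latter does not depend
  on which of \<open>a\<close>, \<open>b\<close> is used to count. As the arcs are open, \<open>a\<close> and \<open>b\<close> are never counted.
\<close>

definition w_mid :: "arrow set \<Rightarrow> arrow \<Rightarrow> arrow \<Rightarrow> nat" where
  "w_mid D a b = label D a (outer_arc a b) (middle_arcs a b)"

definition w_out :: "arrow set \<Rightarrow> arrow \<Rightarrow> arrow \<Rightarrow> nat" where
  "w_out D a b = label D a (outer_arc a b) (outer_arc b a)"

definition matches_F :: "nat \<Rightarrow> nat \<Rightarrow> nat \<Rightarrow> arrow set \<Rightarrow> arrow \<Rightarrow> arrow \<Rightarrow> bool" where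
  "matches_F i j k D a b \<longleftrightarrow>
     type_t a b \<and> type_h b a \<and> w_mid D a b = i \<and> w_mid D b a = j \<and> w_out D a b = k \<or>
     type_t a b \<and> type_t b a \<and> w_out D a b = i \<and> w_mid D a b = j \<and> w_mid D b a = k \<or>
     type_h a b \<and> type_h b a \<and> w_out D a b = j \<and> w_mid D a b = i \<and> w_mid D b a = k"

definition pairing_F :: "nat \<Rightarrow> nat \<Rightarrow> nat \<Rightarrow> arrow set \<Rightarrow> arrow set \<Rightarrow> int" where
  "pairing_F i j k D D' =
     (if \<exists>a b. D' = {a, b} \<and> a \<noteq> b \<and> matches_F i j k D a b then \<Prod>c\<in>D'. asign c else 0)"

definition phi :: "nat \<Rightarrow> nat \<Rightarrow> nat \<Rightarrow> diagram \<Rightarrow> int" where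
  "phi i j k K =
     (\<Sum>D' | \<exists>a b. D' = {a, b} \<and> a \<noteq> b \<and> D' \<subseteq> gauss_diagram K \<and> \<not> intersects a b.
        pairing_F i j k (gauss_diagram K) D')"

end

theory Submission
  imports Defs
begin

text \<open>
  Replacing a negative classical crossing by a positive one at the same double point reverses its
  arrow and changes its sign. The product \<open>sign(c) int(c)\<close>, and with it every label in the
  definition of \<open>\<phi>\<close>, is unaffected. So every double point has an orientation, which can be read
  off the immersed curve, and the labels are signed counts of double points between two arcs of the
  circle; over/under information enters only through the types and the signs of the two arrows of
  the chosen pair. A Gauss diagram is therefore encoded as a \<open>chords\<close> structure: finitely many
  points on a circle, an involution \<open>mate\<close>, an orientation \<open>ori\<close> that is antisymmetric under
  \<open>mate\<close>, and a bit \<open>over\<close> that only tells which end of a chord is the tail. With \<open>index s\<close> the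
  number of chords leaving the arc from \<open>s\<close> to its mate and \<open>link s t\<close> the number of those that
  end on the arc of \<open>t\<close>, the three labels of a pair of disjoint chords are the absolute values of
  \<open>index s - link s t\<close>, \<open>index t + link s t\<close> and \<open>link s t\<close>, and \<open>\<phi>\<close> becomes a sum over ordered pairs of
  points (\<open>phi_eq_phi_chords\<close>).

  Degree at most two. In the alternating sum over the resolutions of three singular points, the
  contribution of a fixed pair of chords depends on the resolution of at most two of these points,
  so it cancels (\<open>phi_finite_type_2\<close>).

  Not degree at most one. For two singular points the same argument leaves only the pairs formed by
  those two chords. The sign of the resolution cancels against the product of the signs of the
  arrows, so every remaining term is 0 or 1 (\<open>not_finite_type_1\<close>), and it is enough to find one
  diagram in which the two singular chords are disjoint and have labels \<open>i\<close>, \<open>j\<close> and \<open>k\<close>. A rosette,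
  that is, a curve that winds three times around the origin while its radius oscillates, has many
  double points between any two of the three arcs bounded by two disjoint chords. Declaring the right ones
  classical and all others virtual produces any prescribed labels (\<open>phi_not_finite_type_1\<close>).

  Invariance. The first and second moves add chords whose two ends, or whose ends in pairs, are
  adjacent on the circle; the pairs containing them either cancel or have two labels 0, which cannot
  both occur among the distinct numbers \<open>i\<close>, \<open>j\<close>, \<open>k\<close> (\<open>phi_chords_kink\<close>,
  \<open>phi_chords_bigon\<close>). In the third move three chords pairwise share adjacent ends, and the move exchanges the
  two points on each of the three strands. Labels and contributions of pairs with at most one of the three chords
  are unchanged. Each of the three pairs inside the triangle is disjoint on exactly one side of the
  move, and all three see the same three labels, because the third chord makes up
  for the exchange of the end points. The identity that remains to be checked is \<open>weight_triangle\<close>: it is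
  the reason for the shape of the formula \<open>F\<close>, and it uses that the three strands are not
  cyclically stacked (\<open>phi_chords_triangle\<close>).
\<close>

section \<open>Chord diagrams on a cyclically ordered set\<close>

definition cyc :: "real \<Rightarrow> real \<Rightarrow> real \<Rightarrow> bool" where
  "cyc a b c \<longleftrightarrow> a < b \<and> b < c \<or> b < c \<and> c < a \<or> c < a \<and> a < b"

text \<open>
  Points are kept apart from their positions, so that the two sides of the third move can be compared
  on one set of points with two position functions. Only the cyclic order of positions matters.
\<close>

datatype 'a chords = Chords (points: "'a set") (pos: "'a \<Rightarrow> real") (mate: "'a \<Rightarrow> 'a")
  (ori: "'a \<Rightarrow> int") (over: "'a \<Rightarrow> bool")

definition btw :: "'a chords \<Rightarrow> 'a \<Rightarrow> 'a \<Rightarrow> 'a \<Rightarrow> bool" where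
  "btw G x y z \<longleftrightarrow> cyc (pos G x) (pos G y) (pos G z)"

text \<open>
  Both numbers count ends of chords on the arc from \<open>s\<close> to its mate, with orientation. Chords with
  both ends on that arc cancel in \<open>index\<close>, because \<open>ori\<close> is antisymmetric under \<open>mate\<close>. So \<open>index s\<close>
  counts the chords that leave the arc of \<open>s\<close>, and \<open>link s t\<close> those that run from it to the arc of \<open>t\<close>.
\<close>

definition index :: "'a chords \<Rightarrow> 'a \<Rightarrow> int" where
  "index G s = (\<Sum>x\<in>points G. if btw G s x (mate G s) then ori G x else 0)"

definition link :: "'a chords \<Rightarrow> 'a \<Rightarrow> 'a \<Rightarrow> int" where
  "link G s t = (\<Sum>x\<in>points G.
     if btw G s x (mate G s) \<and> btw G t (mate G x) (mate G t) then ori G x else 0)"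

text \<open>
  Two chords are disjoint, and their outer arcs are those from \<open>s\<close> and from \<open>t\<close> to their mates. For
  disjoint chords this determines the ends \<open>s\<close> and \<open>t\<close> of the two chords.
\<close>

definition apart :: "'a chords \<Rightarrow> 'a \<Rightarrow> 'a \<Rightarrow> bool" where
  "apart G s t \<longleftrightarrow> btw G s (mate G s) t \<and> btw G t (mate G t) s"

text \<open>
  The outer arc of \<open>s\<close> leads from tail to head iff \<open>s\<close> is the over end, so \<open>p\<close> and \<open>r\<close> are the types t/h
  of the two arrows. The sign of an arrow is the orientation of its tail, which is the
  negative of that of \<open>s\<close> for type h; this is where the value \<open>- 1\<close> for mixed types comes from. The
  mixed case is listed in the order (t, h) only, and the two other cases fix which of the middle labels
  belongs to the first arrow: for distinct \<open>i\<close>, \<open>j\<close>, \<open>k\<close> exactly one of the two orders of a matching pair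
  contributes.
\<close>

definition weight :: "nat \<Rightarrow> nat \<Rightarrow> nat \<Rightarrow> bool \<Rightarrow> bool \<Rightarrow> int \<Rightarrow> int \<Rightarrow> int \<Rightarrow> int" where
  "weight i j k p r A B C =
    (if p \<and> \<not> r \<and> \<bar>A\<bar> = int i \<and> \<bar>B\<bar> = int j \<and> \<bar>C\<bar> = int k then - 1
     else if p \<and> r \<and> \<bar>C\<bar> = int i \<and> \<bar>A\<bar> = int j \<and> \<bar>B\<bar> = int k then 1
     else if \<not> p \<and> \<not> r \<and> \<bar>C\<bar> = int j \<and> \<bar>A\<bar> = int i \<and> \<bar>B\<bar> = int k then 1 else 0)"

definition pair_term :: "nat \<Rightarrow> nat \<Rightarrow> nat \<Rightarrow> 'a chords \<Rightarrow> 'a \<Rightarrow> 'a \<Rightarrow> int" where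
  "pair_term i j k G s t =
    (if apart G s t then
       ori G s * ori G t * weight i j k (over G s) (over G t)
         (index G s - link G s t) (index G t + link G s t) (link G s t)
     else 0)"

definition phi_chords :: "nat \<Rightarrow> nat \<Rightarrow> nat \<Rightarrow> 'a chords \<Rightarrow> int" where
  "phi_chords i j k G = (\<Sum>s\<in>points G. \<Sum>t\<in>points G. pair_term i j k G s t)"

text \<open>Of the distinct numbers \<open>i\<close>, \<open>j\<close>, \<open>k\<close> at most one is 0.\<close>

lemma weight_two_zero:
  assumes "i \<noteq> j" "j \<noteq> k" "i \<noteq> k" "A = 0 \<and> B = 0 \<or> A = 0 \<and> C = 0 \<or> B = 0 \<and> C = 0"
  shows "weight i j k p r A B C = 0"
  using assms unfolding weight_def by auto

lemma weight_abs_cong: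
  "\<bar>A\<bar> = \<bar>A'\<bar> \<Longrightarrow> \<bar>B\<bar> = \<bar>B'\<bar> \<Longrightarrow> \<bar>C\<bar> = \<bar>C'\<bar> \<Longrightarrow> weight i j k p r A B C = weight i j k p r A' B' C'"
  by (simp add: weight_def)

lemma weight_triangle_aux:
  fixes a b c i j k :: 'b
  defines "w p r A B C \<equiv> (if p \<and> \<not> r \<and> A = i \<and> B = j \<and> C = k then - 1
     else if p \<and> r \<and> C = i \<and> A = j \<and> B = k then 1
     else if \<not> p \<and> \<not> r \<and> C = j \<and> A = i \<and> B = k then 1 else (0 :: int))"
  assumes d: "i \<noteq> j" "j \<noteq> k" "i \<noteq> k" and t: "\<not> (p = q \<and> q = r)"
  shows "w p q a b c + w q p b a c + (w q r c a b + w r q a c b) + (w r p b c a + w p r c b a) = 0"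
proof -
  have "(p, q, r) \<in> {(True,True,False),(True,False,True),(False,True,True),
                      (True,False,False),(False,True,False),(False,False,True)}"
    using t by (cases p; cases q; cases r) auto
  moreover have "a = i \<and> b = j \<and> c = k \<or> a = i \<and> c = j \<and> b = k \<or> b = i \<and> a = j \<and> c = k \<or>
    b = i \<and> c = j \<and> a = k \<or> c = i \<and> a = j \<and> b = k \<or> c = i \<and> b = j \<and> a = k \<or>
    \<not> (a = i \<and> b = j \<and> c = k \<or> a = i \<and> c = j \<and> b = k \<or> b = i \<and> a = j \<and> c = k \<or>
    b = i \<and> c = j \<and> a = k \<or> c = i \<and> a = j \<and> b = k \<or> c = i \<and> b = j \<and> a = k)"
    by argo
  ultimately show ?thesis
    using d d[symmetric] unfolding w_def insert_iff empty_iff prod.inject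
    by (elim disjE conjE FalseE; simp)
qed

text \<open>
  The algebraic heart of the third move. The three chords of a triangle have over bits \<open>p\<close>, \<open>q\<close>, \<open>r\<close>, the three arcs
  between its strands are joined by \<open>A\<close>, \<open>B\<close> and \<open>C\<close> chords, and every pair of chords contributes
  in both orders. If exactly one bit is different, the odd chord forms a mixed pair with each
  of the two others, and the two mixed contributions cancel those of the pair of equal type. With
  three equal bits no mixed pair exists and nothing cancels.
\<close>

lemma weight_triangle:
  assumes "i \<noteq> j" "j \<noteq> k" "i \<noteq> k" "\<not> (p = q \<and> q = r)"
  shows "weight i j k p q A B C + weight i j k q p B A C
       + (weight i j k q r C A B + weight i j k r q A C B)
       + (weight i j k r p B C A + weight i j k p r C B A) = 0"
  unfolding weight_def
  by (rule weight_triangle_aux) (use assms in auto)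

lemma cyc_adjacent:
  assumes "cyc u v x" "cyc u v y" 
  shows "cyc x u y = cyc x v y"
  using assms unfolding cyc_def by linarith

lemma btw_rotate: "btw G x y z \<Longrightarrow> btw G y z x"
  unfolding btw_def cyc_def by auto

lemma btw_rotate_iff: "btw G y z x \<longleftrightarrow> btw G x y z"
  unfolding btw_def cyc_def by auto

lemma btw_asym: "btw G x y z \<Longrightarrow> \<not> btw G x z y"
  unfolding btw_def cyc_def by auto

lemma btw_trans: "btw G x y z \<Longrightarrow> btw G x z w \<Longrightarrow> btw G x y w"
  unfolding btw_def cyc_def by auto

lemma btw_irrefl [simp]: "\<not> btw G x x y" "\<not> btw G x y x" "\<not> btw G y x x"
  unfolding btw_def cyc_def by auto

text \<open>
  No point of the diagram lies between \<open>u\<close> and \<open>v\<close> on one of the two arcs that they bound; \<open>b\<close> says that this is the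
  arc from \<open>u\<close> to \<open>v\<close>.
\<close>

definition adjacent :: "'a chords \<Rightarrow> 'a \<Rightarrow> 'a \<Rightarrow> bool \<Rightarrow> bool" where
  "adjacent G u v b \<longleftrightarrow> u \<in> points G \<and> v \<in> points G \<and> u \<noteq> v \<and>
     (\<forall>x\<in>points G - {u, v}. btw G u v x = b)"

locale chord_diagram =
  fixes G :: "'a chords"
  assumes finite_points [simp]: "finite (points G)"
    and pos_inj: "inj_on (pos G) (points G)"
    and mate_in [simp]: "x \<in> points G \<Longrightarrow> mate G x \<in> points G"
    and mate_mate [simp]: "x \<in> points G \<Longrightarrow> mate G (mate G x) = x"
    and mate_neq [simp]: "x \<in> points G \<Longrightarrow> mate G x \<noteq> x"
    and ori_mate [simp]: "x \<in> points G \<Longrightarrow> ori G (mate G x) = - ori G x"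
    and over_mate [simp]: "x \<in> points G \<Longrightarrow> over G (mate G x) \<longleftrightarrow> \<not> over G x"
    and ori_unit: "x \<in> points G \<Longrightarrow> ori G x = 1 \<or> ori G x = - 1"
begin

lemma btw_total:
  assumes "x \<in> points G" "y \<in> points G" "z \<in> points G" "x \<noteq> y" "y \<noteq> z" "x \<noteq> z"
  shows "btw G x z y \<longleftrightarrow> \<not> btw G x y z"
proof -
  have "pos G x \<noteq> pos G y" "pos G y \<noteq> pos G z" "pos G x \<noteq> pos G z"
    using assms inj_onD[OF pos_inj] by blast+
  then show ?thesis unfolding btw_def cyc_def by auto
qed

lemma sum_mate: "(\<Sum>x\<in>points G. f (mate G x)) = (\<Sum>x\<in>points G. f x)"
  by (rule sum.reindex_bij_witness[where i = "mate G" and j = "mate G"]) auto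

lemma sum_mate_antisym:
  assumes "\<And>x. x \<in> points G \<Longrightarrow> f (mate G x) = - f x"
  shows "(\<Sum>x\<in>points G. f x) = (0::int)"
proof -
  have "(\<Sum>x\<in>points G. f x) = (\<Sum>x\<in>points G. f (mate G x))" by (simp add: sum_mate)
  also have "\<dots> = (\<Sum>x\<in>points G. - f x)" by (rule sum.cong) (simp_all add: assms)
  also have "\<dots> = - (\<Sum>x\<in>points G. f x)" by (simp add: sum_negf)
  finally show ?thesis by simp
qed

lemma link_antisym: "link G s t = - link G t s"
proof -
  have "link G t s = (\<Sum>x\<in>points G. if btw G t (mate G x) (mate G t) \<and>
      btw G s (mate G (mate G x)) (mate G s) then ori G (mate G x) else 0)"
    unfolding link_def
    by (subst sum_mate[symmetric]) simp
  also have "\<dots> = (\<Sum>x\<in>points G. - (if btw G s x (mate G s) \<and> btw G t (mate G x) (mate G t)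
      then ori G x else 0))"
    by (rule sum.cong) auto
  finally show ?thesis by (simp add: link_def sum_negf)
qed

text \<open>
  A chord that leaves the arc of \<open>s\<close> ends on the arc of \<open>t\<close> or in the middle region, so the
  difference counts the chords between the outer region of \<open>s\<close> and the middle region.
\<close>

lemma index_minus_link:
  assumes "apart G s t" "s \<in> points G" "t \<in> points G"
  shows "index G s - link G s t = (\<Sum>x\<in>points G. if btw G s x (mate G s) \<and>
     \<not> btw G s (mate G x) (mate G s) \<and> \<not> btw G t (mate G x) (mate G t) then ori G x else 0)"
proof -
  let ?I = "\<lambda>x. btw G s x (mate G s)" and ?J = "\<lambda>x. btw G t x (mate G t)"
  have disj: "\<not> (?I x \<and> ?J x)" for x
    using assms(1) unfolding apart_def btw_def cyc_def by auto
  have "(\<Sum>x\<in>points G. if ?I x \<and> ?I (mate G x) then ori G x else 0) = 0"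
    by (rule sum_mate_antisym) auto
  moreover have "index G s = (\<Sum>x\<in>points G. if ?I x \<and> ?I (mate G x) then ori G x else 0)
     + link G s t + (\<Sum>x\<in>points G. if ?I x \<and> \<not> ?I (mate G x) \<and> \<not> ?J (mate G x) then ori G x else 0)"
    unfolding index_def link_def sum.distrib[symmetric]
    by (rule sum.cong) (use disj in auto)
  ultimately show ?thesis by simp
qed

lemma apart_sym: "apart G s t \<longleftrightarrow> apart G t s"
  unfolding apart_def by auto

text \<open>Adjacent points are on the same side of everything else and can replace each other.\<close>

lemma btw_adjacent:
  assumes "adjacent G u v b" "x \<in> points G - {u, v}" "y \<in> points G - {u, v}"
  shows "btw G x u y = btw G x v y" "btw G u x y = btw G v x y" "btw G x y u = btw G x y v"
proof -
  have uv: "u \<in> points G" "v \<in> points G" "u \<noteq> v"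
    and b: "btw G u v x = b" "btw G u v y = b"
    using assms unfolding adjacent_def by auto
  have *: "btw G x' u y' = btw G x' v y'" if "btw G u v x' = b" "btw G u v y' = b"
    "x' \<in> points G - {u, v}" "y' \<in> points G - {u, v}" for x' y'
  proof (cases b)
    case True
    then show ?thesis using cyc_adjacent that(1,2) unfolding btw_def by blast
  next
    case False
    then have "\<not> btw G u v x'" "\<not> btw G u v y'" using that by auto
    then have "btw G v u x'" "btw G v u y'"
      using btw_total[of u v x'] btw_total[of u v y'] uv that(3,4) 
      by (auto simp: btw_rotate_iff[of G x' v u] btw_rotate_iff[of G y' v u] btw_rotate_iff[of G u x' v] btw_rotate_iff[of G u y' v])
    then show ?thesis using cyc_adjacent[of "pos G v" "pos G u"] unfolding btw_def by blast
  qed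
  show "btw G x u y = btw G x v y" by (rule *[OF b assms(2,3)])
  have "btw G y u x = btw G y v x" by (rule *[OF b(2,1) assms(3,2)])
  then show "btw G u x y = btw G v x y" "btw G x y u = btw G x y v"
    by (metis btw_rotate)+
qed

lemma adjacent_sym: "adjacent G u v b \<Longrightarrow> adjacent G v u (\<not> b)"
  unfolding adjacent_def using btw_total btw_rotate_iff by (metis Diff_iff insert_commute insert_iff)

end

lemma phi_chords_iso:
  assumes g: "bij_betw g (points G) (points H)"
    and m: "\<And>x. x \<in> points G \<Longrightarrow> mate H (g x) = g (mate G x)"
    and mi: "\<And>x. x \<in> points G \<Longrightarrow> mate G x \<in> points G"
    and e: "\<And>x. x \<in> points G \<Longrightarrow> ori H (g x) = ori G x"
    and ov: "\<And>x. x \<in> points G \<Longrightarrow> over H (g x) = over G x"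
    and c: "\<And>x y z. x \<in> points G \<Longrightarrow> y \<in> points G \<Longrightarrow> z \<in> points G \<Longrightarrow>
              btw H (g x) (g y) (g z) = btw G x y z"
  shows "phi_chords i j k H = phi_chords i j k G"
proof -
  have ind: "index H (g s) = index G s" if "s \<in> points G" for s
    unfolding index_def
    by (subst sum.reindex_bij_betw[OF g, symmetric], rule sum.cong) (simp_all add: that m mi e c)
  have lk: "link H (g s) (g t) = link G s t" if "s \<in> points G" "t \<in> points G" for s t
    unfolding link_def
    by (subst sum.reindex_bij_betw[OF g, symmetric], rule sum.cong) (simp_all add: that m mi e c)
  have tm: "pair_term i j k H (g s) (g t) = pair_term i j k G s t"
    if "s \<in> points G" "t \<in> points G" for s t
    unfolding pair_term_def apart_def using that by (simp add: ind lk m mi e ov c)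
  have "phi_chords i j k H = (\<Sum>s\<in>points G. \<Sum>t\<in>points G. pair_term i j k H (g s) (g t))"
    unfolding phi_chords_def
    by (simp add: sum.reindex_bij_betw[OF g, symmetric]
        sum.reindex_bij_betw[OF g, of "\<lambda>s. \<Sum>t\<in>points G. pair_term i j k H s (g t)", symmetric])
  also have "\<dots> = phi_chords i j k G"
    unfolding phi_chords_def by (intro sum.cong refl) (simp add: tm)
  finally show ?thesis .
qed

section \<open>Kinks and bigons\<close>

lemma sum_union_both:
  fixes f :: "'a \<Rightarrow> 'a \<Rightarrow> int"
  assumes "finite Y" "finite T" "Y \<inter> T = {}"
  shows "(\<Sum>s\<in>Y \<union> T. \<Sum>t\<in>Y \<union> T. f s t) = (\<Sum>s\<in>Y. \<Sum>t\<in>Y. f s t)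
    + (\<Sum>s\<in>Y. \<Sum>t\<in>T. f s t) + (\<Sum>t\<in>Y. \<Sum>s\<in>T. f s t) + (\<Sum>s\<in>T. \<Sum>t\<in>T. f s t)"
proof -
  have "(\<Sum>s\<in>Y \<union> T. \<Sum>t\<in>Y \<union> T. f s t) = (\<Sum>s\<in>Y \<union> T. (\<Sum>t\<in>Y. f s t) + (\<Sum>t\<in>T. f s t))"
    using assms by (intro sum.cong refl) (simp add: sum.union_disjoint)
  also have "\<dots> = (\<Sum>s\<in>Y. \<Sum>t\<in>Y. f s t) + (\<Sum>s\<in>Y. \<Sum>t\<in>T. f s t)
      + ((\<Sum>s\<in>T. \<Sum>t\<in>Y. f s t) + (\<Sum>s\<in>T. \<Sum>t\<in>T. f s t))"
    using assms by (simp add: sum.union_disjoint sum.distrib)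
  also have "(\<Sum>s\<in>T. \<Sum>t\<in>Y. f s t) = (\<Sum>t\<in>Y. \<Sum>s\<in>T. f s t)" by (rule sum.swap)
  finally show ?thesis by simp
qed

text \<open>The effect of a first or second move: new chords \<open>T\<close> are inserted and nothing else changes.\<close>

locale extension = chord_diagram H for H :: "'a chords" +
  fixes G :: "'a chords" and T :: "'a set"
  assumes points_H: "points H = points G \<union> T"
    and new_points: "points G \<inter> T = {}"
    and mate_old: "x \<in> points G \<Longrightarrow> mate G x = mate H x" "x \<in> points G \<Longrightarrow> mate H x \<in> points G"
    and same: "pos G = pos H" "x \<in> points G \<Longrightarrow> ori G x = ori H x" "x \<in> points G \<Longrightarrow> over G x = over H x"
begin

lemma finite_parts [simp]: "finite (points G)" "finite T"
  using finite_points unfolding points_H by auto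

lemma old_in [simp]: "x \<in> points G \<Longrightarrow> x \<in> points H" and new_in [simp]: "x \<in> T \<Longrightarrow> x \<in> points H"
  by (auto simp: points_H)

lemma btw_same: "btw G = btw H"
  by (intro ext) (simp add: btw_def same)

lemma index_split:
  assumes "s \<in> points G"
  shows "index H s = index G s + (\<Sum>x\<in>T. if btw H s x (mate H s) then ori H x else 0)"
  unfolding index_def points_H using new_points assms
  by (subst sum.union_disjoint) (auto simp: btw_same mate_old same intro!: sum.cong)

lemma link_split:
  assumes "s \<in> points G" "t \<in> points G"
  shows "link H s t = link G s t + (\<Sum>x\<in>T. if btw H s x (mate H s) \<and> btw H t (mate H x) (mate H t)
     then ori H x else 0)"
  unfolding link_def points_H using new_points assms
  by (subst sum.union_disjoint) (auto simp: btw_same mate_old same intro!: sum.cong)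

lemma phi_chords_extension:
  assumes ind: "\<And>s. s \<in> points G \<Longrightarrow> (\<Sum>x\<in>T. if btw H s x (mate H s) then ori H x else 0) = 0"
    and lnk: "\<And>s t. s \<in> points G \<Longrightarrow> t \<in> points G \<Longrightarrow>
      (\<Sum>x\<in>T. if btw H s x (mate H s) \<and> btw H t (mate H x) (mate H t) then ori H x else 0) = 0"
    and new: "\<And>t. t \<in> points G \<Longrightarrow> (\<Sum>s\<in>T. pair_term i j k H s t) = 0"
      "\<And>s. s \<in> points G \<Longrightarrow> (\<Sum>t\<in>T. pair_term i j k H s t) = 0"
      "\<And>s t. s \<in> T \<Longrightarrow> t \<in> T \<Longrightarrow> pair_term i j k H s t = 0"
  shows "phi_chords i j k H = phi_chords i j k G"
proof -
  have tm: "pair_term i j k H s t = pair_term i j k G s t" if "s \<in> points G" "t \<in> points G" for s t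
    unfolding pair_term_def apart_def using that index_split link_split ind lnk
    by (simp add: btw_same mate_old same)
  show ?thesis
    unfolding phi_chords_def points_H sum_union_both[OF finite_parts new_points]
    by (simp add: tm new)
qed

end

text \<open>
  For a chord disjoint from the kink chord, the outer arc of the kink chord is the short one between
  its adjacent ends. It contains no point, so index and links vanish and two labels are 0.
\<close>

lemma phi_chords_kink:
  assumes ext: "extension H G {a, b}" and ab: "adjacent H a b d" "mate H a = b"
    and ijk: "i \<noteq> j" "j \<noteq> k" "i \<noteq> k"
  shows "phi_chords i j k H = phi_chords i j k G"
proof -
  interpret extension H G "{a, b}" by (rule ext)
  have neq: "a \<noteq> b" and ina: "a \<in> points H" and inb: "b \<in> points H" and mb: "mate H b = a"
    using ab by (auto simp: adjacent_def)
  have ob: "ori H b = - ori H a" using ori_mate[OF ina] ab by simp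
  have old: "x \<in> points H - {a, b}" if "x \<in> points G" for x
    using that new_points by auto
  have zero: "index H s = 0 \<and> link H s t = 0 \<and> link H t s = 0" if "s \<in> {a, b}" "apart H s t" "t \<in> points H" for s t
  proof -
    have "btw H s (mate H s) t" using that unfolding apart_def by auto
    then have t: "t \<in> points H - {a, b}" using that ab mb by auto
    have none: "\<not> btw H s x (mate H s)" if "x \<in> points H" for x
    proof (cases "x \<in> {a, b}")
      case False
      then have "btw H s (mate H s) x"
        using that t \<open>btw H s (mate H s) t\<close> \<open>s \<in> {a, b}\<close> ab mb adjacent_sym[OF ab(1)]
        unfolding adjacent_def by auto
      then show ?thesis by (rule btw_asym)
    qed (use \<open>s \<in> {a, b}\<close> ab mb in auto)
    then show ?thesis unfolding index_def link_def by simp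
  qed
  have term0: "pair_term i j k H s t = 0" if "s \<in> {a, b} \<or> t \<in> {a, b}" "s \<in> points H" "t \<in> points H" for s t
    unfolding pair_term_def using zero[of s t] zero[of t s] that weight_two_zero[OF ijk]
    by (auto simp: apart_sym)
  have same_side: "btw H s a t = btw H s b t" if "s \<in> points G" "t \<in> points G" for s t
    using btw_adjacent(1)[OF ab(1) old old] that by blast
  show ?thesis
    by (rule phi_chords_extension) (use neq same_side term0 ob ab mb in \<open>auto simp: mate_old\<close>)
qed

text \<open>
  Two chords, from \<open>a\<close> to \<open>b\<close> and from \<open>a'\<close> to \<open>b'\<close>, with adjacent ends and opposite orientations. The
  bits \<open>u\<close> and \<open>w\<close> leave open whether they cross. Exchanging the two ends of the chords, or
  the two chords, gives a bigon again, so that most facts are proved for one end only.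
\<close>

locale bigon = extension H G "{a, a', b, b'}" for H G :: "'a chords" and a a' b b' +
  fixes u w :: bool
  assumes adj_a: "adjacent H a a' u" and adj_b: "adjacent H b b' w"
    and mate_a: "mate H a = b" and mate_a': "mate H a' = b'"
    and ori_a': "ori H a' = - ori H a" and over_a': "over H a' = over H a"
    and distinct4: "distinct [a, a', b, b']"
begin

lemma in4 [simp]: "a \<in> points H" "a' \<in> points H" "b \<in> points H" "b' \<in> points H"
  by auto

lemma mates: "mate H b = a" "mate H b' = a'"
  using mate_mate mate_a mate_a' in4 by metis+

lemma swap_strands: "bigon H G b b' a a' w u"
proof -
  have eq: "{b, b', a, a'} = {a, a', b, b'}" by auto
  have "extension H G {b, b', a, a'}" unfolding eq by (rule extension_axioms)
  moreover have "ori H b' = - ori H b" "over H b' = over H b"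
    using ori_mate[of a] ori_mate[of a'] over_mate[of a] over_mate[of a'] mate_a mate_a' ori_a' over_a' by auto
  ultimately show ?thesis
    using adj_a adj_b mates distinct4 by (auto simp: bigon_def bigon_axioms_def)
qed

lemma swap_crossings: "bigon H G a' a b' b (\<not> u) (\<not> w)"
proof -
  have eq: "{a', a, b', b} = {a, a', b, b'}" by auto
  have "extension H G {a', a, b', b}" unfolding eq by (rule extension_axioms)
  then show ?thesis
    using adjacent_sym[OF adj_a] adjacent_sym[OF adj_b] mate_a mate_a' ori_a' over_a' distinct4
    by (auto simp: bigon_def bigon_axioms_def)
qed

lemma old: "x \<in> points G \<Longrightarrow> x \<in> points H - {a, a'}" "x \<in> points G \<Longrightarrow> x \<in> points H - {b, b'}"
  using new_points by auto

lemma ori_b: "ori H b = - ori H a" "ori H b' = ori H a"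
  using ori_mate[of a] ori_mate[of a'] mate_a mate_a' ori_a' by auto

lemma same_side:
  assumes "x \<in> points G" "y \<in> points G"
  shows "btw H x a y = btw H x a' y" "btw H x b y = btw H x b' y"
  using btw_adjacent(1)[OF adj_a, of x y] btw_adjacent(1)[OF adj_b, of x y] assms old by auto

lemma arc_same:
  assumes "x \<in> points G"
  shows "btw H a x b = btw H a' x b'" "btw H b x a = btw H b' x a'"
proof -
  have *: "x \<in> points H - {a, a'}" "x \<in> points H - {b, b'}" "b \<in> points H - {a, a'}" "a' \<in> points H - {b, b'}"
     "b' \<in> points H - {a, a'}" "a \<in> points H - {b, b'}"
    using assms old distinct4 by auto
  show "btw H a x b = btw H a' x b'"
    using btw_adjacent(2)[OF adj_a *(1) *(3)] btw_adjacent(3)[OF adj_b *(4) *(2)] by simp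
  show "btw H b x a = btw H b' x a'"
    using btw_adjacent(2)[OF adj_b *(2) *(6)] btw_adjacent(3)[OF adj_a *(5) *(1)] by simp
qed

lemma bits:
  "x \<in> points H - {a, a'} \<Longrightarrow> btw H a a' x = u" "x \<in> points H - {a, a'} \<Longrightarrow> btw H a' a x = (\<not> u)"
  "x \<in> points H - {b, b'} \<Longrightarrow> btw H b b' x = w" "x \<in> points H - {b, b'} \<Longrightarrow> btw H b' b x = (\<not> w)"
  using adj_a[unfolded adjacent_def] adj_b[unfolded adjacent_def]
    adjacent_sym[OF adj_a, unfolded adjacent_def] adjacent_sym[OF adj_b, unfolded adjacent_def]
  by (simp_all add: insert_commute)

text \<open>
  Beyond the common points, the arc of \<open>a\<close> may contain ends of the chord of \<open>a'\<close> and conversely. The contributions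
  agree, because both the orientation and the side are reversed.
\<close>

lemma index_same: "index H a = index H a'"
proof -
  have out: "b \<in> points H - {a, a'}" "b' \<in> points H - {a, a'}" "a \<in> points H - {b, b'}" "a' \<in> points H - {b, b'}"
    using distinct4 by auto
  have c: "btw H a b' b = btw H b' b a" "btw H a' b b' = btw H b b' a'"
    by (metis btw_rotate)+
  have "index H a = (\<Sum>x\<in>points G. if btw H a x b then ori H x else 0)
      + ((if u then ori H a' else 0) + (if w then 0 else ori H b'))"
    unfolding index_def points_H mate_a using new_points distinct4 out
    by (subst sum.union_disjoint) (auto simp: bits c)
  moreover have "index H a' = (\<Sum>x\<in>points G. if btw H a' x b' then ori H x else 0)
      + ((if u then 0 else ori H a) + (if w then ori H b else 0))"
    unfolding index_def points_H mate_a' using new_points distinct4 out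
    by (subst sum.union_disjoint) (auto simp: bits c)
  moreover have "(\<Sum>x\<in>points G. if btw H a x b then ori H x else 0) = (\<Sum>x\<in>points G. if btw H a' x b' then ori H x else 0)"
    by (intro sum.cong refl) (simp add: arc_same)
  ultimately show ?thesis by (simp add: ori_a' ori_b)
qed

lemma apart_same: "t \<in> points G \<Longrightarrow> apart H a t = apart H a' t"
proof -
  assume t: "t \<in> points G"
  have "btw H a b t = btw H a' b' t"
    using arc_same(2)[OF t] by (metis btw_rotate)
  then show ?thesis
    unfolding apart_def mate_a mate_a' using same_side t mate_old by (metis btw_rotate)
qed

lemma link_same:
  assumes "t \<in> points G" "apart H a t"
  shows "link H a t = link H a' t"
proof -
  have "\<not> btw H t a (mate H t)" "\<not> btw H t b (mate H t)"
    using assms(2) unfolding apart_def mate_a btw_def cyc_def by auto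
  then have no: "\<not> btw H t x (mate H t)" if "x \<in> {a, a', b, b'}" for x
    using that same_side assms(1) mate_old by auto
  have *: "link H s t = (\<Sum>x\<in>points G. if btw H s x (mate H s) \<and> btw H t (mate H x) (mate H t) then ori H x else 0)" for s
    unfolding link_def points_H using new_points distinct4 mate_a mate_a' mates
    by (subst sum.union_disjoint) (auto simp: no)
  show ?thesis unfolding * mate_a mate_a' by (intro sum.cong refl) (simp add: arc_same)
qed

lemma pair_cancels:
  assumes "t \<in> points G"
  shows "pair_term i j k H a t + pair_term i j k H a' t = 0" "pair_term i j k H t a + pair_term i j k H t a' = 0"
proof -
  have *: "apart H a t \<Longrightarrow> link H t a = link H t a'"
    using link_same[OF assms] link_antisym[of t a] link_antisym[of t a'] by simp
  show "pair_term i j k H a t + pair_term i j k H a' t = 0"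
    unfolding pair_term_def using assms apart_same link_same index_same ori_a' over_a' by simp
  show "pair_term i j k H t a + pair_term i j k H t a' = 0"
    unfolding pair_term_def using assms apart_same * index_same ori_a' over_a' apart_sym by auto
qed

text \<open>
  When the two chords are parallel, the middle region between them contains no points, so no chord
  ends there and both labels with the middle region are 0.
\<close>

lemma parallel_index:
  assumes "apart H a b'"
  shows "index H a = link H a b'"
proof -
  have q: "btw H a b b'" "btw H b' a' a" using assms unfolding apart_def mate_a mates by auto
  (* A chord that leaves the outer arc of one of the two chords enters that of the other one. *)
  have none: "\<not> (btw H a x b \<and> \<not> btw H a (mate H x) b \<and> \<not> btw H b' (mate H x) a')" if x: "x \<in> points H" for x
  proof
    assume A: "btw H a x b \<and> \<not> btw H a (mate H x) b \<and> \<not> btw H b' (mate H x) a'"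
    have "x \<noteq> a" "x \<noteq> b" using A by auto
    moreover have "x \<noteq> b'" using A btw_asym[OF q(1)] by auto
    moreover have "x \<noteq> a'" 
      using A btw_trans[OF _ q(1), of a'] btw_asym[OF btw_rotate[OF btw_rotate[OF q(2)]]] by auto
    ultimately have "x \<notin> {a, a', b, b'}" by simp
    then have xG: "x \<in> points G" using x unfolding points_H by auto
    then have mG: "mate H x \<in> points G" by (rule mate_old)
    then have m: "mate H x \<in> points H - {a, b}" "mate H x \<notin> {b, b'}" using old by auto
    have "btw H b (mate H x) a"
      using A m btw_total[of a "mate H x" b] btw_rotate[of H a b "mate H x"] distinct4 by auto
    then show False using A arc_same(2)[OF mG] by auto
  qed
  have "index H a - link H a b' = 0"
    unfolding index_minus_link[OF assms in4(1) in4(4)] mate_a mates 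
    by (rule sum.neutral) (use none in auto)
  then show ?thesis by simp
qed

lemma no_apart: "\<not> apart H a a" "\<not> apart H a b" "\<not> apart H a a'"
proof -
  show "\<not> apart H a a" "\<not> apart H a b" unfolding apart_def mate_a mates by auto
  show "\<not> apart H a a'"
  proof
    assume "apart H a a'"
    then have "btw H a b a'" "btw H a' b' a" unfolding apart_def mate_a mate_a' by auto
    then have "btw H a' a b" "btw H a a' b'" by (metis btw_rotate)+
    then show False using bits(1)[of b'] bits(2)[of b] distinct4 by auto
  qed
qed

lemma terms_inside:
  assumes "i \<noteq> j" "j \<noteq> k" "i \<noteq> k" "t \<in> {a, a', b, b'}"
  shows "pair_term i j k H a t = 0"
proof (cases "t = b' \<and> apart H a b'")
  case True
  interpret flip: bigon H G b' b a' a "\<not> w" "\<not> u"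
    by (rule bigon.swap_crossings[OF swap_strands])
  have "index H b' = link H b' a" using flip.parallel_index True apart_sym by auto
  then show ?thesis
    unfolding pair_term_def using parallel_index True link_antisym[of b' a] weight_two_zero[OF assms(1-3)] by simp
next
  case False
  then show ?thesis using assms(4) no_apart unfolding pair_term_def by auto
qed

end

lemma (in bigon) phi_chords_bigon:
  assumes ijk: "i \<noteq> j" "j \<noteq> k" "i \<noteq> k"
  shows "phi_chords i j k H = phi_chords i j k G"
proof -
  interpret bb: bigon H G b b' a a' w u by (rule swap_strands)
  interpret sa: bigon H G a' a b' b "\<not> u" "\<not> w" by (rule swap_crossings)
  interpret sb: bigon H G b' b a' a "\<not> w" "\<not> u" by (rule bb.swap_crossings)
  have d: "a \<noteq> a'" "a \<noteq> b" "a \<noteq> b'" "a' \<noteq> b" "a' \<noteq> b'" "b \<noteq> b'" using distinct4 by auto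
  show ?thesis
  proof (rule phi_chords_extension)
    fix s t assume st: "s \<in> points G" "t \<in> points G"
    show "(\<Sum>x\<in>{a, a', b, b'}. if btw H s x (mate H s) then ori H x else 0) = 0"
      using d st same_side[OF st(1) mate_old(2)[OF st(1)]] by (auto simp: ori_a' ori_b)
    show "(\<Sum>x\<in>{a, a', b, b'}. if btw H s x (mate H s) \<and> btw H t (mate H x) (mate H t) then ori H x else 0) = 0"
      using d same_side[OF st(1) mate_old(2)[OF st(1)]] same_side[OF st(2) mate_old(2)[OF st(2)]]
      by (auto simp: ori_a' ori_b mate_a mate_a' mates)
    show "(\<Sum>s\<in>{a, a', b, b'}. pair_term i j k H s t) = 0" "(\<Sum>s\<in>{a, a', b, b'}. pair_term i j k H t s) = 0"
      using d pair_cancels[OF st(2)] bb.pair_cancels[OF st(2)] by (auto simp: algebra_simps)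
  next
    fix s t assume "s \<in> {a, a', b, b'}" "t \<in> {a, a', b, b'}"
    then show "pair_term i j k H s t = 0"
      using terms_inside[OF ijk] bb.terms_inside[OF ijk] sa.terms_inside[OF ijk] sb.terms_inside[OF ijk] by blast
  qed
qed

section \<open>Triangles\<close>

definition pm :: "bool \<Rightarrow> int" where "pm b = (if b then 1 else - 1)"

definition gap_sum :: "'a chords \<Rightarrow> 'a set \<Rightarrow> 'a \<Rightarrow> 'a \<Rightarrow> 'a \<Rightarrow> 'a \<Rightarrow> int" where
  "gap_sum G Y p q r s =
     (\<Sum>x\<in>Y. if btw G p x q \<and> btw G r (mate G x) s then ori G x else 0)"

lemma cyc_cut: "cyc a b c \<Longrightarrow> x \<noteq> a \<Longrightarrow> x \<noteq> b \<Longrightarrow> x \<noteq> c \<Longrightarrow> cyc a x b \<or> cyc b x c \<or> cyc c x a"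
  unfolding cyc_def by linarith

lemma cyc_cut_disjoint: "cyc a b c \<Longrightarrow> \<not> (cyc a x b \<and> cyc b x c)"
  unfolding cyc_def by linarith

text \<open>
  Strands \<open>a\<close>, \<open>b\<close>, \<open>c\<close> follow each other in this cyclic order. On each strand the index 1 marks the
  crossing with the next strand and the index 0 that with the previous one. The bits \<open>xa\<close>, \<open>xb\<close>,
  \<open>xc\<close> say that in \<open>G\<close> the point with index 0 comes first, which means that the two chords meeting on that
  strand are disjoint. In \<open>H\<close> all three bits are reversed. The assumption \<open>signs\<close> is the geometric
  constraint on the orientations of three strands that bound a triangle, \<open>\<tau>\<close> being the direction
  in which one turns at its corners. The assumptions are invariant under rotating the
  strands and under exchanging \<open>G\<close> and \<open>H\<close>; this reduces all computations to the chord between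
  \<open>a\<close> and \<open>b\<close> in \<open>G\<close>.
\<close>

locale triangle_pair = G: chord_diagram G + H: chord_diagram H for G H :: "'a chords" +
  fixes a0 a1 b0 b1 c0 c1 :: 'a and xa xb xc :: bool and \<tau> :: int
  assumes points_eq: "points H = points G"
    and data_eq: "mate H = mate G" "ori H = ori G" "over H = over G"
    and six: "distinct [a0, a1, b0, b1, c0, c1]" "{a0, a1, b0, b1, c0, c1} \<subseteq> points G"
    and mates6: "mate G a1 = b0" "mate G b1 = c0" "mate G c1 = a0"
    and strands: "x \<in> {a0, a1} \<Longrightarrow> y \<in> {b0, b1} \<Longrightarrow> z \<in> {c0, c1} \<Longrightarrow> btw G x y z"
    and btw_eq: "x \<in> points G \<Longrightarrow> y \<in> points G \<Longrightarrow> z \<in> points G \<Longrightarrow>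
       \<not> {a0, a1} \<subseteq> {x, y, z} \<Longrightarrow> \<not> {b0, b1} \<subseteq> {x, y, z} \<Longrightarrow> \<not> {c0, c1} \<subseteq> {x, y, z} \<Longrightarrow>
       btw H x y z = btw G x y z"
    and adjG: "adjacent G a0 a1 xa" "adjacent G b0 b1 xb" "adjacent G c0 c1 xc"
    and adjH: "adjacent H a0 a1 (\<not> xa)" "adjacent H b0 b1 (\<not> xb)" "adjacent H c0 c1 (\<not> xc)"
    and signs: "ori G a1 = \<tau> * pm xa * pm xb" "ori G b1 = \<tau> * pm xb * pm xc"
      "ori G c1 = \<tau> * pm xc * pm xa"
    and layers: "\<not> (over G a1 = over G b1 \<and> over G b1 = over G c1)"
begin

abbreviation T where "T \<equiv> {a0, a1, b0, b1, c0, c1}"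
abbreviation Y where "Y \<equiv> points G - T"

lemma neqs: "a0 \<noteq> a1" "a0 \<noteq> b0" "a0 \<noteq> b1" "a0 \<noteq> c0" "a0 \<noteq> c1"
  "a1 \<noteq> b0" "a1 \<noteq> b1" "a1 \<noteq> c0" "a1 \<noteq> c1" "b0 \<noteq> b1" "b0 \<noteq> c0" "b0 \<noteq> c1"
  "b1 \<noteq> c0" "b1 \<noteq> c1" "c0 \<noteq> c1"
  using six(1) by auto

lemma in6 [simp]: "a0 \<in> points G" "a1 \<in> points G" "b0 \<in> points G" "b1 \<in> points G"
  "c0 \<in> points G" "c1 \<in> points G"
  using six(2) by auto

lemma mates6': "mate G b0 = a1" "mate G c0 = b1" "mate G a0 = c1"
  using G.mate_mate mates6 in6 by metis+

lemma rotate: "triangle_pair G H b0 b1 c0 c1 a0 a1 xb xc xa \<tau>"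
proof -
  have "btw G x y z" if "x \<in> {b0, b1}" "y \<in> {c0, c1}" "z \<in> {a0, a1}" for x y z
    by (rule btw_rotate, rule strands[OF that(3,1,2)])
  moreover have "{b0, b1, c0, c1, a0, a1} = T" by auto
  moreover have "btw H x y z = btw G x y z" if "x \<in> points G" "y \<in> points G" "z \<in> points G"
       "\<not> {b0, b1} \<subseteq> {x, y, z}" "\<not> {c0, c1} \<subseteq> {x, y, z}" "\<not> {a0, a1} \<subseteq> {x, y, z}" for x y z
    using btw_eq that by blast
  ultimately show ?thesis
    unfolding triangle_pair_def triangle_pair_axioms_def
    using points_eq data_eq six mates6 adjG adjH signs layers neqs neqs[symmetric] G.chord_diagram_axioms H.chord_diagram_axioms
    by (simp only: HOL.simp_thms) (auto simp: ac_simps)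
qed

lemma flip: "triangle_pair H G a0 a1 b0 b1 c0 c1 (\<not> xa) (\<not> xb) (\<not> xc) \<tau>"
proof -
  have "btw H x y z" if "x \<in> {a0, a1}" "y \<in> {b0, b1}" "z \<in> {c0, c1}" for x y z
    using strands[OF that] that btw_eq[of x y z] neqs neqs[symmetric] by auto
  moreover have "pm (\<not> x) = - pm x" for x by (simp add: pm_def)
  ultimately show ?thesis
    unfolding triangle_pair_def triangle_pair_axioms_def
    using points_eq data_eq six mates6 adjG adjH signs layers btw_eq G.chord_diagram_axioms H.chord_diagram_axioms
    by (simp only: HOL.simp_thms) auto
qed

lemma mate_Y: "x \<in> Y \<Longrightarrow> mate G x \<in> Y"
proof -
  assume x: "x \<in> Y"
  then have "mate G (mate G x) = x" by simp
  then have "mate G x \<notin> T" using x mates6 mates6' by (metis Diff_iff insert_iff empty_iff)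
  then show ?thesis using x by simp
qed

lemma near_a: "z \<in> points G - {a0, a1} \<Longrightarrow> btw G a0 a1 z = xa"
   "z \<in> points G - {a0, a1} \<Longrightarrow> btw G a1 a0 z = (\<not> xa)"
   "z \<in> points G - {a0, a1} \<Longrightarrow> btw G a1 z a0 = xa"
   "z \<in> points G - {a0, a1} \<Longrightarrow> btw G a0 z a1 = (\<not> xa)"
   "z \<in> points G - {a0, a1} \<Longrightarrow> btw G z a0 a1 = xa"
   "z \<in> points G - {a0, a1} \<Longrightarrow> btw G z a1 a0 = (\<not> xa)"
  using adjG(1)[unfolded adjacent_def] G.adjacent_sym[OF adjG(1), unfolded adjacent_def]
  by (simp_all add: btw_rotate_iff[of G a1 z a0] btw_rotate_iff[of G z a0 a1] btw_rotate_iff[of G a0 z a1]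
      btw_rotate_iff[of G z a1 a0] insert_commute)

lemma near_b: "z \<in> points G - {b0, b1} \<Longrightarrow> btw G b0 b1 z = xb"
   "z \<in> points G - {b0, b1} \<Longrightarrow> btw G b1 b0 z = (\<not> xb)"
   "z \<in> points G - {b0, b1} \<Longrightarrow> btw G b1 z b0 = xb"
   "z \<in> points G - {b0, b1} \<Longrightarrow> btw G b0 z b1 = (\<not> xb)"
   "z \<in> points G - {b0, b1} \<Longrightarrow> btw G z b0 b1 = xb"
   "z \<in> points G - {b0, b1} \<Longrightarrow> btw G z b1 b0 = (\<not> xb)"
  using triangle_pair.near_a[OF rotate] by auto

lemma near_c: "z \<in> points G - {c0, c1} \<Longrightarrow> btw G c0 c1 z = xc"
   "z \<in> points G - {c0, c1} \<Longrightarrow> btw G c1 c0 z = (\<not> xc)"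
   "z \<in> points G - {c0, c1} \<Longrightarrow> btw G c1 z c0 = xc"
   "z \<in> points G - {c0, c1} \<Longrightarrow> btw G c0 z c1 = (\<not> xc)"
   "z \<in> points G - {c0, c1} \<Longrightarrow> btw G z c0 c1 = xc"
   "z \<in> points G - {c0, c1} \<Longrightarrow> btw G z c1 c0 = (\<not> xc)"
  using triangle_pair.near_b[OF rotate] by auto

lemma strands_all:
  assumes "x \<in> {a0, a1}" "y \<in> {b0, b1}" "z \<in> {c0, c1}"
  shows "btw G x y z" "btw G y z x" "btw G z x y" "\<not> btw G x z y" "\<not> btw G z y x" "\<not> btw G y x z"
  using strands[OF assms] btw_rotate btw_asym by metis+

lemmas T_btw = strands_all[of a0 b0 c0] strands_all[of a0 b0 c1] strands_all[of a0 b1 c0] strands_all[of a0 b1 c1]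
  strands_all[of a1 b0 c0] strands_all[of a1 b0 c1] strands_all[of a1 b1 c0] strands_all[of a1 b1 c1]
  near_a near_b near_c

lemma same_a: "x \<in> points G - {a0, a1} \<Longrightarrow> y \<in> points G - {a0, a1} \<Longrightarrow>
   btw G x a0 y = btw G x a1 y \<and> btw G a0 x y = btw G a1 x y \<and> btw G x y a0 = btw G x y a1"
  using G.btw_adjacent[OF adjG(1)] by blast

lemma same_b: "x \<in> points G - {b0, b1} \<Longrightarrow> y \<in> points G - {b0, b1} \<Longrightarrow>
   btw G x b0 y = btw G x b1 y \<and> btw G b0 x y = btw G b1 x y \<and> btw G x y b0 = btw G x y b1"
  using G.btw_adjacent[OF adjG(2)] by blast

lemma same_c: "x \<in> points G - {c0, c1} \<Longrightarrow> y \<in> points G - {c0, c1} \<Longrightarrow>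
   btw G x c0 y = btw G x c1 y \<and> btw G c0 x y = btw G c1 x y \<and> btw G x y c0 = btw G x y c1"
  using G.btw_adjacent[OF adjG(3)] by blast

lemma points_split: "points G = Y \<union> T"
  using six(2) by auto

lemma sum_points: "(\<Sum>x\<in>points G. f x) = (\<Sum>x\<in>Y. f x) + (f a0 + f a1 + f b0 + f b1 + f c0 + (f c1 :: int))"
proof -
  have "(\<Sum>x\<in>points G. f x) = (\<Sum>x\<in>Y. f x) + (\<Sum>x\<in>T. f x)"
    by (subst points_split, rule sum.union_disjoint) auto
  moreover have "(\<Sum>x\<in>T. f x) = f a0 + f a1 + f b0 + f b1 + f c0 + f c1"
    using neqs by simp
  ultimately show ?thesis by simp
qed

lemma oris: "ori G b0 = - ori G a1" "ori G c0 = - ori G b1" "ori G a0 = - ori G c1"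
  using G.ori_mate in6 mates6 by metis+

lemma tau: "\<tau> = 1 \<or> \<tau> = - 1"
  using G.ori_unit[of a1] signs(1) by (auto simp: pm_def split: if_splits)

text \<open>
  The points \<open>a0\<close> and \<open>b1\<close> are next to the two ends of the chord between \<open>a\<close> and \<open>b\<close>, and the move takes each of
  them from one side of this chord to the other. They belong to the two chords with the third
  strand, and the turning condition makes the two changes compensate.
\<close>

lemma exchange:
  "(if xa then 0 else ori G a0) + (if xb then 0 else ori G b1) =
   (if xa then ori G a0 else 0) + (if xb then ori G b1 else 0)"
  unfolding oris signs by (simp add: pm_def)

lemma index_a1: "index G a1 = (\<Sum>x\<in>Y. if btw G a1 x b0 then ori G x else 0)
     + ((if xa then 0 else ori G a0) + (if xb then 0 else ori G b1))"
  unfolding index_def sum_points mates6 using neqs neqs[symmetric] by (simp add: T_btw)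

lemma index_b0: "index G b0 = (\<Sum>x\<in>Y. if btw G b0 x a1 then ori G x else 0)
     + ((if xa then ori G a0 else 0) + (if xb then ori G b1 else 0)) - ori G b1 + ori G c1"
  unfolding index_def sum_points mates6' using neqs neqs[symmetric] by (simp add: T_btw oris)


lemma arc_Y:
  assumes "s \<in> points G" "s \<notin> T" "x \<in> points G"
  shows "btw H s x (mate G s) = btw G s x (mate G s)"
  using assms mate_Y[of s] neqs by (intro btw_eq) auto

lemma two_Y:
  assumes "x \<in> points G" "y \<in> Y" "z \<in> Y"
  shows "btw H x y z = btw G x y z" "btw H y x z = btw G y x z" "btw H y z x = btw G y z x"
  using assms neqs by (intro btw_eq; auto)+

lemma mid_Y:
  assumes x: "x \<in> Y" and u: "u \<in> T" and v: "v \<in> T"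
    and n: "\<not> {a0, a1} \<subseteq> {u, v}" "\<not> {b0, b1} \<subseteq> {u, v}" "\<not> {c0, c1} \<subseteq> {u, v}"
  shows "btw H u x v = btw G u x v" "btw H u v x = btw G u v x"
proof -
  have in3: "u \<in> points G" "v \<in> points G" "x \<in> points G" using x u v six(2) by blast+
  have "a0 \<noteq> x" "a1 \<noteq> x" "b0 \<noteq> x" "b1 \<noteq> x" "c0 \<noteq> x" "c1 \<noteq> x" using x by blast+
  then have "\<not> {a0, a1} \<subseteq> {u, x, v}" "\<not> {b0, b1} \<subseteq> {u, x, v}" "\<not> {c0, c1} \<subseteq> {u, x, v}"
    using n by simp_all
  moreover have "{u, v, x} = {u, x, v}" by blast
  ultimately show "btw H u x v = btw G u x v" "btw H u v x = btw G u v x"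
    using btw_eq[of u x v] btw_eq[of u v x] in3 by simp_all
qed

lemma arc_T:
  assumes "x \<in> points G" "x \<notin> T"
  shows "btw H a1 x b0 = btw G a1 x b0" "btw H b0 x a1 = btw G b0 x a1"
proof -
  have "x \<in> Y" using assms by simp
  moreover have "\<not> {a0, a1} \<subseteq> {a1, b0}" "\<not> {b0, b1} \<subseteq> {a1, b0}" "\<not> {c0, c1} \<subseteq> {a1, b0}"
     "\<not> {a0, a1} \<subseteq> {b0, a1}" "\<not> {b0, b1} \<subseteq> {b0, a1}" "\<not> {c0, c1} \<subseteq> {b0, a1}"
    using neqs neqs[symmetric] by simp_all
  ultimately show "btw H a1 x b0 = btw G a1 x b0" "btw H b0 x a1 = btw G b0 x a1"
    by (simp_all add: mid_Y)
qed

lemma index_Y: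
  assumes "s \<in> Y"
  shows "index H s = index G s"
  unfolding index_def points_eq data_eq by (intro sum.cong refl) (use assms arc_Y in auto)

lemma link_Y:
  assumes "s \<in> Y" "t \<in> Y"
  shows "link H s t = link G s t"
  unfolding link_def points_eq data_eq by (intro sum.cong refl) (use assms arc_Y in auto)

lemma index_T: "index H a1 = index G a1" "index H b0 = index G b0"
proof -
  have S: "(\<Sum>x\<in>Y. if btw H a1 x b0 then ori G x else 0) = (\<Sum>x\<in>Y. if btw G a1 x b0 then ori G x else 0)"
    "(\<Sum>x\<in>Y. if btw H b0 x a1 then ori G x else 0) = (\<Sum>x\<in>Y. if btw G b0 x a1 then ori G x else 0)"
    by (rule sum.cong[OF refl]; simp add: arc_T)+
  have "index H a1 = (\<Sum>x\<in>Y. if btw G a1 x b0 then ori G x else 0)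
     + ((if xa then ori G a0 else 0) + (if xb then ori G b1 else 0))"
    unfolding triangle_pair.index_a1[OF flip] points_eq data_eq
    by (simp add: S)
  then show "index H a1 = index G a1" unfolding index_a1 exchange .
  have "index H b0 = (\<Sum>x\<in>Y. if btw G b0 x a1 then ori G x else 0)
     + ((if xa then 0 else ori G a0) + (if xb then 0 else ori G b1)) - ori G b1 + ori G c1"
    unfolding triangle_pair.index_b0[OF flip] points_eq data_eq
    by (simp add: S)
  then show "index H b0 = index G b0" unfolding index_b0 exchange .
qed

lemma apart_T:
  assumes "t \<in> Y"
  shows "apart H a1 t = apart G a1 t" "apart H b0 t = apart G b0 t"
proof -
  have n: "\<not> {a0, a1} \<subseteq> {a1, b0}" "\<not> {b0, b1} \<subseteq> {a1, b0}" "\<not> {c0, c1} \<subseteq> {a1, b0}"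
     "\<not> {a0, a1} \<subseteq> {b0, a1}" "\<not> {b0, b1} \<subseteq> {b0, a1}" "\<not> {c0, c1} \<subseteq> {b0, a1}"
    using neqs neqs[symmetric] by simp_all
  show "apart H a1 t = apart G a1 t" "apart H b0 t = apart G b0 t"
    unfolding apart_def data_eq mates6 mates6'
    using mid_Y(2)[OF assms _ _ n(1-3)] mid_Y(2)[OF assms _ _ n(4-6)]
      two_Y(3)[OF _ assms mate_Y[OF assms]] by simp_all
qed

lemma link_a1:
  assumes "t \<in> Y"
  shows "link G a1 t = (\<Sum>x\<in>Y. if btw G a1 x b0 \<and> btw G t (mate G x) (mate G t) then ori G x else 0)
     + (if btw G t c0 (mate G t) then (if xa then 0 else ori G a0) + (if xb then 0 else ori G b1) else 0)"
proof -
  have c: "btw G t c1 (mate G t) = btw G t c0 (mate G t)"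
    using same_c[of t "mate G t"] mate_Y assms by auto
  show ?thesis
    unfolding link_def sum_points mates6 mates6' using neqs neqs[symmetric] by (simp add: T_btw c)
qed

lemma link_b0:
  assumes "t \<in> Y" "apart G b0 t"
  shows "link G b0 t = (\<Sum>x\<in>Y. if btw G b0 x a1 \<and> btw G t (mate G x) (mate G t) then ori G x else 0)
     + (if btw G t c0 (mate G t) then (if xa then ori G a0 else 0) + (if xb then ori G b1 else 0) else 0)"
proof -
  have c: "btw G t c1 (mate G t) = btw G t c0 (mate G t)" and a: "btw G t a0 (mate G t) = btw G t a1 (mate G t)"
    and b: "btw G t b1 (mate G t) = btw G t b0 (mate G t)"
    using same_a[of t "mate G t"] same_b[of t "mate G t"] same_c[of t "mate G t"] mate_Y assms by auto
  have "\<not> btw G t b0 (mate G t)"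
    using assms(2) btw_asym unfolding apart_def mates6' by metis
  moreover have "\<not> btw G t a1 (mate G t)"
  proof
    assume "btw G t a1 (mate G t)"
    moreover have "btw G t b0 a1" "btw G t (mate G t) b0"
      using assms(2) btw_rotate unfolding apart_def mates6' by metis+
    ultimately show False using btw_trans btw_asym by metis
  qed
  ultimately show ?thesis
    unfolding link_def sum_points mates6 mates6' using neqs neqs[symmetric] by (simp add: T_btw c a b)
qed

lemma link_T:
  assumes "t \<in> Y"
  shows "apart G a1 t \<Longrightarrow> link H a1 t = link G a1 t" "apart G b0 t \<Longrightarrow> link H b0 t = link G b0 t"
proof -
  have c: "btw H t c0 (mate G t) = btw G t c0 (mate G t)" using assms arc_Y by auto
  have S: "(\<Sum>x\<in>Y. if btw H a1 x b0 \<and> btw H t (mate G x) (mate G t) then ori G x else 0) =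
      (\<Sum>x\<in>Y. if btw G a1 x b0 \<and> btw G t (mate G x) (mate G t) then ori G x else 0)"
      "(\<Sum>x\<in>Y. if btw H b0 x a1 \<and> btw H t (mate G x) (mate G t) then ori G x else 0) =
      (\<Sum>x\<in>Y. if btw G b0 x a1 \<and> btw G t (mate G x) (mate G t) then ori G x else 0)"
    using assms arc_Y arc_T by (auto intro!: sum.cong)
  have tH: "t \<in> points H - T" using assms points_eq by simp
  {
    assume "apart G a1 t"
    from triangle_pair.link_a1[OF flip tH]
    show "link H a1 t = link G a1 t"
      unfolding link_a1[OF assms] points_eq data_eq S c exchange by (simp add: if_distrib cong: if_cong)
  next
    assume q: "apart G b0 t"
    then have "apart H b0 t" using apart_T assms by simp
    from triangle_pair.link_b0[OF flip tH this]
    show "link H b0 t = link G b0 t"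
      unfolding link_b0[OF assms q] points_eq data_eq S c exchange[symmetric] by (simp add: if_distrib cong: if_cong)
  }
qed

text \<open>
  A chord outside the triangle contains either both or neither point of a strand in its arc, so
  the move is only visible in the arc of the triangle chord, where \<open>exchange\<close> applies.
\<close>

lemma term_cross_ab:
  assumes "t \<in> Y" "s \<in> {a1, b0}"
  shows "pair_term i j k H s t = pair_term i j k G s t" "pair_term i j k H t s = pair_term i j k G t s"
proof -
  have q: "apart H s t = apart G s t" "apart H t s = apart G t s"
    using apart_T[OF assms(1)] assms(2) G.apart_sym[of t] H.apart_sym[of t] by auto
  have l: "link H s t = link G s t \<and> link H t s = link G t s" if "apart G s t"
    using link_T[OF assms(1)] assms(2) that G.link_antisym[of t s] H.link_antisym[of t s] by auto
  have x: "index H s = index G s" "index H t = index G t"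
    using index_T index_Y assms by auto
  show "pair_term i j k H s t = pair_term i j k G s t"
    unfolding pair_term_def q data_eq x using l by auto
  show "pair_term i j k H t s = pair_term i j k G t s"
    unfolding pair_term_def q data_eq x using l G.apart_sym[of t s] by auto
qed

lemma term_cross:
  assumes "t \<in> Y" "s \<in> T"
  shows "pair_term i j k H s t = pair_term i j k G s t" "pair_term i j k H t s = pair_term i j k G t s"
proof -
  interpret rot: triangle_pair G H b0 b1 c0 c1 a0 a1 xb xc xa \<tau> by (rule rotate)
  interpret rot2: triangle_pair G H c0 c1 a0 a1 b0 b1 xc xa xb \<tau> by (rule rot.rotate)
  have t: "t \<in> points G - {b0, b1, c0, c1, a0, a1}" "t \<in> points G - {c0, c1, a0, a1, b0, b1}"
    using assms(1) by auto
  consider "s \<in> {a1, b0}" | "s \<in> {b1, c0}" | "s \<in> {c1, a0}" using assms(2) by auto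
  then show "pair_term i j k H s t = pair_term i j k G s t" "pair_term i j k H t s = pair_term i j k G t s"
    by (cases; simp only: term_cross_ab[OF assms(1)] rot.term_cross_ab[OF t(1)] rot2.term_cross_ab[OF t(2)])+
qed

lemma term_YY:
  assumes "s \<in> Y" "t \<in> Y"
  shows "pair_term i j k H s t = pair_term i j k G s t"
  unfolding pair_term_def apart_def data_eq
  using assms arc_Y[of s "t"] index_Y link_Y arc_Y[of t s] mate_Y btw_eq[of s "mate G s" t] btw_eq[of t "mate G t" s] by auto


text \<open>
  \<open>Wa\<close>, \<open>Wb\<close> and \<open>Wc\<close> are the numbers of chords between the two arcs next to strand \<open>a\<close>, \<open>b\<close> and
  \<open>c\<close>, seen from any pair of the three triangle chords that is disjoint. The correction is the
  contribution of the third chord. It is nonzero at the strand whose bit differs from the two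
  others, a condition that is invariant under reversing all bits, and so the same numbers serve
  both sides of the move.
\<close>

abbreviation Wa where "Wa \<equiv> gap_sum G Y c1 a0 a1 b0 - (if xa \<noteq> xc \<and> xa \<noteq> xb then \<tau> else 0)"
abbreviation Wb where "Wb \<equiv> gap_sum G Y a1 b0 b1 c0 - (if xb \<noteq> xa \<and> xb \<noteq> xc then \<tau> else 0)"
abbreviation Wc where "Wc \<equiv> gap_sum G Y b1 c0 c1 a0 - (if xc \<noteq> xb \<and> xc \<noteq> xa then \<tau> else 0)"

lemma gaps:
  assumes "x \<in> Y"
  shows "btw G a1 x b0 \<or> btw G b1 x c0 \<or> btw G c1 x a0"
    and "\<not> (btw G a1 x b0 \<and> btw G b1 x c0)" "\<not> (btw G b1 x c0 \<and> btw G c1 x a0)"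
      "\<not> (btw G c1 x a0 \<and> btw G a1 x b0)"
proof -
  have e: "btw G b1 x c0 = btw G b0 x c0" "btw G c1 x a0 = btw G c0 x a1"
    using same_b[of x c0] same_c[of x a0] same_a[of c0 x] assms neqs by auto
  have n: "pos G x \<noteq> pos G a1" "pos G x \<noteq> pos G b0" "pos G x \<noteq> pos G c0"
    using assms inj_onD[OF G.pos_inj] in6 by blast+
  have c: "cyc (pos G a1) (pos G b0) (pos G c0)" "cyc (pos G b0) (pos G c0) (pos G a1)"
    "cyc (pos G c0) (pos G a1) (pos G b0)"
    using strands_all[of a1 b0 c0] unfolding btw_def by auto
  show "btw G a1 x b0 \<or> btw G b1 x c0 \<or> btw G c1 x a0"
    unfolding e unfolding btw_def using cyc_cut[OF c(1) n] by blast
  show "\<not> (btw G a1 x b0 \<and> btw G b1 x c0)" "\<not> (btw G b1 x c0 \<and> btw G c1 x a0)"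
      "\<not> (btw G c1 x a0 \<and> btw G a1 x b0)"
    unfolding e unfolding btw_def using cyc_cut_disjoint[OF c(1)] cyc_cut_disjoint[OF c(2)]
      cyc_cut_disjoint[OF c(3)] by blast+
qed

lemma sum_mate_Y: "(\<Sum>x\<in>Y. f (mate G x)) = (\<Sum>x\<in>Y. (f x :: int))"
  by (rule sum.reindex_bij_witness[where i = "mate G" and j = "mate G"]) (use mate_Y in auto)

lemma sum_Y_gap: "(\<Sum>x\<in>Y. if btw G a1 x b0 then ori G x else 0)
   = gap_sum G Y a1 b0 b1 c0 - gap_sum G Y c1 a0 a1 b0"
proof -
  let ?f = "\<lambda>x. if btw G a1 x b0 \<and> btw G a1 (mate G x) b0 then ori G x else 0"
  let ?g = "\<lambda>x. if btw G c1 x a0 \<and> btw G a1 (mate G x) b0 then ori G x else 0"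
  have mm: "x \<in> Y \<Longrightarrow> mate G (mate G x) = x" "x \<in> Y \<Longrightarrow> ori G (mate G x) = - ori G x" for x by auto
  have "(\<Sum>x\<in>Y. ?f x) = (\<Sum>x\<in>Y. ?f (mate G x))" by (rule sum_mate_Y[symmetric])
  also have "\<dots> = (\<Sum>x\<in>Y. - ?f x)" by (intro sum.cong refl) (simp add: mm)
  also have "\<dots> = - (\<Sum>x\<in>Y. ?f x)" by (simp add: sum_negf)
  finally have 1: "(\<Sum>x\<in>Y. ?f x) = 0" by simp
  have "(\<Sum>x\<in>Y. ?g x) = (\<Sum>x\<in>Y. ?g (mate G x))" by (rule sum_mate_Y[symmetric])
  also have "\<dots> = (\<Sum>x\<in>Y. - (if btw G a1 x b0 \<and> btw G c1 (mate G x) a0 then ori G x else 0))"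
    by (intro sum.cong refl) (simp add: mm)
  finally have 2: "gap_sum G Y c1 a0 a1 b0 =
     - (\<Sum>x\<in>Y. if btw G a1 x b0 \<and> btw G c1 (mate G x) a0 then ori G x else 0)"
    by (simp add: gap_sum_def sum_negf)
  have "(\<Sum>x\<in>Y. if btw G a1 x b0 then ori G x else 0) = (\<Sum>x\<in>Y. ?f x) + gap_sum G Y a1 b0 b1 c0
     + (\<Sum>x\<in>Y. if btw G a1 x b0 \<and> btw G c1 (mate G x) a0 then ori G x else 0)"
    unfolding gap_sum_def sum.distrib[symmetric]
  proof (intro sum.cong refl)
    fix x assume "x \<in> Y"
    from gaps[OF mate_Y[OF this]]
    show "(if btw G a1 x b0 then ori G x else 0) = ?f x +
      (if btw G a1 x b0 \<and> btw G b1 (mate G x) c0 then ori G x else 0) +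
      (if btw G a1 x b0 \<and> btw G c1 (mate G x) a0 then ori G x else 0)" by auto
  qed
  then show ?thesis using 1 2 by simp
qed

text \<open>
  The chords leaving the arc between strands \<open>a\<close> and \<open>b\<close> end in one of the two other arcs; the corrections
  account for the ends of triangle chords on this arc.
\<close>

lemma index_W: "index G a1 = Wb - Wa"
  unfolding index_a1 sum_Y_gap oris signs by (auto simp: pm_def)

lemma link_W: "xb \<Longrightarrow> link G a1 b1 = Wb"
  unfolding link_def sum_points mates6 mates6' gap_sum_def using neqs neqs[symmetric]
  by (simp add: T_btw oris signs pm_def)

text \<open>
  A pair of triangle chords is disjoint iff the bit of the strand on which they meet is set, and its outer
  arcs are then the arcs between the strands of each chord.
\<close>

lemma apart_from_a1_b0:
  "t \<in> T \<Longrightarrow> apart G a1 t \<longleftrightarrow> t = b1 \<and> xb \<or> t = c1 \<and> xa" "t \<in> T \<Longrightarrow> \<not> apart G b0 t"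
  unfolding apart_def using neqs neqs[symmetric] by (auto simp: T_btw mates6 mates6')

lemma Ws_rotate:
  "gap_sum G (points G - {b0, b1, c0, c1, a0, a1}) = gap_sum G Y"
  "gap_sum G (points G - {c0, c1, a0, a1, b0, b1}) = gap_sum G Y"
  by (rule arg_cong[where f = "gap_sum G"]; auto)+

lemma sum_terms_inside:
  "(\<Sum>s\<in>T. \<Sum>t\<in>T. pair_term i j k G s t) =
    (if xb then pm xa * pm xc * (weight i j k (over G a1) (over G b1) Wa Wc Wb
       + weight i j k (over G b1) (over G a1) Wc Wa Wb) else 0)
  + (if xc then pm xa * pm xb * (weight i j k (over G b1) (over G c1) Wb Wa Wc
       + weight i j k (over G c1) (over G b1) Wa Wb Wc) else 0)
  + (if xa then pm xb * pm xc * (weight i j k (over G c1) (over G a1) Wc Wb Wa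
       + weight i j k (over G a1) (over G c1) Wb Wc Wa) else 0)"
proof -
  interpret rot: triangle_pair G H b0 b1 c0 c1 a0 a1 xb xc xa \<tau> by (rule rotate)
  interpret rot2: triangle_pair G H c0 c1 a0 a1 b0 b1 xc xa xb \<tau> by (rule rot.rotate)
  have ap: "t \<in> T \<Longrightarrow> apart G a1 t \<longleftrightarrow> t = b1 \<and> xb \<or> t = c1 \<and> xa" "t \<in> T \<Longrightarrow> \<not> apart G b0 t"
    "t \<in> T \<Longrightarrow> apart G b1 t \<longleftrightarrow> t = c1 \<and> xc \<or> t = a1 \<and> xb" "t \<in> T \<Longrightarrow> \<not> apart G c0 t"
    "t \<in> T \<Longrightarrow> apart G c1 t \<longleftrightarrow> t = a1 \<and> xa \<or> t = b1 \<and> xc" "t \<in> T \<Longrightarrow> \<not> apart G a0 t" for t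
    using apart_from_a1_b0[of t] rot.apart_from_a1_b0[of t] rot2.apart_from_a1_b0[of t] by auto
  have "(\<Sum>s\<in>T. \<Sum>t\<in>T. pair_term i j k G s t) =
     (pair_term i j k G a1 b1 + pair_term i j k G b1 a1) + (pair_term i j k G b1 c1 + pair_term i j k G c1 b1)
     + (pair_term i j k G c1 a1 + pair_term i j k G a1 c1)"
    using neqs neqs[symmetric] by (simp add: pair_term_def ap)
  moreover have ix: "index G a1 = Wb - Wa" "index G b1 = Wc - Wb" "index G c1 = Wa - Wc"
    using index_W rot.index_W rot2.index_W unfolding Ws_rotate by auto
  have lk: "xb \<Longrightarrow> link G a1 b1 = Wb" "xc \<Longrightarrow> link G b1 c1 = Wc" "xa \<Longrightarrow> link G c1 a1 = Wa"
    using link_W rot.link_W rot2.link_W unfolding Ws_rotate by auto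
  have sg: "ori G a1 * ori G b1 = pm xa * pm xc" "ori G b1 * ori G c1 = pm xa * pm xb" "ori G c1 * ori G a1 = pm xb * pm xc"
    unfolding signs using tau by (auto simp: pm_def)
  have pair: "pair_term i j k G s t + pair_term i j k G t s = (if x then m * (weight i j k (over G s) (over G t) A B C
       + weight i j k (over G t) (over G s) B A C) else 0)"
    if "apart G s t \<longleftrightarrow> x" "index G s = C - A" "index G t = B - C" "x \<Longrightarrow> link G s t = C" 
      "ori G s * ori G t = m"  for s t x A B C m
  proof (cases x)
    case True
    have "link G t s = - C" using G.link_antisym[of t s] that(4) True by simp
    then have "pair_term i j k G s t = m * weight i j k (over G s) (over G t) A B C"
      "pair_term i j k G t s = m * weight i j k (over G t) (over G s) B A C"
      unfolding pair_term_def using that True G.apart_sym[of t s]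
      by (auto simp: mult.commute intro!: weight_abs_cong)
    then show ?thesis using True by (simp add: distrib_left)
  next
    case False
    then show ?thesis using that(1) G.apart_sym[of t s] by (simp add: pair_term_def)
  qed
  have 1: "pair_term i j k G a1 b1 + pair_term i j k G b1 a1 = (if xb then pm xa * pm xc *
      (weight i j k (over G a1) (over G b1) Wa Wc Wb + weight i j k (over G b1) (over G a1) Wc Wa Wb) else 0)"
    by (rule pair) (use ix lk sg ap(1)[of b1] neqs in auto)
  have 2: "pair_term i j k G b1 c1 + pair_term i j k G c1 b1 = (if xc then pm xa * pm xb *
      (weight i j k (over G b1) (over G c1) Wb Wa Wc + weight i j k (over G c1) (over G b1) Wa Wb Wc) else 0)"
    by (rule pair) (use ix lk sg ap(3)[of c1] neqs in auto)
  have 3: "pair_term i j k G c1 a1 + pair_term i j k G a1 c1 = (if xa then pm xb * pm xc *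
      (weight i j k (over G c1) (over G a1) Wc Wb Wa + weight i j k (over G a1) (over G c1) Wb Wc Wa) else 0)"
    by (rule pair) (use ix lk sg ap(5)[of a1] neqs in auto)
  ultimately show ?thesis by (simp only: 1 2 3)
qed

lemma gap_sum_H: "gap_sum H (points H - T) a1 b0 b1 c0 = gap_sum G Y a1 b0 b1 c0"
  "gap_sum H (points H - T) b1 c0 c1 a0 = gap_sum G Y b1 c0 c1 a0"
  "gap_sum H (points H - T) c1 a0 a1 b0 = gap_sum G Y c1 a0 a1 b0"
  unfolding gap_sum_def points_eq data_eq
proof -
  interpret rot: triangle_pair G H b0 b1 c0 c1 a0 a1 xb xc xa \<tau> by (rule rotate)
  interpret rot2: triangle_pair G H c0 c1 a0 a1 b0 b1 xc xa xb \<tau> by (rule rot.rotate)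
  have *: "btw H a1 x b0 = btw G a1 x b0" "btw H b1 x c0 = btw G b1 x c0" "btw H c1 x a0 = btw G c1 x a0"
    "btw H a1 (mate G x) b0 = btw G a1 (mate G x) b0" "btw H b1 (mate G x) c0 = btw G b1 (mate G x) c0"
    "btw H c1 (mate G x) a0 = btw G c1 (mate G x) a0" if "x \<in> Y" for x
    using that mate_Y[OF that] arc_T(1) rot.arc_T(1) rot2.arc_T(1) by auto
  show "(\<Sum>x\<in>Y. if btw H a1 x b0 \<and> btw H b1 (mate G x) c0 then ori G x else 0) =
      (\<Sum>x\<in>Y. if btw G a1 x b0 \<and> btw G b1 (mate G x) c0 then ori G x else 0)"
     "(\<Sum>x\<in>Y. if btw H b1 x c0 \<and> btw H c1 (mate G x) a0 then ori G x else 0) =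
      (\<Sum>x\<in>Y. if btw G b1 x c0 \<and> btw G c1 (mate G x) a0 then ori G x else 0)"
     "(\<Sum>x\<in>Y. if btw H c1 x a0 \<and> btw H a1 (mate G x) b0 then ori G x else 0) =
      (\<Sum>x\<in>Y. if btw G c1 x a0 \<and> btw G a1 (mate G x) b0 then ori G x else 0)"
    by (intro sum.cong refl; simp only: *)+
qed

text \<open>
  Passing from \<open>G\<close> to \<open>H\<close> replaces the set of strands with a bit by its complement. The bit of a
  strand, read as a sign, times the orientations of the two chords meeting there is the product of all three
  bits. So the difference of the two sums is a multiple of the expression in \<open>weight_triangle\<close>.
\<close>

lemma phi_chords_triangle:
  assumes "i \<noteq> j" "j \<noteq> k" "i \<noteq> k"
  shows "phi_chords i j k H = phi_chords i j k G"
proof -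
  let ?w = "weight i j k"
  define S1 S2 S3 where
    "S1 = ?w (over G a1) (over G b1) Wa Wc Wb + ?w (over G b1) (over G a1) Wc Wa Wb"
    and "S2 = ?w (over G b1) (over G c1) Wb Wa Wc + ?w (over G c1) (over G b1) Wa Wb Wc"
    and "S3 = ?w (over G c1) (over G a1) Wc Wb Wa + ?w (over G a1) (over G c1) Wb Wc Wa"
  have fl: "pm (\<not> x) = - pm x" for x by (simp add: pm_def)
  have "S1 + S2 + S3 = 0"
    using weight_triangle[OF assms layers, of Wa Wc Wb] unfolding S1_def S2_def S3_def by simp
  then have "S3 = - S1 - S2" by simp
  moreover have "(\<Sum>s\<in>T. \<Sum>t\<in>T. pair_term i j k G s t) = (if xb then pm xa * pm xc * S1 else 0)
     + (if xc then pm xa * pm xb * S2 else 0) + (if xa then pm xb * pm xc * S3 else 0)"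
    unfolding sum_terms_inside S1_def S2_def S3_def ..
  moreover have "(\<Sum>s\<in>T. \<Sum>t\<in>T. pair_term i j k H s t) = (if \<not> xb then pm xa * pm xc * S1 else 0)
     + (if \<not> xc then pm xa * pm xb * S2 else 0) + (if \<not> xa then pm xb * pm xc * S3 else 0)"
    unfolding triangle_pair.sum_terms_inside[OF flip] data_eq gap_sum_H S1_def S2_def S3_def
    by (simp only: fl simp_thms minus_mult_minus)
  ultimately have TT: "(\<Sum>s\<in>T. \<Sum>t\<in>T. pair_term i j k H s t) = (\<Sum>s\<in>T. \<Sum>t\<in>T. pair_term i j k G s t)"
    by (cases xa; cases xb; cases xc) (simp_all add: pm_def)
  have d: "finite Y" "finite T" "Y \<inter> T = {}" by auto
  have "(\<Sum>s\<in>Y. \<Sum>t\<in>Y. pair_term i j k H s t) = (\<Sum>s\<in>Y. \<Sum>t\<in>Y. pair_term i j k G s t)"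
    by (intro sum.cong refl) (rule term_YY)
  moreover have "(\<Sum>s\<in>Y. \<Sum>t\<in>T. pair_term i j k H s t) = (\<Sum>s\<in>Y. \<Sum>t\<in>T. pair_term i j k G s t)"
    by (intro sum.cong refl) (rule term_cross)
  moreover have "(\<Sum>t\<in>Y. \<Sum>s\<in>T. pair_term i j k H s t) = (\<Sum>t\<in>Y. \<Sum>s\<in>T. pair_term i j k G s t)"
    by (intro sum.cong refl) (rule term_cross)
  ultimately have "(\<Sum>s\<in>Y \<union> T. \<Sum>t\<in>Y \<union> T. pair_term i j k H s t) =
      (\<Sum>s\<in>Y \<union> T. \<Sum>t\<in>Y \<union> T. pair_term i j k G s t)"
    unfolding sum_union_both[OF d] TT by simp
  then show ?thesis
    unfolding phi_chords_def points_eq points_split[symmetric] .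
qed

end

section \<open>From arrows to chords\<close>

lemma arc_ccw_cyc:
  assumes "a \<noteq> b" "a \<in> {0..<1}" "b \<in> {0..<1}"
  shows "arc_ccw a b = {x \<in> {0..<1}. cyc a x b}"
  using assms unfolding arc_ccw_def cyc_def by auto

lemma btw_rotate2: "btw G x y z \<Longrightarrow> btw G z x y"
  by (rule btw_rotate, rule btw_rotate)

text \<open>
  Both ends of a chord give the same arrow. The orientation is the sign of the crossing
  at the over end and its negative at the under end.
\<close>

definition arrow_of :: "real chords \<Rightarrow> real \<Rightarrow> arrow" where
  "arrow_of G s = (if over G s then Arrow s (mate G s) (ori G s) else Arrow (mate G s) s (- ori G s))"

locale circle_chords = chord_diagram G for G :: "real chords" +
  assumes pos_id: "pos G x = x" and points_unit: "points G \<subseteq> {0..<1}"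
begin

abbreviation "arcs s \<equiv> arc_ccw s (mate G s)"
abbreviation "D \<equiv> arrow_of G ` points G"

lemma in_unit: "x \<in> points G \<Longrightarrow> x \<in> {0..<1}"
  using points_unit by auto

lemma in_arc: "s \<in> points G \<Longrightarrow> x \<in> {0..<1} \<Longrightarrow> x \<in> arcs s \<longleftrightarrow> btw G s x (mate G s)"
  using arc_ccw_cyc[of s "mate G s"] in_unit[of s] in_unit[of "mate G s"] mate_neq[of s, THEN not_sym]
  by (auto simp: btw_def pos_id)

lemma in_arc': "s \<in> points G \<Longrightarrow> x \<in> {0..<1} \<Longrightarrow> x \<in> arc_ccw (mate G s) s \<longleftrightarrow> btw G (mate G s) x s"
  using in_arc[of "mate G s"] by simp

lemma arrow_of_mate: "s \<in> points G \<Longrightarrow> arrow_of G (mate G s) = arrow_of G s"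
  by (simp add: arrow_of_def)

lemma arrow_of_eq: "s \<in> points G \<Longrightarrow> t \<in> points G \<Longrightarrow> arrow_of G s = arrow_of G t \<Longrightarrow> t = s \<or> t = mate G s"
  by (auto simp: arrow_of_def split: if_splits)

lemma tail_head:
  "over G s \<Longrightarrow> tail (arrow_of G s) = s" "over G s \<Longrightarrow> head (arrow_of G s) = mate G s"
  "\<not> over G s \<Longrightarrow> tail (arrow_of G s) = mate G s" "\<not> over G s \<Longrightarrow> head (arrow_of G s) = s"
  "asign (arrow_of G s) = (if over G s then ori G s else - ori G s)"
  by (auto simp: arrow_of_def)

lemma apart_sides:
  assumes "apart G s t"
  shows "btw G s (mate G s) t" "btw G s (mate G s) (mate G t)"
proof -
  show *: "btw G s (mate G s) t" using assms unfolding apart_def by simp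
  have "btw G s t (mate G t)" using assms unfolding apart_def by (metis btw_rotate2)
  then show "btw G s (mate G s) (mate G t)" by (rule btw_trans[OF *])
qed

lemma apart_outside:
  assumes "apart G s t" "s \<in> points G" "t \<in> points G" "u \<in> {t, mate G t}"
  shows "u \<notin> arcs s" "u \<in> arc_ccw (mate G s) s"
proof -
  have u: "u \<in> points G" "btw G s (mate G s) u" using assms apart_sides by auto
  show "u \<notin> arcs s" using in_arc[OF assms(2) in_unit[OF u(1)]] btw_asym[OF u(2)] by simp
  show "u \<in> arc_ccw (mate G s) s" using in_arc'[OF assms(2) in_unit[OF u(1)]] btw_rotate[OF u(2)] by simp
qed

lemma apart_outer:
  assumes "apart G s t" "s \<in> points G" "t \<in> points G"
  shows "outer_arc (arrow_of G s) (arrow_of G t) = arcs s" "type_t (arrow_of G s) (arrow_of G t) \<longleftrightarrow> over G s"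
proof -
  have tl: "tail (arrow_of G t) \<in> {t, mate G t}" by (cases "over G t") (simp_all add: tail_head)
  note o = apart_outside[OF assms tl]
  show 1: "outer_arc (arrow_of G s) (arrow_of G t) = arcs s"
    using o by (cases "over G s") (simp_all add: outer_arc_def tail_head)
  show "type_t (arrow_of G s) (arrow_of G t) \<longleftrightarrow> over G s"
    unfolding type_t_def 1 using o by (cases "over G s") (auto simp: tail_head)
qed

text \<open>
  For a chord from the arc of \<open>s\<close> to the other side, the factors \<open>asign\<close> and \<open>int_num\<close> both change
  when its over/under information is switched. Their product depends only on the orientation of the chord
  and, by a global sign that the absolute value removes, on the direction of the arrow at \<open>s\<close>.
\<close>

lemma label_arcs:
  assumes s: "s \<in> points G" and Q: "Q \<inter> arcs s = {}" "Q \<inter> {s, mate G s} = {}"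
  shows "label D (arrow_of G s) (arcs s) Q =
    nat \<bar>\<Sum>x\<in>points G. if x \<in> arcs s \<and> mate G x \<in> Q then ori G x else 0\<bar>"
proof -
  let ?S = "{x \<in> points G. x \<in> arcs s \<and> mate G x \<in> Q}"
  have "connecting D (arcs s) Q = arrow_of G ` ?S"
  proof (intro set_eqI iffI)
    fix c assume c: "c \<in> connecting D (arcs s) Q"
    then obtain x where x: "x \<in> points G" "c = arrow_of G x"
      and a: "tail c \<in> arcs s \<and> head c \<in> Q \<or> tail c \<in> Q \<and> head c \<in> arcs s"
      unfolding connecting_def by auto
    then have "x \<in> arcs s \<and> mate G x \<in> Q \<or> x \<in> Q \<and> mate G x \<in> arcs s"
      by (cases "over G x") (auto simp: tail_head)
    then have "x \<in> ?S \<or> mate G x \<in> ?S" using x by auto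
    then show "c \<in> arrow_of G ` ?S"
    proof
      assume "mate G x \<in> ?S"
      then have "arrow_of G (mate G x) \<in> arrow_of G ` ?S" by (rule imageI)
      then show ?thesis by (simp only: arrow_of_mate[OF x(1)] x(2))
    qed (simp only: x(2) imageI)
  next
    fix c assume "c \<in> arrow_of G ` ?S"
    then obtain x where x: "x \<in> points G" "c = arrow_of G x" "x \<in> arcs s" "mate G x \<in> Q" by auto
    then show "c \<in> connecting D (arcs s) Q"
      unfolding connecting_def by (cases "over G x") (auto simp: tail_head)
  qed
  moreover have "inj_on (arrow_of G) ?S"
  proof (rule inj_onI)
    fix x y assume x: "x \<in> ?S" and y: "y \<in> ?S" and "arrow_of G x = arrow_of G y"
    then have "y = x \<or> y = mate G x" using arrow_of_eq by simp
    then show "x = y" using x y Q(1) by blast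
  qed
  ultimately have "(\<Sum>c\<in>connecting D (arcs s) Q. asign c * int_num (arrow_of G s) c)
      = (\<Sum>x\<in>?S. asign (arrow_of G x) * int_num (arrow_of G s) (arrow_of G x))"
    by (simp add: sum.reindex)
  also have "\<dots> = (\<Sum>x\<in>?S. (if over G s then - 1 else 1) * ori G x)"
  proof (intro sum.cong refl)
    fix x assume "x \<in> ?S"
    then have x: "x \<in> points G" "x \<in> arcs s" "mate G x \<in> Q" "mate G x \<in> points G" by auto
    have m: "mate G x \<notin> arcs s" "mate G x \<noteq> s" "mate G x \<noteq> mate G s" using x Q by auto
    have "btw G s (mate G s) (mate G x)"
      using m x s in_arc[OF s in_unit[OF x(4)]] btw_total[of s "mate G x" "mate G s"] mate_neq[OF s] by auto
    then have m': "mate G x \<in> arc_ccw (mate G s) s"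
      using in_arc'[OF s in_unit[OF x(4)]] btw_rotate by simp
    have "btw G s x (mate G s)" using in_arc[OF s in_unit[OF x(1)]] x by simp
    then have "\<not> btw G (mate G s) x s" using btw_asym btw_rotate_iff[of G "mate G s" x s] by simp
    then have x': "x \<notin> arc_ccw (mate G s) s" using in_arc'[OF s in_unit[OF x(1)]] by simp
    show "asign (arrow_of G x) * int_num (arrow_of G s) (arrow_of G x) = (if over G s then - 1 else 1) * ori G x"
      using m(1) m' x(2) x' by (cases "over G x"; cases "over G s") (simp_all add: int_num_def tail_head)
  qed
  also have "\<dots> = (if over G s then - 1 else 1) * (\<Sum>x\<in>?S. ori G x)"
    by (simp add: sum_distrib_left)
  also have "(\<Sum>x\<in>?S. ori G x) = (\<Sum>x\<in>points G. if x \<in> arcs s \<and> mate G x \<in> Q then ori G x else 0)"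
    by (simp add: sum.inter_filter)
  finally show ?thesis unfolding label_def by (simp add: abs_mult)
qed

lemma apart_labels:
  assumes "apart G s t" "s \<in> points G" "t \<in> points G"
  shows "w_out D (arrow_of G s) (arrow_of G t) = nat \<bar>link G s t\<bar>"
    and "w_mid D (arrow_of G s) (arrow_of G t) = nat \<bar>index G s - link G s t\<bar>"
proof -
  have ap': "apart G t s" using assms(1) apart_sym by simp
  have B: "arcs t \<inter> arcs s = {}"
  proof -
    have "\<not> (btw G s x (mate G s) \<and> btw G t x (mate G t))" for x
    proof
      assume "btw G s x (mate G s) \<and> btw G t x (mate G t)"
      then have x: "btw G s x (mate G s)" "btw G t x (mate G t)" by auto
      have "btw G s x t" by (rule btw_trans[OF x(1) apart_sides(1)[OF assms(1)]])
      moreover have "btw G t x s" by (rule btw_trans[OF x(2) apart_sides(1)[OF ap']])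
      ultimately show False using btw_asym[of G s x t] btw_rotate[OF btw_rotate[of G t x s]] by simp
    qed
    moreover have "x \<in> {0..<1}" if "x \<in> arcs s" for x
      using that in_unit[OF assms(2)] in_unit[of "mate G s"] assms(2)
      by (auto simp: arc_ccw_def split: if_splits)
    ultimately show ?thesis using in_arc assms(2,3) by blast
  qed
  have sB: "arcs t \<inter> {s, mate G s} = {}"
    using apart_outside(1)[OF ap' assms(3,2)] by auto
  show "w_out D (arrow_of G s) (arrow_of G t) = nat \<bar>link G s t\<bar>"
    unfolding w_out_def apart_outer(1)[OF assms] apart_outer(1)[OF ap' assms(3,2)] label_arcs[OF assms(2) B sB]
      link_def
    by (intro arg_cong[where f = "\<lambda>z. nat \<bar>z\<bar>"] sum.cong refl if_cong)
      (use in_arc in_unit assms(2,3) in auto)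
  have ends: "{tail (arrow_of G u), head (arrow_of G u)} = {u, mate G u}" for u
    by (cases "over G u") (auto simp: tail_head)
  have M: "middle_arcs (arrow_of G s) (arrow_of G t) = {0..<1} - (arcs s \<union> arcs t \<union> {s, mate G s, t, mate G t})"
    unfolding middle_arcs_def apart_outer(1)[OF assms] apart_outer(1)[OF ap' assms(3,2)]
    using ends[of s] ends[of t] by blast
  have M1: "middle_arcs (arrow_of G s) (arrow_of G t) \<inter> arcs s = {}"
    and M2: "middle_arcs (arrow_of G s) (arrow_of G t) \<inter> {s, mate G s} = {}"
    unfolding M by blast+
  show "w_mid D (arrow_of G s) (arrow_of G t) = nat \<bar>index G s - link G s t\<bar>"
    unfolding w_mid_def apart_outer(1)[OF assms] index_minus_link[OF assms]
      label_arcs[OF assms(2) M1 M2]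
    proof (intro arg_cong[where f = "\<lambda>z. nat \<bar>z\<bar>"] sum.cong refl if_cong)
      fix x assume x: "x \<in> points G"
      have no: "mate G x \<notin> {s, mate G s, t, mate G t}" if "x \<in> arcs s"
      proof
        assume "mate G x \<in> {s, mate G s, t, mate G t}"
        then have "mate G (mate G x) \<in> mate G ` {s, mate G s, t, mate G t}" by (rule imageI)
        then have "x \<in> {mate G s, s, mate G t, t}"
          by (simp only: image_insert image_empty mate_mate[OF x] mate_mate[OF assms(2)] mate_mate[OF assms(3)])
        moreover have "s \<notin> arcs s" "mate G s \<notin> arcs s"
          using in_arc[OF assms(2) in_unit] assms(2) by simp_all
        ultimately show False
          using that apart_outside(1)[OF assms, of x] by blast
      qed
      show "(x \<in> arcs s \<and> mate G x \<in> middle_arcs (arrow_of G s) (arrow_of G t)) \<longleftrightarrow>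
        (btw G s x (mate G s) \<and> \<not> btw G s (mate G x) (mate G s) \<and> \<not> btw G t (mate G x) (mate G t))"
        unfolding M using no in_arc[OF assms(2) in_unit[OF x]] in_arc[OF assms(2) in_unit[of "mate G x"]]
          in_arc[OF assms(3) in_unit[of "mate G x"]] in_unit[of "mate G x"] x by auto
    qed
qed

lemma pair_term_matches:
  assumes "s \<in> points G" "t \<in> points G"
  shows "pair_term i j k G s t = (if apart G s t \<and> matches_F i j k D (arrow_of G s) (arrow_of G t)
    then asign (arrow_of G s) * asign (arrow_of G t) else 0)"
proof (cases "apart G s t")
  case True
  then have ap': "apart G t s" using apart_sym by simp
  have mt: "w_mid D (arrow_of G t) (arrow_of G s) = nat \<bar>index G t + link G s t\<bar>"
    using apart_labels(2)[OF ap' assms(2,1)] link_antisym[of t s] by simp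
  have n: "\<bar>z\<bar> = int n \<longleftrightarrow> nat \<bar>z\<bar> = n" for z n by auto
  show ?thesis
    using True unfolding pair_term_def matches_F_def type_h_def weight_def n
      apart_labels[OF True assms] mt apart_outer(2)[OF True assms] apart_outer(2)[OF ap' assms(2,1)]
    by (cases "over G s"; cases "over G t") (simp_all add: tail_head)
qed (simp add: pair_term_def)

lemma not_intersects:
  assumes "s \<in> points G" "t \<in> points G"
  shows "intersects (arrow_of G s) (arrow_of G t) \<longleftrightarrow>
    btw G t s (mate G t) \<and> btw G (mate G t) (mate G s) t \<or> btw G t (mate G s) (mate G t) \<and> btw G (mate G t) s t"
  using in_arc[OF assms(2) in_unit, of s] in_arc[OF assms(2) in_unit, of "mate G s"]
    in_arc'[OF assms(2) in_unit, of s] in_arc'[OF assms(2) in_unit, of "mate G s"] assms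
  unfolding intersects_def by (cases "over G s"; cases "over G t") (auto simp: tail_head)

text \<open>Each of two disjoint chords has exactly one end from which the arc to its mate avoids the other chord.\<close>

lemma exists_apart:
  assumes st: "s \<in> points G" "t \<in> points G" "arrow_of G s \<noteq> arrow_of G t" "\<not> intersects (arrow_of G s) (arrow_of G t)"
  obtains u v where "u \<in> points G" "v \<in> points G" "arrow_of G u = arrow_of G s" "arrow_of G v = arrow_of G t" "apart G u v"
proof -
  have "mate G s \<noteq> mate G t"
  proof
    assume "mate G s = mate G t"
    then have "mate G (mate G s) = mate G (mate G t)" by (rule arg_cong)
    then have "s = t" by (simp only: mate_mate[OF st(1)] mate_mate[OF st(2)])
    then show False using st(3) by simp
  qed
  moreover have "s \<noteq> mate G t" "mate G s \<noteq> t"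
    using st(3) arrow_of_mate[OF st(1)] arrow_of_mate[OF st(2)] by metis+
  moreover have "s \<noteq> t" using st(3) by auto
  ultimately have d: "s \<noteq> t" "s \<noteq> mate G t" "mate G s \<noteq> t" "mate G s \<noteq> mate G t"
      "s \<noteq> mate G s" "t \<noteq> mate G t"
    using mate_neq[OF st(1), THEN not_sym] mate_neq[OF st(2), THEN not_sym] by simp_all
  have in4: "mate G s \<in> points G" "mate G t \<in> points G" using st by auto
  obtain v where v: "v \<in> {t, mate G t}" "btw G v (mate G v) s" "btw G v (mate G v) (mate G s)"
  proof (cases "btw G t s (mate G t)")
    case True
    have "\<not> btw G (mate G t) (mate G s) t" using True st not_intersects[OF st(1,2)] by simp
    then have "btw G (mate G t) t (mate G s)"
      using btw_total[of "mate G t" "mate G s" t] d in4 st by auto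
    moreover have "btw G (mate G t) t s" using True by (rule btw_rotate2)
    ultimately show ?thesis using that[of "mate G t"] st by simp
  next
    case False
    then have 1: "btw G t (mate G t) s" using btw_total[of t s "mate G t"] d in4 st by auto
    then have "btw G (mate G t) s t" by (rule btw_rotate)
    then have "\<not> btw G t (mate G s) (mate G t)" using st not_intersects[OF st(1,2)] by simp
    then have "btw G t (mate G t) (mate G s)" using btw_total[of t "mate G s" "mate G t"] d in4 st by auto
    then show ?thesis using that[of t] 1 by simp
  qed
  have vp: "v \<in> points G" "arrow_of G v = arrow_of G t" "v \<noteq> s" "v \<noteq> mate G s"
    using v(1) st(1,2) arrow_of_mate[OF st(2)] d by (elim insertE emptyE; simp)+
  show ?thesis
  proof (cases "btw G s (mate G s) v")
    case True
    then show ?thesis using that[of s v] st vp v unfolding apart_def by auto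
  next
    case False
    then have "btw G s v (mate G s)" using btw_total[of s v "mate G s"] d in4 st vp by auto
    then have "btw G (mate G s) s v" by (rule btw_rotate2)
    then show ?thesis using that[of "mate G s" v] st vp v arrow_of_mate unfolding apart_def by auto
  qed
qed

lemma apart_not_intersects:
  assumes "apart G s t" "s \<in> points G" "t \<in> points G"
  shows "\<not> intersects (arrow_of G s) (arrow_of G t)" "arrow_of G s \<noteq> arrow_of G t"
proof -
  have ap': "apart G t s" using assms(1) apart_sym by simp
  show "\<not> intersects (arrow_of G s) (arrow_of G t)"
    unfolding not_intersects[OF assms(2,3)] using btw_asym[OF apart_sides(1)[OF ap']] btw_asym[OF apart_sides(2)[OF ap']] by simp
  show "arrow_of G s \<noteq> arrow_of G t"
    using arrow_of_eq[OF assms(2,3)] apart_sides(1)[OF assms(1)] by auto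
qed

lemma apart_unique:
  assumes "apart G s t" "apart G s' t'" "s \<in> points G" "t \<in> points G" "s' \<in> points G" "t' \<in> points G"
    "arrow_of G s = arrow_of G s'" "arrow_of G t = arrow_of G t'"
  shows "s = s'"
proof (rule ccontr)
  assume "s \<noteq> s'"
  then have s': "s' = mate G s" using arrow_of_eq[OF assms(3,5,7)] by auto
  have t': "t' = t \<or> t' = mate G t" using arrow_of_eq[OF assms(4,6,8)] by auto
  have "btw G s (mate G s) t'" using apart_sides[OF assms(1)] t' by auto
  moreover have "btw G (mate G s) s t'" using apart_sides(1)[OF assms(2)] s' assms(3) by simp
  ultimately show False using btw_asym[of G s "mate G s" t'] btw_rotate[of G "mate G s" s t'] by simp
qed

text \<open>
  For distinct \<open>i\<close>, \<open>j\<close>, \<open>k\<close> the conditions on an ordered pair of arrows exclude those on the reversed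
  pair, so a matching subdiagram determines the order of its arrows and, through the outer arcs,
  the starting points of these arcs.
\<close>

lemma sum_pairing_eq_phi_chords:
  assumes ijk: "i \<noteq> j" "j \<noteq> k" "i \<noteq> k"
  shows "(\<Sum>D' | \<exists>a b. D' = {a, b} \<and> a \<noteq> b \<and> D' \<subseteq> D \<and> \<not> intersects a b. pairing_F i j k D D')
    = phi_chords i j k G"
proof -
  let ?DD = "{D'. \<exists>a b. D' = {a, b} \<and> a \<noteq> b \<and> D' \<subseteq> D \<and> \<not> intersects a b}"
  let ?M = "matches_F i j k D"
  let ?E = "{D' \<in> ?DD. \<exists>a b. D' = {a, b} \<and> a \<noteq> b \<and> ?M a b}"
  let ?Q = "{p \<in> points G \<times> points G. apart G (fst p) (snd p) \<and> ?M (arrow_of G (fst p)) (arrow_of G (snd p))}"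
  have antisym: "\<not> (?M a b \<and> ?M b a)" for a b
    using ijk unfolding matches_F_def type_h_def by auto
  have fin: "finite ?DD" by (rule finite_subset[of _ "Pow D"]) auto
  have "bij_betw (\<lambda>p. {arrow_of G (fst p), arrow_of G (snd p)}) ?Q ?E"
  proof (rule bij_betw_imageI)
    show "inj_on (\<lambda>p. {arrow_of G (fst p), arrow_of G (snd p)}) ?Q"
    proof (rule inj_onI)
      fix p q assume p: "p \<in> ?Q" and q: "q \<in> ?Q"
        and e: "{arrow_of G (fst p), arrow_of G (snd p)} = {arrow_of G (fst q), arrow_of G (snd q)}"
      have in4: "fst p \<in> points G" "snd p \<in> points G" "fst q \<in> points G" "snd q \<in> points G"
        and ap: "apart G (fst p) (snd p)" "apart G (fst q) (snd q)"
        and m: "?M (arrow_of G (fst p)) (arrow_of G (snd p))" "?M (arrow_of G (fst q)) (arrow_of G (snd q))"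
        using p q by auto
      have ap': "apart G (snd p) (fst p)" "apart G (snd q) (fst q)"
        using ap apart_sym by simp_all
      from e have "arrow_of G (fst p) = arrow_of G (fst q) \<and> arrow_of G (snd p) = arrow_of G (snd q) \<or>
          arrow_of G (fst p) = arrow_of G (snd q) \<and> arrow_of G (snd p) = arrow_of G (fst q)"
        by (simp add: doubleton_eq_iff)
      then have eq: "arrow_of G (fst p) = arrow_of G (fst q)" "arrow_of G (snd p) = arrow_of G (snd q)"
        using m antisym[of "arrow_of G (fst p)" "arrow_of G (snd p)"] by auto
      have "fst p = fst q" by (rule apart_unique[OF ap in4 eq])
      moreover have "snd p = snd q" by (rule apart_unique[OF ap' in4(2,1,4,3) eq(2,1)])
      ultimately show "p = q" by (simp add: prod_eq_iff)
    qed
    show "(\<lambda>p. {arrow_of G (fst p), arrow_of G (snd p)}) ` ?Q = ?E"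
    proof (intro set_eqI iffI)
      fix D' assume "D' \<in> (\<lambda>p. {arrow_of G (fst p), arrow_of G (snd p)}) ` ?Q"
      then obtain s t where st: "s \<in> points G" "t \<in> points G" "apart G s t" "?M (arrow_of G s) (arrow_of G t)"
        "D' = {arrow_of G s, arrow_of G t}" by auto
      then show "D' \<in> ?E" using apart_not_intersects[OF st(3,1,2)] by auto
    next
      fix D' assume "D' \<in> ?E"
      then obtain a b c d where D': "D' = {a, b}" "a \<noteq> b" "D' \<subseteq> D" "\<not> intersects a b"
        "D' = {c, d}" "c \<noteq> d" "?M c d" by blast
      obtain s t where "s \<in> points G" "t \<in> points G" "a = arrow_of G s" "b = arrow_of G t" using D'(1,3) by auto
      then obtain u v where uv: "u \<in> points G" "v \<in> points G" "arrow_of G u = a" "arrow_of G v = b" "apart G u v"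
        using exists_apart D'(2,4) by metis
      consider "c = a" "d = b" | "c = b" "d = a" using D'(1,5) by (auto simp: doubleton_eq_iff)
      then show "D' \<in> (\<lambda>p. {arrow_of G (fst p), arrow_of G (snd p)}) ` ?Q"
      proof cases
        case 1
        then show ?thesis using uv D' by (intro image_eqI[of _ _ "(u, v)"]) auto
      next
        case 2
        moreover have "apart G v u" using uv(5) apart_sym by simp
        ultimately show ?thesis using uv D' by (intro image_eqI[of _ _ "(v, u)"]) auto
      qed
    qed
  qed
  note bij = this
  have "(\<Sum>D'\<in>?DD. pairing_F i j k D D') = (\<Sum>D'\<in>?E. \<Prod>c\<in>D'. asign c)"
    unfolding pairing_F_def by (rule sum.inter_filter[OF fin, symmetric])
  also have "\<dots> = (\<Sum>p\<in>?Q. \<Prod>c\<in>{arrow_of G (fst p), arrow_of G (snd p)}. asign c)"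
    by (rule sum.reindex_bij_betw[OF bij, symmetric])
  also have "\<dots> = (\<Sum>p\<in>?Q. asign (arrow_of G (fst p)) * asign (arrow_of G (snd p)))"
    by (intro sum.cong refl) (use apart_not_intersects(2) in auto)
  also have "\<dots> = (\<Sum>p\<in>points G \<times> points G. pair_term i j k G (fst p) (snd p))"
    by (subst sum.inter_filter) (auto simp: pair_term_matches intro!: sum.cong)
  also have "\<dots> = phi_chords i j k G"
    unfolding phi_chords_def by (subst sum.cartesian_product) (simp add: case_prod_unfold)
  finally show ?thesis .
qed

end

section \<open>The chord diagram of a plane diagram, and isotopy\<close>

lemma cross2_antisym: "cross2 w z = - cross2 z w"
  by (simp add: cross2_def)

lemma crossing_sym: "crossing K s t \<Longrightarrow> crossing K t s"
  by (auto simp: crossing_def)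

definition partner :: "diagram \<Rightarrow> real \<Rightarrow> real" where
  "partner K s = (THE t. crossing K s t)"

definition chords_of :: "diagram \<Rightarrow> real chords" where
  "chords_of K = Chords {s. (\<exists>t. crossing K s t) \<and> mark K s \<in> {Over, Under}} (\<lambda>s. s) (partner K)
     (\<lambda>s. if cross2 (vel K s) (vel K (partner K s)) > 0 then 1 else - 1) (\<lambda>s. mark K s = Over)"

locale generic_diagram =
  fixes K :: diagram
  assumes sing: "singular_diagram K"
begin

lemma crossing_unique: "crossing K s t \<Longrightarrow> crossing K s u \<Longrightarrow> t = u"
  using sing unfolding singular_diagram_def by blast

lemma partner: "crossing K s t \<Longrightarrow> partner K s = t"
  unfolding partner_def using crossing_unique by blast

lemma transverse: "crossing K s t \<Longrightarrow> cross2 (vel K s) (vel K t) \<noteq> 0"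
  using sing unfolding singular_diagram_def by blast

lemma marks: "crossing K s t \<Longrightarrow> (mark K s, mark K t) \<in>
    {(Over, Under), (Under, Over), (Virtual, Virtual), (Singular, Singular)}"
  using sing unfolding singular_diagram_def by blast

lemma periodic: "curve K (t + 1) = curve K t" "mark K (t + 1) = mark K t"
  using sing unfolding singular_diagram_def by blast+

lemma points_iff: "s \<in> points (chords_of K) \<longleftrightarrow> (\<exists>t. crossing K s t) \<and> mark K s \<in> {Over, Under}"
  by (simp add: chords_of_def)

lemma chords_sel: "pos (chords_of K) s = s" "over (chords_of K) s \<longleftrightarrow> mark K s = Over"
  "mate (chords_of K) s = partner K s"
  by (simp_all add: chords_of_def)

lemma mate_crossing: "crossing K s t \<Longrightarrow> mate (chords_of K) s = t"
  by (simp add: chords_sel partner)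

lemma ori_crossing: "crossing K s t \<Longrightarrow> ori (chords_of K) s = (if cross2 (vel K s) (vel K t) > 0 then 1 else - 1)"
  by (simp add: chords_of_def partner)

lemma btw_chords: "btw (chords_of K) x y z = cyc x y z"
  by (simp add: btw_def chords_sel)

lemma points_obtain:
  assumes "s \<in> points (chords_of K)"
  obtains t where "crossing K s t" "crossing K t s" "mark K s = Over \<and> mark K t = Under \<or> mark K s = Under \<and> mark K t = Over"
proof -
  obtain t where t: "crossing K s t" "mark K s \<in> {Over, Under}" using assms points_iff by blast
  show ?thesis
    by (rule that[OF t(1) crossing_sym[OF t(1)]]) (use marks[OF t(1)] t(2) in auto)
qed

sublocale chords: circle_chords "chords_of K"
proof
  have "points (chords_of K) \<subseteq> fst ` {(s, t). crossing K s t}"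
    unfolding chords_of_def by force
  moreover have "finite {(s, t). crossing K s t}" using sing unfolding singular_diagram_def by blast
  ultimately show "finite (points (chords_of K))" by (meson finite_imageI finite_subset)
  show "inj_on (pos (chords_of K)) (points (chords_of K))" by (simp add: chords_sel inj_on_def)
  show "pos (chords_of K) x = x" for x by (simp add: chords_sel)
  show "points (chords_of K) \<subseteq> {0..<1}" unfolding chords_of_def crossing_def by auto
  fix x assume "x \<in> points (chords_of K)"
  then obtain t where t: "crossing K x t" "crossing K t x"
      "mark K x = Over \<and> mark K t = Under \<or> mark K x = Under \<and> mark K t = Over"
    by (rule points_obtain)
  have m: "mate (chords_of K) x = t" "mate (chords_of K) t = x" using t mate_crossing by auto
  show "mate (chords_of K) x \<in> points (chords_of K)" unfolding m points_iff using t by auto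
  show "mate (chords_of K) (mate (chords_of K) x) = x" by (simp add: m)
  show "mate (chords_of K) x \<noteq> x" unfolding m using t(1) by (simp add: crossing_def)
  show "ori (chords_of K) (mate (chords_of K) x) = - ori (chords_of K) x"
    unfolding m ori_crossing[OF t(1)] ori_crossing[OF t(2)]
    using transverse[OF t(1)] cross2_antisym[of "vel K t" "vel K x"] by auto
  show "over (chords_of K) (mate (chords_of K) x) \<longleftrightarrow> \<not> over (chords_of K) x"
    unfolding m chords_sel(2) using t(3) by auto
  show "ori (chords_of K) x = 1 \<or> ori (chords_of K) x = - 1"
    by (simp add: chords_of_def)
qed

lemma gauss_diagram_eq: "gauss_diagram K = arrow_of (chords_of K) ` points (chords_of K)"
proof (intro set_eqI iffI)
  fix c assume "c \<in> gauss_diagram K"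
  then obtain s t where c: "c = Arrow s t (if cross2 (vel K s) (vel K t) > 0 then 1 else - 1)"
    "crossing K s t" "mark K s = Over" "mark K t = Under"
    unfolding gauss_diagram_def by blast
  then have "c = arrow_of (chords_of K) s"
    unfolding arrow_of_def chords_sel(2) using mate_crossing[OF c(2)] ori_crossing[OF c(2)] by simp
  moreover have "s \<in> points (chords_of K)" using c points_iff by auto
  ultimately show "c \<in> arrow_of (chords_of K) ` points (chords_of K)" by blast
next
  fix c assume "c \<in> arrow_of (chords_of K) ` points (chords_of K)"
  then obtain x where x: "x \<in> points (chords_of K)" "c = arrow_of (chords_of K) x" by blast
  obtain t where t: "crossing K x t" "crossing K t x"
      "mark K x = Over \<and> mark K t = Under \<or> mark K x = Under \<and> mark K t = Over"
    by (rule points_obtain[OF x(1)])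
  from t(3) show "c \<in> gauss_diagram K"
  proof
    assume "mark K x = Over \<and> mark K t = Under"
    then show ?thesis
      unfolding gauss_diagram_def x(2) arrow_of_def chords_sel(2) mate_crossing[OF t(1)] ori_crossing[OF t(1)]
      using t by auto
  next
    assume m: "mark K x = Under \<and> mark K t = Over"
    have "c = Arrow t x (if cross2 (vel K t) (vel K x) > 0 then 1 else - 1)"
      unfolding x(2) arrow_of_def chords_sel(2) mate_crossing[OF t(1)] ori_crossing[OF t(1)]
      using m transverse[OF t(1)] cross2_antisym[of "vel K t" "vel K x"] by auto
    then show ?thesis unfolding gauss_diagram_def using t(2) m by blast
  qed
qed

lemma phi_eq_phi_chords:
  assumes "i \<noteq> j" "j \<noteq> k" "i \<noteq> k"
  shows "phi i j k K = phi_chords i j k (chords_of K)"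
  unfolding phi_def gauss_diagram_eq by (rule chords.sum_pairing_eq_phi_chords[OF assms])

lemma periodic_int: "curve K (t + of_int n) = curve K t" "mark K (t + of_int n) = mark K t"
proof -
  have nat: "curve K (t + real m) = curve K t \<and> mark K (t + real m) = mark K t" for t m
  proof (induction m)
    case (Suc m)
    have e: "t + real (Suc m) = (t + real m) + 1" by simp
    show ?case unfolding e using periodic[of "t + real m"] Suc by simp
  qed simp
  have "curve K (t + of_int n) = curve K t \<and> mark K (t + of_int n) = mark K t"
  proof (cases "n \<ge> 0")
    case True
    then show ?thesis using nat[of t "nat n"] by simp
  next
    case False
    then show ?thesis using nat[of "t + of_int n" "nat (- n)"] by simp
  qed
  then show "curve K (t + of_int n) = curve K t" "mark K (t + of_int n) = mark K t" by auto
qed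

lemma vel_periodic: "vel K (t + 1) = vel K t"
proof -
  have "(curve K has_vector_derivative v) (at (t + 1)) \<longleftrightarrow> (curve K has_vector_derivative v) (at t)" for v
  proof
    assume "(curve K has_vector_derivative v) (at (t + 1))"
    moreover have "((\<lambda>x. x + 1) has_real_derivative 1) (at t)" by (auto intro!: derivative_eq_intros)
    ultimately have "((curve K \<circ> (\<lambda>x. x + 1)) has_vector_derivative (1 *\<^sub>R v)) (at t)"
      by (intro vector_diff_chain_at) (auto simp: has_real_derivative_iff_has_vector_derivative)
    then show "(curve K has_vector_derivative v) (at t)" by (simp add: o_def periodic)
  next
    assume "(curve K has_vector_derivative v) (at t)"
    moreover have "((\<lambda>x. x - 1) has_real_derivative 1) (at (t + 1))" by (auto intro!: derivative_eq_intros)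
    ultimately have "((curve K \<circ> (\<lambda>x. x - 1)) has_vector_derivative (1 *\<^sub>R v)) (at (t + 1))"
      by (intro vector_diff_chain_at) (auto simp: has_real_derivative_iff_has_vector_derivative)
    moreover have "curve K (x - 1) = curve K x" for x using periodic(1)[of "x - 1"] by simp
    ultimately show "(curve K has_vector_derivative v) (at (t + 1))" by (simp add: o_def)
  qed
  then show ?thesis unfolding vel_def vector_derivative_def by simp
qed

lemma vel_periodic_int: "vel K (t + of_int n) = vel K t"
proof -
  have nat: "vel K (t + real m) = vel K t" for t m
  proof (induction m)
    case (Suc m)
    have e: "t + real (Suc m) = (t + real m) + 1" by simp
    show ?case unfolding e using vel_periodic[of "t + real m"] Suc by simp
  qed simp
  show ?thesis
  proof (cases "n \<ge> 0")
    case True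
    then show ?thesis using nat[of t "nat n"] by simp
  next
    case False
    then show ?thesis using nat[of "t + of_int n" "nat (- n)"] by simp
  qed
qed

lemma at_frac: "curve K (frac t) = curve K t" "mark K (frac t) = mark K t" "vel K (frac t) = vel K t"
  using periodic_int[of "frac t" "\<lfloor>t\<rfloor>"] vel_periodic_int[of "frac t" "\<lfloor>t\<rfloor>"] by (simp_all add: frac_def)

lemma has_vel: "(curve K has_vector_derivative vel K t) (at t)"
  using sing unfolding singular_diagram_def C1_differentiable_on_eq vel_def
  by (simp add: vector_derivative_works[symmetric])

end

lemma frac_add_of_int: "frac (t + of_int n) = frac t"
  by (simp add: frac_def)

lemma frac_cyc:
  assumes "a < b" "b < c" "c < a + 1"
  shows "cyc (frac a) (frac b) (frac c)"
proof -
  have f: "\<lfloor>b\<rfloor> = \<lfloor>a\<rfloor> \<or> \<lfloor>b\<rfloor> = \<lfloor>a\<rfloor> + 1" "\<lfloor>c\<rfloor> = \<lfloor>a\<rfloor> \<or> \<lfloor>c\<rfloor> = \<lfloor>a\<rfloor> + 1" "\<lfloor>b\<rfloor> \<le> \<lfloor>c\<rfloor>"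
    using assms by linarith+
  note fl = floor_correct[of a] floor_correct[of b] floor_correct[of c]
  consider "\<lfloor>b\<rfloor> = \<lfloor>a\<rfloor>" "\<lfloor>c\<rfloor> = \<lfloor>a\<rfloor>" | "\<lfloor>b\<rfloor> = \<lfloor>a\<rfloor>" "\<lfloor>c\<rfloor> = \<lfloor>a\<rfloor> + 1" | "\<lfloor>b\<rfloor> = \<lfloor>a\<rfloor> + 1" "\<lfloor>c\<rfloor> = \<lfloor>a\<rfloor> + 1"
    using f by linarith
  then show ?thesis
  proof cases
    case 1
    then have "frac a < frac b \<and> frac b < frac c" unfolding frac_def using assms by simp
    then show ?thesis unfolding cyc_def by blast
  next
    case 2
    then have "frac c < frac a \<and> frac a < frac b" unfolding frac_def using assms by simp
    then show ?thesis unfolding cyc_def by blast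
  next
    case 3
    then have "frac b < frac c \<and> frac c < frac a" unfolding frac_def using assms by simp
    then show ?thesis unfolding cyc_def by blast
  qed
qed

locale circle_map =
  fixes r :: "real \<Rightarrow> real"
  assumes r: "circle_diffeo r"
begin

lemma r_deriv: "(r has_real_derivative vector_derivative r (at t)) (at t)" "vector_derivative r (at t) > 0"
  using r unfolding circle_diffeo_def C1_differentiable_on_eq
  by (simp_all add: has_real_derivative_iff_has_vector_derivative vector_derivative_works[symmetric])

lemma r_mono: "s < t \<Longrightarrow> r s < r t"
  by (rule DERIV_pos_imp_increasing) (use r_deriv in blast)+

lemma r_less: "r s < r t \<longleftrightarrow> s < t"
  using r_mono by (smt (verit))

lemma r_inj: "r s = r t \<Longrightarrow> s = t"
  using r_less[of s t] r_less[of t s] by linarith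

lemma r_shift: "r (t + 1) = r t + 1"
  using r unfolding circle_diffeo_def by blast

lemma r_int: "r (t + of_int n) = r t + of_int n"
proof -
  have nat: "r (t + real m) = r t + real m" for t m
  proof (induction m)
    case (Suc m)
    have e: "t + real (Suc m) = (t + real m) + 1" by simp
    show ?case unfolding e using r_shift[of "t + real m"] Suc by simp
  qed simp
  show ?thesis
  proof (cases "n \<ge> 0")
    case True
    then show ?thesis using nat[of t "nat n"] by simp
  next
    case False
    then show ?thesis using nat[of "t + of_int n" "nat (- n)"] by simp
  qed
qed

lemma r_surj: "\<exists>t. r t = y"
proof -
  define n where "n = \<lceil>\<bar>y - r 0\<bar>\<rceil>"
  have n: "\<bar>y - r 0\<bar> \<le> of_int n" "0 \<le> n" unfolding n_def by (linarith, simp)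
  have "r (of_int (- n)) \<le> y" "y \<le> r (of_int n)"
    using r_int[of 0 "- n"] r_int[of 0 n] n by (simp_all add: abs_le_iff)
  moreover have "continuous_on {of_int (- n)..of_int n} r"
    by (intro DERIV_atLeastAtMost_imp_continuous_on) (use r_deriv in blast)
  ultimately show ?thesis using IVT'[of r "of_int (- n)" y "of_int n"] n by auto
qed

definition g where "g s = frac (r s)"

lemma g_inj: "s \<in> {0..<1} \<Longrightarrow> t \<in> {0..<1} \<Longrightarrow> g s = g t \<longleftrightarrow> s = t"
proof
  assume s: "s \<in> {0..<1}" "t \<in> {0..<1}" "g s = g t"
  have "r s = r (t + of_int (\<lfloor>r s\<rfloor> - \<lfloor>r t\<rfloor>))"
    unfolding r_int using s(3) unfolding g_def frac_def by simp
  then have "s = t + of_int (\<lfloor>r s\<rfloor> - \<lfloor>r t\<rfloor>)" by (rule r_inj)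
  then have "frac s = frac (t + of_int (\<lfloor>r s\<rfloor> - \<lfloor>r t\<rfloor>))" by (rule arg_cong)
  also have "\<dots> = frac t" by (rule frac_add_of_int)
  finally show "s = t" using s by (simp add: frac_eq_id)
qed simp

lemma g_unit: "g s \<in> {0..<1}"
  unfolding g_def by (simp add: frac_lt_1)

lemma g_surj:
  assumes "y \<in> {0..<1}"
  shows "\<exists>s\<in>{0..<1}. g s = y"
proof -
  obtain t where t: "r t = y" using r_surj by blast
  have "r (frac t) = y + of_int (- \<lfloor>t\<rfloor>)"
    using r_int[of t "- \<lfloor>t\<rfloor>"] t by (simp add: frac_def)
  then have "g (frac t) = frac (y + of_int (- \<lfloor>t\<rfloor>))" by (simp add: g_def)
  also have "\<dots> = frac y" by (rule frac_add_of_int)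
  also have "\<dots> = y" using assms by (simp add: frac_eq_id)
  finally show ?thesis by (intro bexI[of _ "frac t"]) (auto simp: frac_lt_1)
qed

lemma g_cyc_imp:
  assumes "x \<in> {0..<1}" "y \<in> {0..<1}" "z \<in> {0..<1}" "cyc x y z"
  shows "cyc (g x) (g y) (g z)"
proof -
  have *: "cyc (g a) (g b) (g c)" if "a < b" "b < c" "a \<in> {0..<1}" "c \<in> {0..<1}" for a b c
    unfolding g_def using r_mono[OF that(1)] r_mono[OF that(2)] r_mono[of c "a + 1"] r_shift[of a] that
    by (intro frac_cyc) auto
  show ?thesis
    using assms(4) *[of x y z] *[of y z x] *[of z x y] assms(1-3) unfolding cyc_def by blast
qed

lemma g_cyc:
  assumes "x \<in> {0..<1}" "y \<in> {0..<1}" "z \<in> {0..<1}"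
  shows "cyc (g x) (g y) (g z) = cyc x y z"
proof (cases "x = y \<or> y = z \<or> x = z")
  case True
  then show ?thesis unfolding cyc_def by auto
next
  case False
  then have "cyc x y z \<or> cyc x z y" unfolding cyc_def by linarith
  moreover have "\<not> (cyc a b c \<and> cyc a c b)" for a b c unfolding cyc_def by linarith
  ultimately show ?thesis using g_cyc_imp[OF assms] g_cyc_imp[OF assms(1,3,2)] by blast
qed

end

lemma cross2_linear:
  assumes "linear h"
  shows "cross2 (h v) (h w) = cross2 (h 1) (h \<i>) * cross2 v w"
proof -
  have *: "h v = Re v *\<^sub>R h 1 + Im v *\<^sub>R h \<i>" for v
  proof -
    have "v = Re v *\<^sub>R 1 + Im v *\<^sub>R \<i>" by (simp add: complex_eq_iff)
    then have "h v = h (Re v *\<^sub>R 1 + Im v *\<^sub>R \<i>)" by simp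
    then show ?thesis by (simp only: linear_add[OF assms] linear_scale[OF assms])
  qed
  show ?thesis unfolding *[of v] *[of w] cross2_def by (simp add: algebra_simps)
qed

text \<open>
  The reparametrization acts on the fundamental domain by \<open>g\<close>, which preserves the cyclic order but
  in general not the order. The diffeomorphism of the plane multiplies all orientations by the
  positive determinant of its derivative.
\<close>

lemma phi_chords_isotopic:
  assumes D: "singular_diagram D" and E: "singular_diagram E" and iso: "isotopic D E"
  shows "phi_chords i j k (chords_of D) = phi_chords i j k (chords_of E)"
proof -
  interpret D: generic_diagram D by standard (rule D)
  interpret E: generic_diagram E by standard (rule E)
  obtain h r where h: "plane_diffeo h" and "circle_diffeo r"
    and cur: "\<And>t. curve E t = h (curve D (r t))" and mk: "\<And>s t. crossing E s t \<Longrightarrow> mark E s = mark D (r s)"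
    using iso unfolding isotopic_def by blast
  then interpret circle_map r by (unfold_locales)
  obtain h' where h': "\<And>z. (h has_derivative h' z) (at z)" "\<And>z. cross2 (h' z 1) (h' z \<i>) > 0" and "bij h"
    using h unfolding plane_diffeo_def by blast
  have curg: "curve E t = h (curve D (g t))" for t
    unfolding g_def D.at_frac by (rule cur)
  have cr: "crossing E s t \<longleftrightarrow> crossing D (g s) (g t)" if "s \<in> {0..<1}" "t \<in> {0..<1}" for s t
    unfolding crossing_def curg using that g_inj[OF that] g_unit bij_is_inj[OF \<open>bij h\<close>] by (auto dest: injD)
  have vel: "vel E t = vector_derivative r (at t) *\<^sub>R h' (curve D (g t)) (vel D (g t))" for t
  proof -
    have 1: "((curve D \<circ> r) has_vector_derivative (vector_derivative r (at t) *\<^sub>R vel D (r t))) (at t)"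
      using r_deriv(1)[of t] D.has_vel[of "r t"]
      by (intro vector_diff_chain_at) (auto simp: has_real_derivative_iff_has_vector_derivative)
    have "((h \<circ> (curve D \<circ> r)) has_derivative
        (h' (curve D (r t)) \<circ> (\<lambda>x. x *\<^sub>R (vector_derivative r (at t) *\<^sub>R vel D (r t))))) (at t)"
      using 1 h'(1)[of "curve D (r t)"] unfolding has_vector_derivative_def by (intro diff_chain_at) (auto simp: o_def)
    moreover have "curve E = h \<circ> (curve D \<circ> r)" using cur by (auto simp: fun_eq_iff)
    ultimately have "(curve E has_vector_derivative
        (vector_derivative r (at t) *\<^sub>R h' (curve D (r t)) (vel D (r t)))) (at t)"
      unfolding has_vector_derivative_def
      using linear_scale[OF has_derivative_linear[OF h'(1)]] by (simp add: o_def)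
    then have "vel E t = vector_derivative r (at t) *\<^sub>R h' (curve D (r t)) (vel D (r t))"
      unfolding vel_def by (rule vector_derivative_at)
    then show ?thesis unfolding g_def D.at_frac .
  qed
  have pos: "cross2 (vel E s) (vel E t) > 0 \<longleftrightarrow> cross2 (vel D (g s)) (vel D (g t)) > 0" if "crossing E s t" for s t
  proof -
    have c: "curve D (g t) = curve D (g s)"
      using that cr[of s t] unfolding crossing_def by auto
    define P where "P = vector_derivative r (at s) * vector_derivative r (at t) *
        cross2 (h' (curve D (g s)) 1) (h' (curve D (g s)) \<i>)"
    have P: "P > 0" unfolding P_def by (intro mult_pos_pos r_deriv(2) h'(2))
    have "cross2 (vel E s) (vel E t) = vector_derivative r (at s) * vector_derivative r (at t) *
        (cross2 (h' (curve D (g s)) 1) (h' (curve D (g s)) \<i>) * cross2 (vel D (g s)) (vel D (g t)))"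
      unfolding vel c cross2_linear[OF has_derivative_linear[OF h'(1)], symmetric] by (simp add: cross2_def algebra_simps)
    then have "cross2 (vel E s) (vel E t) = P * cross2 (vel D (g s)) (vel D (g t))"
      by (simp add: P_def)
    then show ?thesis using P by (metis mult_pos_pos zero_less_mult_pos)
  qed
  have unit: "s \<in> {0..<1} \<and> t \<in> {0..<1}" if "crossing K s t" for K s t using that by (simp add: crossing_def)
  have crg: "crossing D (g s) (g t)" if "crossing E s t" for s t using cr that unit[OF that] by blast
  have mg: "mark D (g s) = mark E s" if "crossing E s t" for s t
    using mk[OF that] unfolding g_def D.at_frac by simp
  have lift: "\<exists>s t. crossing E s t \<and> g s = x \<and> g t = y" if "crossing D x y" for x y
    using that g_surj[of x] g_surj[of y] cr unit[OF that] by blast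
  show ?thesis
  proof (rule phi_chords_iso[where g = g])
    show "bij_betw g (points (chords_of E)) (points (chords_of D))"
    proof (rule bij_betw_imageI)
      show "inj_on g (points (chords_of E))"
        by (rule inj_onI) (use g_inj E.chords.in_unit in blast)
      show "g ` points (chords_of E) = points (chords_of D)"
      proof (intro set_eqI iffI)
        fix x assume "x \<in> g ` points (chords_of E)"
        then obtain s where "x = g s" "s \<in> points (chords_of E)" by blast
        moreover from E.points_iff this(2) obtain t where "crossing E s t" "mark E s \<in> {Over, Under}" by blast
        ultimately have "x = g s" "crossing E s t" "mark E s \<in> {Over, Under}" by auto
        then show "x \<in> points (chords_of D)" unfolding D.points_iff using crg[of s t] mg[of s t] by auto
      next
        fix x assume "x \<in> points (chords_of D)"
        then obtain y where "crossing D x y" "mark D x \<in> {Over, Under}" unfolding D.points_iff by blast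
        moreover from lift[OF this(1)] obtain s t where "crossing E s t" "g s = x" by blast
        ultimately have "s \<in> points (chords_of E)" "g s = x"
          unfolding E.points_iff using mg[of s t] by auto
        then show "x \<in> g ` points (chords_of E)" by blast
      qed
    qed
    fix x assume x: "x \<in> points (chords_of E)"
    then obtain y where y: "crossing E x y" using E.points_iff by blast
    show "mate (chords_of D) (g x) = g (mate (chords_of E) x)"
      using D.mate_crossing[OF crg[OF y]] E.mate_crossing[OF y] by simp
    show "mate (chords_of E) x \<in> points (chords_of E)" using x by simp
    show "ori (chords_of D) (g x) = ori (chords_of E) x"
      using D.ori_crossing[OF crg[OF y]] E.ori_crossing[OF y] pos[OF y] by simp
    show "over (chords_of D) (g x) = over (chords_of E) x"
      unfolding D.chords_sel E.chords_sel using mg[OF y] by simp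
  next
    fix x y z assume "x \<in> points (chords_of E)" "y \<in> points (chords_of E)" "z \<in> points (chords_of E)"
    then show "btw (chords_of D) (g x) (g y) (g z) = btw (chords_of E) x y z"
      unfolding D.btw_chords E.btw_chords using E.chords.in_unit by (intro g_cyc)
  qed
qed

section \<open>Local changes and the first two moves\<close>

locale local_pair = D: generic_diagram D + E: generic_diagram E for D E +
  fixes n :: nat and I :: "nat \<Rightarrow> real set"
  assumes change: "local_change n I D E"
begin

definition J where "J = (\<Union>m<n. I m)"

lemma strand: "m < n \<Longrightarrow> \<exists>l u. 0 < l \<and> l < u \<and> u < 1 \<and> I m = {l..u}"
  using change unfolding local_change_def by blast

lemma strands_disjoint: "m < n \<Longrightarrow> m' < n \<Longrightarrow> m \<noteq> m' \<Longrightarrow> s \<in> I m \<Longrightarrow> s \<notin> I m'"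
  using change unfolding local_change_def by blast

lemma in_J: "m < n \<Longrightarrow> s \<in> I m \<Longrightarrow> s \<in> J"
  unfolding J_def by blast

lemma J_unit: "s \<in> J \<Longrightarrow> 0 < s \<and> s < 1"
  unfolding J_def using strand by fastforce

lemma closed_J: "closed J"
proof -
  have "closed (I m)" if "m \<in> {..<n}" for m using strand[of m] that by auto
  then show ?thesis unfolding J_def by (intro closed_UN) auto
qed

lemma same_outside:
  assumes "t \<in> {0..<1}" "t \<notin> J"
  shows "curve E t = curve D t" "mark E t = mark D t"
  using change assms unfolding local_change_def J_def by auto

text \<open>The disc meets the curves in the strands only, so strands cross nothing but strands.\<close>

lemma no_mixed_crossing:
  assumes "s \<in> J" "t \<notin> J"
  shows "\<not> crossing D s t" "\<not> crossing E s t"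
proof -
  obtain B where B: "\<forall>t\<in>{0..<1}. if t \<in> (\<Union>m<n. I m) then curve D t \<in> B \<and> curve E t \<in> B
           else curve E t = curve D t \<and> mark E t = mark D t \<and> curve D t \<notin> B"
    using change unfolding local_change_def by blast
  have s: "s \<in> {0..<1}" using J_unit[OF assms(1)] by simp
  have sB: "curve D s \<in> B" "curve E s \<in> B" using bspec[OF B s] assms(1) unfolding J_def by simp_all
  have tB: "curve E t = curve D t" "curve D t \<notin> B" if "t \<in> {0..<1}"
    using bspec[OF B that] assms(2) unfolding J_def by simp_all
  show "\<not> crossing D s t" "\<not> crossing E s t"
    using sB tB unfolding crossing_def by auto
qed

text \<open>
  The curves agree near \<open>t\<close>. The neighbourhood \<open>U\<close> also avoids a translate of \<open>J\<close>, since for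
  \<open>t = 0\<close> it reaches into the previous period.
\<close>

lemma vel_outside:
  assumes "t \<in> {0..<1}" "t \<notin> J"
  shows "vel E t = vel D t"
proof -
  define U where "U = {-1<..<1} - (J \<union> (\<lambda>x. x - 1) ` J)"
  have "closed ((\<lambda>x. x - 1) ` J)"
    using closed_translation_subtract[OF closed_J, of 1] by simp
  then have U: "open U" unfolding U_def using closed_J by (intro open_Diff closed_Un) auto
  have tU: "t \<in> U" unfolding U_def using assms J_unit by force
  have eq: "curve E x = curve D x" if "x \<in> U" for x
  proof (cases "x \<ge> 0")
    case True
    then show ?thesis using that same_outside[of x] unfolding U_def by auto
  next
    case False
    have "x + 1 \<notin> J"
    proof
      assume "x + 1 \<in> J"
      then have "x + 1 - 1 \<in> (\<lambda>x. x - 1) ` J" by (rule imageI)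
      then show False using that unfolding U_def by simp
    qed
    then have "curve E (x + 1) = curve D (x + 1)"
      using that False same_outside[of "x + 1"] unfolding U_def by auto
    then show ?thesis by (simp add: D.periodic E.periodic)
  qed
  have "(curve E has_vector_derivative vel D t) (at t)"
    using D.has_vel[of t] U tU eq
    by (intro has_vector_derivative_transform_within_open[of "curve D" _ t U "curve E"]) auto
  then show ?thesis unfolding vel_def[of E] by (rule vector_derivative_at)
qed

lemma crossing_outside:
  assumes "s \<notin> J"
  shows "crossing E s t \<longleftrightarrow> crossing D s t"
proof (cases "t \<in> J")
  case True
  then show ?thesis using no_mixed_crossing[OF True assms] crossing_sym by blast
next
  case False
  then show ?thesis
    using same_outside(1)[OF _ assms] same_outside(1)[OF _ False] unfolding crossing_def by auto
qed

lemma crossing_inside: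
  assumes "crossing D s t \<or> crossing E s t" "s \<in> J"
  shows "t \<in> J"
  using no_mixed_crossing[OF assms(2)] assms(1) by blast

lemma outside:
  assumes "s \<notin> J"
  shows "s \<in> points (chords_of E) \<longleftrightarrow> s \<in> points (chords_of D)"
    and "s \<in> points (chords_of D) \<Longrightarrow> mate (chords_of E) s = mate (chords_of D) s"
    and "s \<in> points (chords_of D) \<Longrightarrow> ori (chords_of E) s = ori (chords_of D) s"
    and "s \<in> points (chords_of D) \<Longrightarrow> over (chords_of E) s = over (chords_of D) s"
    and "s \<in> points (chords_of D) \<Longrightarrow> mate (chords_of D) s \<notin> J"
proof -
  have m: "mark E s = mark D s" if "crossing D s t" for t
    using that same_outside(2)[OF _ assms] unfolding crossing_def by blast
  show "s \<in> points (chords_of E) \<longleftrightarrow> s \<in> points (chords_of D)"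
  proof (cases "\<exists>t. crossing D s t")
    case True
    then have "mark E s = mark D s" using m by blast
    then show ?thesis unfolding D.points_iff E.points_iff crossing_outside[OF assms] by simp
  next
    case False
    then show ?thesis unfolding D.points_iff E.points_iff crossing_outside[OF assms] by simp
  qed
  assume "s \<in> points (chords_of D)"
  then obtain t where t: "crossing D s t" unfolding D.points_iff by blast
  have tE: "crossing E s t" using t crossing_outside[OF assms] by simp
  have tJ: "t \<notin> J" using crossing_inside[of t s] crossing_sym[OF t] assms by blast
  have u: "s \<in> {0..<1}" "t \<in> {0..<1}" using t unfolding crossing_def by auto
  show "mate (chords_of E) s = mate (chords_of D) s"
    unfolding D.mate_crossing[OF t] E.mate_crossing[OF tE] ..
  show "ori (chords_of E) s = ori (chords_of D) s"
    unfolding D.ori_crossing[OF t] E.ori_crossing[OF tE] vel_outside[OF u(1) assms] vel_outside[OF u(2) tJ] ..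
  show "over (chords_of E) s = over (chords_of D) s"
    unfolding D.chords_sel E.chords_sel m[OF t] ..
  show "mate (chords_of D) s \<notin> J" unfolding D.mate_crossing[OF t] by (rule tJ)
qed

lemma adjacent_on_strand:
  assumes "circle_chords G" "m < n" "u \<in> points G" "v \<in> points G" "u \<in> I m" "v \<in> I m" "u \<noteq> v"
    and only: "\<And>x. x \<in> points G \<Longrightarrow> x \<in> I m \<Longrightarrow> x = u \<or> x = v"
  shows "adjacent G u v (u < v)"
proof -
  interpret circle_chords G by fact
  obtain l w where lw: "I m = {l..w}" using strand[OF assms(2)] by blast
  have "btw G u v x = (u < v)" if "x \<in> points G - {u, v}" for x
  proof -
    have "x \<notin> {l..w}" using only[of x] that lw by auto
    then show ?thesis using assms(5,6,7) lw unfolding btw_def pos_id cyc_def by auto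
  qed
  then show ?thesis unfolding adjacent_def using assms by blast
qed

lemma extension_inside:
  assumes "points (chords_of D) \<inter> J = {}" "T = points (chords_of E) \<inter> J"
  shows "extension (chords_of E) (chords_of D) T"
proof
  have out: "x \<in> points (chords_of D) \<Longrightarrow> x \<notin> J" for x using assms(1) by blast
  show "points (chords_of E) = points (chords_of D) \<union> T"
    unfolding assms(2) using outside(1) out by blast
  show "points (chords_of D) \<inter> T = {}" unfolding assms(2) using out by blast
  show "pos (chords_of D) = pos (chords_of E)" by (rule ext) (simp add: D.chords_sel E.chords_sel)
  fix x assume x: "x \<in> points (chords_of D)"
  note o = outside[OF out[OF x]]
  show "mate (chords_of D) x = mate (chords_of E) x" using o x by simp
  show "mate (chords_of E) x \<in> points (chords_of D)" using o x by simp
  show "ori (chords_of D) x = ori (chords_of E) x" "over (chords_of D) x = over (chords_of E) x"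
    using o x by simp_all
qed

lemma phi_chords_no_classical:
  assumes "points (chords_of D) \<inter> J = {}" "points (chords_of E) \<inter> J = {}"
  shows "phi_chords i j k (chords_of E) = phi_chords i j k (chords_of D)"
proof -
  interpret extension "chords_of E" "chords_of D" "{}"
    by (rule extension_inside) (use assms in auto)
  show ?thesis by (rule phi_chords_extension) auto
qed

end

lemma phi_chords_move1:
  assumes D: "singular_diagram D" and E: "singular_diagram E" and move: "move1 D E"
    and ijk: "i \<noteq> j" "j \<noteq> k" "i \<noteq> k"
  shows "phi_chords i j k (chords_of E) = phi_chords i j k (chords_of D)"
proof -
  obtain I a b where ch: "local_change 1 I D E" and inj: "inj_on (curve D) (I 0)"
    and ab: "{(s, t). s \<in> I 0 \<and> t \<in> I 0 \<and> s < t \<and> curve E s = curve E t} = {(a, b)}"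
    using move unfolding move1_def by blast
  interpret local_pair D E 1 I by unfold_locales (rule D, rule E, rule ch)
  have J: "J = I 0" unfolding J_def by auto
  have abI: "a \<in> I 0" "b \<in> I 0" "a < b" "curve E a = curve E b" using ab by blast+
  have cD: "\<not> crossing D s t" if "s \<in> J" for s t
    using crossing_inside[of s t] that inj_onD[OF inj] unfolding J crossing_def by blast
  then have pD: "points (chords_of D) \<inter> J = {}" unfolding disjoint_iff D.points_iff by blast
  have cE: "{s, t} = {a, b}" if "s \<in> J" "crossing E s t" for s t
  proof -
    have "t \<in> J" using crossing_inside[of s t] that by blast
    then have "(s, t) \<in> {(a, b)} \<or> (t, s) \<in> {(a, b)}"
      using that unfolding J ab[symmetric] crossing_def by auto
    then show ?thesis by auto
  qed
  have "crossing E a b" unfolding crossing_def using abI J_unit[of a] J_unit[of b] J by auto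
  note cab = this crossing_sym[OF this]
  show ?thesis
  proof (cases "mark E a \<in> {Over, Under}")
    case True
    then have "mark E b \<in> {Over, Under}" using E.marks[OF cab(1)] by auto
    then have in2: "a \<in> points (chords_of E)" "b \<in> points (chords_of E)"
      unfolding E.points_iff using cab True by auto
    have T: "points (chords_of E) \<inter> J = {a, b}"
    proof (intro set_eqI iffI)
      fix x assume x: "x \<in> points (chords_of E) \<inter> J"
      then obtain y where "crossing E x y" using E.points_iff[of x] by blast
      then have "{x, y} = {a, b}" using cE x by simp
      then show "x \<in> {a, b}" by blast
    next
      fix x assume "x \<in> {a, b}"
      then show "x \<in> points (chords_of E) \<inter> J" using in2 abI unfolding J by auto
    qed
    have "adjacent (chords_of E) a b (a < b)"
      by (rule adjacent_on_strand[OF E.chords.circle_chords_axioms _ in2 abI(1,2)]) (use T J abI in auto)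
    with extension_inside[OF pD T[symmetric]] show ?thesis
      by (rule phi_chords_kink) (use E.mate_crossing[OF cab(1)] ijk in auto)
  next
    case False
    then have "mark E b \<notin> {Over, Under}" using E.marks[OF cab(1)] by auto
    have "x \<notin> J" if x: "x \<in> points (chords_of E)" for x
    proof
      assume "x \<in> J"
      obtain y where "crossing E x y" "mark E x \<in> {Over, Under}" using x E.points_iff[of x] by blast
      moreover from cE[OF \<open>x \<in> J\<close> this(1)] have "x = a \<or> x = b" by blast
      ultimately show False using False \<open>mark E b \<notin> {Over, Under}\<close> by blast
    qed
    then have "points (chords_of E) \<inter> J = {}" by blast
    then show ?thesis by (rule phi_chords_no_classical[OF pD])
  qed
qed

lemma phi_chords_move2:
  assumes D: "singular_diagram D" and E: "singular_diagram E" and move: "move2 D E"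
    and ijk: "i \<noteq> j" "j \<noteq> k" "i \<noteq> k"
  shows "phi_chords i j k (chords_of E) = phi_chords i j k (chords_of D)"
proof -
  obtain I a a' b b' where ch: "local_change 2 I D E" and inj: "inj_on (curve D) (I 0 \<union> I 1)"
    and injE: "inj_on (curve E) (I 0)" "inj_on (curve E) (I 1)" and aa': "a \<noteq> a'"
    and cr: "{(s, t). s \<in> I 0 \<and> t \<in> I 1 \<and> curve E s = curve E t} = {(a, b), (a', b')}"
    and opp: "cross2 (vel E a) (vel E b) * cross2 (vel E a') (vel E b') < 0"
    and mk: "mark E a = Over \<and> mark E a' = Over \<or> mark E a = Virtual \<and> mark E a' = Virtual"
    using move unfolding move2_def by blast
  interpret local_pair D E 2 I by unfold_locales (rule D, rule E, rule ch)
  have J: "J = I 0 \<union> I 1" unfolding J_def by (auto simp: less_2_cases_iff)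
  have in4: "a \<in> I 0" "a' \<in> I 0" "b \<in> I 1" "b' \<in> I 1" "curve E a = curve E b" "curve E a' = curve E b'"
    using cr by blast+
  have dis: "x \<in> I 0 \<Longrightarrow> y \<in> I 1 \<Longrightarrow> x \<noteq> y" for x y using strands_disjoint[of 0 1 x] by auto
  have unit: "x \<in> J \<Longrightarrow> x \<in> {0..<1}" for x using J_unit[of x] by simp
  have cab: "crossing E a b" "crossing E a' b'"
    unfolding crossing_def using in4 unit dis J by auto
  note cba = crossing_sym[OF cab(1)] crossing_sym[OF cab(2)]
  have bb': "b \<noteq> b'" using E.crossing_unique[OF cba(1)] cba(2) aa' by auto
  have cD: "\<not> crossing D s t" if "s \<in> J" for s t
    using crossing_inside[of s t] that inj_onD[OF inj] unfolding J crossing_def by blast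
  then have pD: "points (chords_of D) \<inter> J = {}" unfolding disjoint_iff D.points_iff by blast
  have cE: "s \<in> {a, a', b, b'}" if "s \<in> J" "crossing E s t" for s t
  proof -
    have t: "t \<in> J" using crossing_inside[of s t] that by blast
    have eq: "curve E s = curve E t" "s \<noteq> t" using that unfolding crossing_def by auto
    have "s \<in> I 0 \<and> t \<in> I 1 \<or> s \<in> I 1 \<and> t \<in> I 0"
      using that(1) t eq inj_onD[OF injE(1) eq(1)] inj_onD[OF injE(2) eq(1)] unfolding J by blast
    then have "(s, t) \<in> {(a, b), (a', b')} \<or> (t, s) \<in> {(a, b), (a', b')}"
      unfolding cr[symmetric] using eq by auto
    then show ?thesis by auto
  qed
  from mk show ?thesis
  proof
    assume o: "mark E a = Over \<and> mark E a' = Over"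
    then have u: "mark E b = Under" "mark E b' = Under" using E.marks[OF cab(1)] E.marks[OF cab(2)] by auto
    have in4': "a \<in> points (chords_of E)" "a' \<in> points (chords_of E)" "b \<in> points (chords_of E)" "b' \<in> points (chords_of E)"
      unfolding E.points_iff using cab cba o u by auto
    have T: "{a, a', b, b'} = points (chords_of E) \<inter> J"
    proof (intro set_eqI iffI)
      fix x assume "x \<in> {a, a', b, b'}"
      then show "x \<in> points (chords_of E) \<inter> J" using in4' in4 J by blast
    next
      fix x assume x: "x \<in> points (chords_of E) \<inter> J"
      then obtain y where "crossing E x y" using E.points_iff[of x] by blast
      then show "x \<in> {a, a', b, b'}" using cE x by blast
    qed
    have only: "x \<in> {a, a', b, b'}" if "x \<in> points (chords_of E)" "x \<in> J" for x using T that by blast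
    have ad: "adjacent (chords_of E) a a' (a < a')" "adjacent (chords_of E) b b' (b < b')"
      using adjacent_on_strand[OF E.chords.circle_chords_axioms _ in4'(1,2) in4(1,2) aa']
        adjacent_on_strand[OF E.chords.circle_chords_axioms _ in4'(3,4) in4(3,4) bb']
        only dis in4 J by (simp, blast)+
    have "ori (chords_of E) a' = - ori (chords_of E) a"
      unfolding E.ori_crossing[OF cab(1)] E.ori_crossing[OF cab(2)] using opp
      by (auto simp: mult_less_0_iff)
    moreover have "distinct [a, a', b, b']" using aa' bb' in4 dis by auto
    ultimately interpret bigon "chords_of E" "chords_of D" a a' b b' "a < a'" "b < b'"
      using extension_inside[OF pD T] ad E.mate_crossing[OF cab(1)] E.mate_crossing[OF cab(2)] o
      unfolding bigon_def bigon_axioms_def by (simp add: E.chords_sel(2))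
    show ?thesis by (rule phi_chords_bigon[OF ijk])
  next
    assume v: "mark E a = Virtual \<and> mark E a' = Virtual"
    then have "mark E b = Virtual" "mark E b' = Virtual" using E.marks[OF cab(1)] E.marks[OF cab(2)] by auto
    note u = this
    have "x \<notin> J" if x: "x \<in> points (chords_of E)" for x
    proof
      assume "x \<in> J"
      obtain y where "crossing E x y" "mark E x \<in> {Over, Under}" using x E.points_iff[of x] by blast
      moreover from cE[OF \<open>x \<in> J\<close> this(1)] have "x = a \<or> x = a' \<or> x = b \<or> x = b'" by blast
      ultimately show False using v u by auto
    qed
    then have "points (chords_of E) \<inter> J = {}" by blast
    then show ?thesis by (rule phi_chords_no_classical[OF pD])
  qed
qed

section \<open>The third move\<close>

lemma cyc_less_cong:
  assumes "x' < y' \<longleftrightarrow> x < y" "y' < z' \<longleftrightarrow> y < z" "z' < x' \<longleftrightarrow> z < x"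
  shows "cyc x' y' z' = cyc x y z"
  unfolding cyc_def assms ..

lemma cyc_interval:
  assumes "u \<in> {l..w}" "v \<in> {l..w}" "x \<notin> {l..w}" "u \<noteq> v"
  shows "cyc u v x \<longleftrightarrow> u < v"
  using assms unfolding cyc_def by auto

lemma less_intervals:
  assumes "{l..w} \<inter> {l'..w'} = {}" "x \<in> {l..w}" "x' \<in> {l..w}" "y \<in> {l'..w'}" "y' \<in> {l'..w'}"
  shows "x' < y' \<longleftrightarrow> x < (y :: real)"
proof -
  have "w < l' \<or> w' < l"
  proof (rule ccontr)
    assume "\<not> (w < l' \<or> w' < l)"
    then have "max l l' \<in> {l..w} \<inter> {l'..w'}" using assms(2,4) by auto
    then show False using assms(1) by blast
  qed
  then show ?thesis using assms(2-5) by auto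
qed

definition tri :: "nat \<Rightarrow> nat \<Rightarrow> bool" where
  "tri m n \<longleftrightarrow> m < 3 \<and> n < 3 \<and> m \<noteq> n"

lemma tri_sym: "tri m n \<Longrightarrow> tri n m"
  by (auto simp: tri_def)

text \<open>
  The corners of a triangle of three strands; \<open>p m n\<close> is the parameter on strand \<open>m\<close> of
  its crossing with strand \<open>n\<close>.
\<close>

locale triangle_in = generic_diagram K for K +
  fixes I :: "nat \<Rightarrow> real set" and p :: "nat \<Rightarrow> nat \<Rightarrow> real"
  assumes tri: "triangle K I p"
    and interval: "m < 3 \<Longrightarrow> \<exists>l u. 0 < l \<and> l < u \<and> u < 1 \<and> I m = {l..u}"
    and disjoint: "m < 3 \<Longrightarrow> m' < 3 \<Longrightarrow> m \<noteq> m' \<Longrightarrow> I m \<inter> I m' = {}"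
    and closed_crossing: "m < 3 \<Longrightarrow> s \<in> I m \<Longrightarrow> crossing K s t \<Longrightarrow> \<exists>n<3. t \<in> I n"
begin

lemma strand_unique: "m < 3 \<Longrightarrow> m' < 3 \<Longrightarrow> x \<in> I m \<Longrightarrow> x \<in> I m' \<Longrightarrow> m = m'"
  using disjoint by blast

lemma crossing_set: "tri m n \<Longrightarrow> {(s, t). s \<in> I m \<and> t \<in> I n \<and> curve K s = curve K t} = {(p m n, p n m)}"
  using tri unfolding triangle_def tri_def by blast

lemma corner: "tri m n \<Longrightarrow> p m n \<in> I m" "tri m n \<Longrightarrow> crossing K (p m n) (p n m)"
proof -
  assume t: "tri m n"
  have *: "p m n \<in> I m" "p n m \<in> I n" "curve K (p m n) = curve K (p n m)"
    using crossing_set[OF t] by blast+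
  show "p m n \<in> I m" by (rule *)
  have "p m n \<noteq> p n m" using * t disjoint[of m n] unfolding tri_def by auto
  moreover have "x \<in> {0..<1}" if "x \<in> I k" "k < 3" for x k
    using interval[OF that(2)] that(1) by auto
  ultimately show "crossing K (p m n) (p n m)"
    unfolding crossing_def using * t unfolding tri_def by blast
qed

lemma inside:
  assumes "m < 3" "s \<in> I m" "crossing K s t"
  shows "\<exists>n. tri m n \<and> s = p m n \<and> t = p n m"
proof -
  obtain n where n: "n < 3" "t \<in> I n" using closed_crossing[OF assms] by blast
  have eq: "curve K s = curve K t" "s \<noteq> t" using assms(3) unfolding crossing_def by auto
  have "m \<noteq> n"
  proof
    assume "m = n"
    moreover have "inj_on (curve K) (I m)" using tri assms(1) unfolding triangle_def by blast
    ultimately show False using inj_onD[of "curve K" "I m" s t] assms(2) n eq by blast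
  qed
  then have mn: "tri m n" using assms n unfolding tri_def by auto
  have "(s, t) \<in> {(p m n, p n m)}"
    unfolding crossing_set[OF mn, symmetric] using assms n eq by auto
  then show ?thesis using mn by blast
qed

lemma corner_inj:
  assumes "tri m n" "tri m' n'" "p m n = p m' n'"
  shows "m = m' \<and> n = n'"
proof -
  have "p m n \<in> I m'" using corner(1)[OF assms(2)] assms(3) by simp
  then have m: "m = m'"
    using strand_unique[of m m' "p m n"] corner(1)[OF assms(1)] assms(1,2) unfolding tri_def by blast
  have "crossing K (p m n) (p n' m')" using corner(2)[OF assms(2)] assms(3) by simp
  then have "p n m = p n' m'" using crossing_unique[OF corner(2)[OF assms(1)]] by blast
  then have "p n m \<in> I n'" using corner(1)[OF tri_sym[OF assms(2)]] by simp
  then have "n = n'"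
    using strand_unique[of n n' "p n m"] corner(1)[OF tri_sym[OF assms(1)]] assms(1,2) unfolding tri_def by blast
  with m show ?thesis by blast
qed

end

locale move3_pair = local_pair D E 3 I for D E I +
  fixes p q :: "nat \<Rightarrow> nat \<Rightarrow> real"
  assumes tri_D: "triangle D I p" and tri_E: "triangle E I q" and convex: "convex_triangle D p"
    and reversed: "tri m n \<Longrightarrow> tri n k \<Longrightarrow> tri m k \<Longrightarrow> p m n < p m k \<longleftrightarrow> q m k < q m n"
    and marks_corr: "tri m n \<Longrightarrow> mark E (q m n) = mark D (p m n)"
    and signs_corr: "tri m n \<Longrightarrow> sgn (cross2 (vel E (q m n)) (vel E (q n m))) =
      sgn (cross2 (vel D (p m n)) (vel D (p n m)))"
begin

lemma closed_D: "m < 3 \<Longrightarrow> s \<in> I m \<Longrightarrow> crossing D s t \<Longrightarrow> \<exists>n<3. t \<in> I n"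
  and closed_E: "m < 3 \<Longrightarrow> s \<in> I m \<Longrightarrow> crossing E s t \<Longrightarrow> \<exists>n<3. t \<in> I n"
  using crossing_inside[of s t] in_J[of m s] unfolding J_def by blast+

sublocale TD: triangle_in D I p
  by unfold_locales (use tri_D strand strands_disjoint closed_D in blast)+

sublocale TE: triangle_in E I q
  by unfold_locales (use tri_E strand strands_disjoint closed_E in blast)+

text \<open>
  The correspondence between the crossings before and after the move. It preserves the order of any two
  points that are not on the same strand (\<open>f_less\<close>), so the diagram \<open>H\<close> below, which is that of \<open>E\<close>
  transported to the points of \<open>D\<close>, differs from that of \<open>D\<close> only in the order within each strand.
\<close>

definition f where
  "f x = (if \<exists>m n. tri m n \<and> x = p m n then THE y. \<exists>m n. tri m n \<and> x = p m n \<and> y = q m n else x)"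

lemma f_corner: "tri m n \<Longrightarrow> f (p m n) = q m n"
proof -
  assume t: "tri m n"
  have "(THE y. \<exists>m' n'. tri m' n' \<and> p m n = p m' n' \<and> y = q m' n') = q m n"
    by (rule the_equality) (use t TD.corner_inj[OF t] in blast)+
  then show ?thesis unfolding f_def using t by auto
qed

lemma f_outside: "x \<notin> J \<Longrightarrow> f x = x"
proof -
  assume x: "x \<notin> J"
  have "\<not> (\<exists>m n. tri m n \<and> x = p m n)"
  proof
    assume "\<exists>m n. tri m n \<and> x = p m n"
    then obtain m n where mn: "tri m n" "x = p m n" by blast
    then show False using TD.corner(1)[OF mn(1)] in_J[of m x] x unfolding tri_def by simp
  qed
  then show ?thesis unfolding f_def by (simp only: if_False)
qed

abbreviation "X \<equiv> points (chords_of D)"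

lemma X_cases:
  assumes "x \<in> X"
  obtains (out) "x \<notin> J" | (corner) m n where "tri m n" "x = p m n" "m < 3" "x \<in> I m"
proof (cases "x \<in> J")
  case True
  then obtain m where m: "m < 3" "x \<in> I m" unfolding J_def by blast
  obtain y where "crossing D x y" using assms D.points_iff[of x] by blast
  from TD.inside[OF m this] obtain n where "tri m n" "x = p m n" by blast
  then show ?thesis using corner m by blast
qed (use out in blast)

lemma X_on_strand: "x \<in> X \<Longrightarrow> x \<in> I m \<Longrightarrow> m < 3 \<Longrightarrow> \<exists>n. tri m n \<and> x = p m n"
  using TD.inside[of m x] D.points_iff[of x] by blast

lemma f_strand: "x \<in> X \<Longrightarrow> m < 3 \<Longrightarrow> f x \<in> I m \<longleftrightarrow> x \<in> I m"
proof (erule X_cases)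
  assume "x \<notin> J" then show ?thesis by (simp add: f_outside)
next
  fix m' n' assume m: "m < 3" and t: "tri m' n'" "x = p m' n'" "m' < 3" "x \<in> I m'"
  have "f x \<in> I m'" using f_corner[OF t(1)] TE.corner(1)[OF t(1)] t(2) by simp
  then show ?thesis using TD.strand_unique[OF m t(3)] t(4) by blast
qed

lemma f_less:
  assumes "x \<in> X" "y \<in> X" "\<And>m. m < 3 \<Longrightarrow> x \<in> I m \<Longrightarrow> y \<in> I m \<Longrightarrow> x = y"
  shows "f x < f y \<longleftrightarrow> x < y"
proof (cases "x = y")
  case False
  have one: "f u < v \<longleftrightarrow> u < v" "v < f u \<longleftrightarrow> v < u" if "u \<in> X" "v \<notin> J" for u v
  proof -
    have "(f u < v \<longleftrightarrow> u < v) \<and> (v < f u \<longleftrightarrow> v < u)"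
    proof (cases rule: X_cases[OF that(1)])
      case 1
      then show ?thesis by (simp add: f_outside)
    next
      case (2 m n)
      obtain l w where lw: "I m = {l..w}" using strand[OF 2(3)] by blast
      have "f u \<in> {l..w}" "u \<in> {l..w}" using f_strand[OF that(1) 2(3)] 2(4) lw by auto
      moreover have "v \<notin> {l..w}" using that(2) in_J[OF 2(3)] lw by blast
      ultimately show ?thesis by auto
    qed
    then show "f u < v \<longleftrightarrow> u < v" "v < f u \<longleftrightarrow> v < u" by auto
  qed
  show ?thesis
  proof (cases rule: X_cases[OF assms(1)])
    case 1
    then show ?thesis using one(2)[OF assms(2) 1] by (simp add: f_outside)
  next
    case (2 m n)
    note x = this
    show ?thesis
    proof (cases rule: X_cases[OF assms(2)])
      case 1
      then show ?thesis using one(1)[OF assms(1) 1] by (simp add: f_outside)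
    next
      case (2 m' n')
      have ne: "m \<noteq> m'" using assms(3)[OF x(3,4)] 2(4) False by blast
      obtain l w l' w' where lw: "I m = {l..w}" "I m' = {l'..w'}" using strand[OF x(3)] strand[OF 2(3)] by blast
      show ?thesis
        by (rule less_intervals[OF TD.disjoint[OF x(3) 2(3) ne, unfolded lw]])
          (use f_strand[OF assms(1) x(3)] f_strand[OF assms(2) 2(3)] x(4) 2(4) lw in auto)
    qed
  qed
qed simp

lemma f_inj: "inj_on f X"
proof (rule inj_onI)
  fix x y assume xy: "x \<in> X" "y \<in> X" "f x = f y"
  show "x = y"
  proof (cases "\<exists>m<3. x \<in> I m \<and> y \<in> I m")
    case True
    then obtain m where m: "m < 3" "x \<in> I m" "y \<in> I m" by blast
    obtain n n' where n: "tri m n" "x = p m n" "tri m n'" "y = p m n'"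
      using X_on_strand[OF xy(1) m(2,1)] X_on_strand[OF xy(2) m(3,1)] by blast
    then have "q m n = q m n'" using xy(3) f_corner by simp
    then have "n = n'" using TE.corner_inj[OF n(1,3)] by blast
    then show ?thesis using n by simp
  next
    case False
    then have "f x < f y \<longleftrightarrow> x < y" "f y < f x \<longleftrightarrow> y < x" using f_less[OF xy(1,2)] f_less[OF xy(2,1)] by blast+
    then show ?thesis using xy(3) by auto
  qed
qed

definition H :: "real chords" where
  "H = Chords X f (mate (chords_of D)) (ori (chords_of D)) (over (chords_of D))"

lemma H_sel: "points H = X" "pos H = f" "mate H = mate (chords_of D)" "ori H = ori (chords_of D)"
  "over H = over (chords_of D)"
  by (simp_all add: H_def)

lemma chord_diagram_H: "chord_diagram H"
  by unfold_locales (auto simp: H_sel f_inj D.chords.ori_unit)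

lemma phi_chords_E: "phi_chords i j k (chords_of E) = phi_chords i j k H"
proof (rule phi_chords_iso[where g = f])
  show "bij_betw f (points H) (points (chords_of E))"
  proof (rule bij_betw_imageI)
    show "inj_on f (points H)" by (simp add: H_sel f_inj)
    show "f ` points H = points (chords_of E)"
    proof (intro set_eqI iffI)
      fix y assume "y \<in> f ` points H"
      then obtain x where x: "x \<in> X" "y = f x" by (auto simp: H_sel)
      show "y \<in> points (chords_of E)"
      proof (cases rule: X_cases[OF x(1)])
        case 1
        then show ?thesis using outside(1)[OF 1] x f_outside by simp
      next
        case (2 m n)
        have "mark D x \<in> {Over, Under}" using x(1) D.points_iff[of x] by blast
        then have "mark E (q m n) \<in> {Over, Under}" unfolding marks_corr[OF 2(1)] 2(2) .
        then show ?thesis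
          unfolding x(2) 2(2) f_corner[OF 2(1)] using TE.corner(2)[OF 2(1)] E.points_iff by blast
      qed
    next
      fix y assume y: "y \<in> points (chords_of E)"
      show "y \<in> f ` points H"
      proof (cases "y \<in> J")
        case True
        then obtain m where m: "m < 3" "y \<in> I m" unfolding J_def by blast
        obtain z where "crossing E y z" "mark E y \<in> {Over, Under}" using y E.points_iff[of y] by blast
        moreover from TE.inside[OF m this(1)] obtain n where n: "tri m n" "y = q m n" by blast
        ultimately have "mark D (p m n) \<in> {Over, Under}" using marks_corr[OF n(1)] by simp
        then have "p m n \<in> X" using TD.corner(2)[OF n(1)] D.points_iff by blast
        then show ?thesis using f_corner[OF n(1)] n(2) by (auto simp: H_sel intro!: image_eqI)
      next
        case False
        then have "y \<in> X" using y outside(1) by simp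
        moreover have "y = f y" using f_outside[OF False] by simp
        ultimately show ?thesis unfolding H_sel by (rule rev_image_eqI)
      qed
    qed
  qed
  fix x assume "x \<in> points H"
  then have x: "x \<in> X" by (simp add: H_sel)
  show "mate H x \<in> points H" using x by (simp add: H_sel)
  show "mate (chords_of E) (f x) = f (mate H x)"
  proof (cases rule: X_cases[OF x])
    case 1
    then show ?thesis using outside(2,5)[OF 1 x] by (simp add: H_sel f_outside)
  next
    case (2 m n)
    show ?thesis
      unfolding H_sel 2(2) f_corner[OF 2(1)] D.mate_crossing[OF TD.corner(2)[OF 2(1)]]
        E.mate_crossing[OF TE.corner(2)[OF 2(1)]] f_corner[OF tri_sym[OF 2(1)]] ..
  qed
  show "ori (chords_of E) (f x) = ori H x"
  proof (cases rule: X_cases[OF x])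
    case 1
    then show ?thesis using outside(3)[OF 1 x] by (simp add: H_sel f_outside)
  next
    case (2 m n)
    have "cross2 (vel E (q m n)) (vel E (q n m)) > 0 \<longleftrightarrow> cross2 (vel D (p m n)) (vel D (p n m)) > 0"
      using signs_corr[OF 2(1)] by (metis sgn_1_pos)
    then show ?thesis
      unfolding H_sel 2(2) f_corner[OF 2(1)] D.ori_crossing[OF TD.corner(2)[OF 2(1)]]
        E.ori_crossing[OF TE.corner(2)[OF 2(1)]] by simp
  qed
  show "over (chords_of E) (f x) = over H x"
  proof (cases rule: X_cases[OF x])
    case 1
    then show ?thesis using outside(4)[OF 1 x] by (simp add: H_sel f_outside)
  next
    case (2 m n)
    show ?thesis
      unfolding H_sel 2(2) f_corner[OF 2(1)] D.chords_sel E.chords_sel marks_corr[OF 2(1)] ..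
  qed
next
  fix x y z
  show "btw (chords_of E) (f x) (f y) (f z) = btw H x y z"
    unfolding E.btw_chords by (simp add: btw_def H_sel)
qed

text \<open>
  In the virtual and the mixed third move each strand carries at most one end of a classical crossing,
  and then the move does not change the Gauss diagram.
\<close>

lemma phi_chords_few_classical:
  assumes "\<And>m x y. m < 3 \<Longrightarrow> x \<in> X \<Longrightarrow> y \<in> X \<Longrightarrow> x \<in> I m \<Longrightarrow> y \<in> I m \<Longrightarrow> x = y"
  shows "phi_chords i j k (chords_of E) = phi_chords i j k (chords_of D)"
  unfolding phi_chords_E
proof (rule phi_chords_iso[where g = "\<lambda>x. x"])
  fix x y z assume "x \<in> X" "y \<in> X" "z \<in> X"
  then show "btw H x y z = btw (chords_of D) x y z"
    unfolding D.btw_chords unfolding btw_def H_sel by (intro cyc_less_cong f_less) (use assms in blast)+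
qed (simp_all add: H_sel bij_betw_def)

lemma adjacent_D:
  assumes "tri m n" "tri m k" "n \<noteq> k" "p m n \<in> X" "p m k \<in> X"
  shows "adjacent (chords_of D) (p m n) (p m k) (p m n < p m k)"
proof (rule adjacent_on_strand[OF D.chords.circle_chords_axioms _ assms(4,5)])
  show "m < 3" using assms(1) by (simp add: tri_def)
  show "p m n \<in> I m" "p m k \<in> I m" using TD.corner(1) assms(1,2) by auto
  show "p m n \<noteq> p m k" using TD.corner_inj[OF assms(1,2)] assms(3) by blast
  fix x assume "x \<in> X" "x \<in> I m"
  then obtain n' where "tri m n'" "x = p m n'" using X_on_strand \<open>m < 3\<close> by blast
  moreover have "n' = n \<or> n' = k" using calculation(1) assms(1-3) unfolding tri_def by linarith
  ultimately show "x = p m n \<or> x = p m k" by blast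
qed

lemma adjacent_H:
  assumes "tri m n" "tri m k" "tri n k" "p m n \<in> X" "p m k \<in> X"
  shows "adjacent H (p m n) (p m k) (\<not> p m n < p m k)"
proof -
  have m: "m < 3" "n \<noteq> k" using assms(1,3) by (auto simp: tri_def)
  have ne: "p m n \<noteq> p m k" "q m n \<noteq> q m k"
    using TD.corner_inj[OF assms(1,2)] TE.corner_inj[OF assms(1,2)] m(2) by blast+
  obtain l w where lw: "I m = {l..w}" using strand[OF m(1)] by blast
  have "btw H (p m n) (p m k) x = (\<not> p m n < p m k)" if x: "x \<in> X - {p m n, p m k}" for x
  proof -
    have "x \<notin> I m"
    proof
      assume "x \<in> I m"
      then obtain n' where n': "tri m n'" "x = p m n'" using X_on_strand m(1) x by blast
      moreover have "n' = n \<or> n' = k" using n'(1) assms(1-3) unfolding tri_def by linarith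
      ultimately show False using x by blast
    qed
    then have "f x \<notin> {l..w}" using f_strand[of x m] x m(1) lw by simp
    moreover have "q m n \<in> {l..w}" "q m k \<in> {l..w}" using TE.corner(1)[OF assms(1)] TE.corner(1)[OF assms(2)] lw by auto
    ultimately have "cyc (q m n) (q m k) (f x) \<longleftrightarrow> q m n < q m k" using ne(2) by (intro cyc_interval)
    then show ?thesis
      unfolding btw_def H_sel f_corner[OF assms(1)] f_corner[OF assms(2)]
      using reversed[OF assms(1,3,2)] ne by auto
  qed
  then show ?thesis unfolding adjacent_def H_sel using assms(4,5) ne(1) by blast
qed

text \<open>The turning condition, in terms of orientations and of the order of the points on the strands.\<close>

lemma orientation_relation:
  defines "o_D \<equiv> ori (chords_of D)"
  shows "o_D (p 0 1) * pm (p 0 2 < p 0 1) * pm (p 1 0 < p 1 2) = o_D (p 1 2) * pm (p 1 0 < p 1 2) * pm (p 2 1 < p 2 0)"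
    and "o_D (p 1 2) * pm (p 1 0 < p 1 2) * pm (p 2 1 < p 2 0) = o_D (p 2 0) * pm (p 2 1 < p 2 0) * pm (p 0 2 < p 0 1)"
proof -
  have s: "sgn (cross2 (vel D (p m n)) (vel D (p n m))) = real_of_int (o_D (p m n))" if "tri m n" for m n
    unfolding o_D_def D.ori_crossing[OF TD.corner(2)[OF that]]
    using D.transverse[OF TD.corner(2)[OF that]] by (auto simp: sgn_if)
  have d: "sgn (v - u) = real_of_int (pm (u < v))" if "u \<noteq> v" for u v :: real
    using that by (auto simp: pm_def sgn_if)
  have ne: "p 0 2 \<noteq> p 0 1" "p 1 0 \<noteq> p 1 2" "p 2 1 \<noteq> p 2 0"
    using TD.corner_inj[of 0 2 0 1] TD.corner_inj[of 1 0 1 2] TD.corner_inj[of 2 1 2 0] by (auto simp: tri_def)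
  have c: "(0 + 1) mod 3 = (1 :: nat)" "(0 + 2) mod 3 = (2 :: nat)" "(1 + 1) mod 3 = (2 :: nat)"
    "(1 + 2) mod 3 = (0 :: nat)" "(2 + 1) mod 3 = (0 :: nat)" "(2 + 2) mod 3 = (1 :: nat)" by simp_all
  have t: "tri 0 1" "tri 1 2" "tri 2 0" by (simp_all add: tri_def)
  have "real_of_int (pm (p 0 2 < p 0 1)) * real_of_int (pm (p 1 0 < p 1 2)) * real_of_int (o_D (p 0 1))
      = real_of_int (pm (p 1 0 < p 1 2)) * real_of_int (pm (p 2 1 < p 2 0)) * real_of_int (o_D (p 1 2))
    \<and> real_of_int (pm (p 1 0 < p 1 2)) * real_of_int (pm (p 2 1 < p 2 0)) * real_of_int (o_D (p 1 2))
      = real_of_int (pm (p 2 1 < p 2 0)) * real_of_int (pm (p 0 2 < p 0 1)) * real_of_int (o_D (p 2 0))"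
    using convex unfolding convex_triangle_def Let_def c s[OF t(1)] s[OF t(2)] s[OF t(3)] d[OF ne(1)] d[OF ne(2)] d[OF ne(3)] .
  then have "pm (p 0 2 < p 0 1) * pm (p 1 0 < p 1 2) * o_D (p 0 1) = pm (p 1 0 < p 1 2) * pm (p 2 1 < p 2 0) * o_D (p 1 2)
    \<and> pm (p 1 0 < p 1 2) * pm (p 2 1 < p 2 0) * o_D (p 1 2) = pm (p 2 1 < p 2 0) * pm (p 0 2 < p 0 1) * o_D (p 2 0)"
    by (simp only: of_int_mult[symmetric] of_int_eq_iff)
  then show "o_D (p 0 1) * pm (p 0 2 < p 0 1) * pm (p 1 0 < p 1 2) = o_D (p 1 2) * pm (p 1 0 < p 1 2) * pm (p 2 1 < p 2 0)"
    and "o_D (p 1 2) * pm (p 1 0 < p 1 2) * pm (p 2 1 < p 2 0) = o_D (p 2 0) * pm (p 2 1 < p 2 0) * pm (p 0 2 < p 0 1)"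
    by (simp_all add: mult.commute mult.left_commute)
qed

text \<open>
  The strands are numbered from top to bottom, and their cyclic order on the curve is \<open>0, b, c\<close>. For
  the order \<open>0, 2, 1\<close> all orientations and all directions are reversed compared with the numbering, which changes
  the sign of \<open>\<tau>\<close>.
\<close>

lemma phi_chords_classical:
  assumes bc: "b = 1 \<and> c = 2 \<or> b = 2 \<and> c = 1"
    and order: "\<And>x y z. x \<in> I 0 \<Longrightarrow> y \<in> I b \<Longrightarrow> z \<in> I c \<Longrightarrow> cyc x y z"
    and layers: "mark D (p 0 1) = Over" "mark D (p 0 2) = Over" "mark D (p 1 2) = Over"
    and ijk: "i \<noteq> j" "j \<noteq> k" "i \<noteq> k"
  shows "phi_chords i j k (chords_of E) = phi_chords i j k (chords_of D)"
proof -
  have t: "tri 0 b" "tri 0 c" "tri b 0" "tri b c" "tri c b" "tri c 0"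
    and t012: "tri 0 1" "tri 0 2" "tri 1 2" "tri 1 0" "tri 2 0" "tri 2 1"
    using bc by (auto simp: tri_def)
  have lt: "b < 3" "c < 3" and bc0: "b \<noteq> 0" "c \<noteq> 0" "b \<noteq> c" using bc by auto
  have under: "mark D (p 1 0) = Under" "mark D (p 2 0) = Under" "mark D (p 2 1) = Under"
    using D.marks[OF TD.corner(2)[OF t012(1)]] D.marks[OF TD.corner(2)[OF t012(2)]]
      D.marks[OF TD.corner(2)[OF t012(3)]] layers by auto
  have inX: "p m n \<in> X" if "tri m n" for m n
  proof -
    have "(m, n) \<in> {(0,1),(0,2),(1,2),(1,0),(2,0),(2,1)}" using that unfolding tri_def by auto
    then have "mark D (p m n) \<in> {Over, Under}" using layers under by auto
    then show ?thesis using TD.corner(2)[OF that] D.points_iff by blast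
  qed
  have ne: "p m n \<noteq> p m' n'" if "tri m n" "tri m' n'" "m \<noteq> m' \<or> n \<noteq> n'" for m n m' n'
    using TD.corner_inj[OF that(1,2)] that(3) by blast
  have reverse_turn: "- y * - B * - C = - z * - A * - B" "- x * - C * - A = - z * - A * - B"
    if "x * A * C = y * C * B" "y * C * B = z * B * A" for x y z A B C :: int
  proof -
    have "- y * - B * - C = - (y * C * B)" "- x * - C * - A = - (x * A * C)" "- z * - A * - B = - (z * B * A)"
      by (simp_all add: mult.commute mult.left_commute)
    then show "- y * - B * - C = - z * - A * - B" "- x * - C * - A = - z * - A * - B"
      unfolding that(1) that(2) by simp_all
  qed
  let ?xa = "p 0 c < p 0 b" and ?xb = "p b 0 < p b c" and ?xc = "p c b < p c 0"
  let ?o = "ori (chords_of D)"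
  (* The direction of turning at the corners, computed at the corner of the strands 0 and b. *)
  define \<tau> where "\<tau> = ?o (p 0 b) * pm ?xa * pm ?xb"
  have sq: "pm x * pm x = 1" for x by (simp add: pm_def)
  have opposite: "?o (p n m) = - ?o (p m n)" if "tri m n" for m n
    using D.chords.ori_mate[OF inX[OF that]] unfolding D.mate_crossing[OF TD.corner(2)[OF that]] .
  have neg: "pm (u < v) = - pm (v < u)" if "u \<noteq> v" for u v :: real using that by (auto simp: pm_def)
  have turn: "?o (p b c) * pm ?xb * pm ?xc = \<tau>" "?o (p c 0) * pm ?xc * pm ?xa = \<tau>"
  proof -
    note R = orientation_relation
    from bc have "?o (p b c) * pm ?xb * pm ?xc = \<tau> \<and> ?o (p c 0) * pm ?xc * pm ?xa = \<tau>"
    proof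
      assume "b = 1 \<and> c = 2"
      then have b: "b = 1" and c: "c = 2" by auto
      show ?thesis
        unfolding \<tau>_def b c by (intro conjI; (rule R(1)[symmetric] | rule trans[OF R(1) R(2), symmetric]))
    next
      assume "b = 2 \<and> c = 1"
      then have b: "b = 2" and c: "c = 1" by auto
      have n: "pm (p 0 1 < p 0 2) = - pm (p 0 2 < p 0 1)" "pm (p 2 0 < p 2 1) = - pm (p 2 1 < p 2 0)"
        "pm (p 1 2 < p 1 0) = - pm (p 1 0 < p 1 2)"
        by (intro neg ne t012; simp)+
      show ?thesis
        unfolding \<tau>_def b c n opposite[OF t012(1)] opposite[OF t012(3)] opposite[OF t012(5)]
        by (intro conjI reverse_turn[OF R])
    qed
    then show "?o (p b c) * pm ?xb * pm ?xc = \<tau>" "?o (p c 0) * pm ?xc * pm ?xa = \<tau>" by auto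
  qed
  have solve: "z = w * pm x * pm y" if "z * pm x * pm y = w" for z w x y
    unfolding that[symmetric] by (simp add: mult.assoc mult.left_commute[of "pm y"] sq)
  interpret triangle_pair "chords_of D" H "p 0 c" "p 0 b" "p b 0" "p b c" "p c b" "p c 0" ?xa ?xb ?xc \<tau>
  proof (intro triangle_pair.intro triangle_pair_axioms.intro)
    show "chord_diagram (chords_of D)" by (rule D.chords.chord_diagram_axioms)
    show "chord_diagram H" by (rule chord_diagram_H)
    show "distinct [p 0 c, p 0 b, p b 0, p b c, p c b, p c 0]"
      using ne t bc0 by simp
    show "{p 0 c, p 0 b, p b 0, p b c, p c b, p c 0} \<subseteq> X" using inX t by blast
    show "mate (chords_of D) (p 0 b) = p b 0" "mate (chords_of D) (p b c) = p c b" "mate (chords_of D) (p c 0) = p 0 c"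
      using D.mate_crossing TD.corner(2) t by auto
    fix x y z
    show "btw (chords_of D) x y z" if "x \<in> {p 0 c, p 0 b}" "y \<in> {p b 0, p b c}" "z \<in> {p c b, p c 0}"
      unfolding D.btw_chords using that TD.corner(1) t by (intro order) auto
    assume xyz: "x \<in> X" "y \<in> X" "z \<in> X"
      and no: "\<not> {p 0 c, p 0 b} \<subseteq> {x, y, z}" "\<not> {p b 0, p b c} \<subseteq> {x, y, z}" "\<not> {p c b, p c 0} \<subseteq> {x, y, z}"
    have pair: "u = v" if uv: "u \<in> X" "v \<in> X" "m < 3" "u \<in> I m" "v \<in> I m" "u \<in> {x, y, z}" "v \<in> {x, y, z}" for u v m
    proof (rule ccontr)
      assume "u \<noteq> v"
      obtain n n' where n: "tri m n" "u = p m n" "tri m n'" "v = p m n'"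
        using X_on_strand[OF uv(1,4,3)] X_on_strand[OF uv(2,5,3)] by blast
      have nn: "n \<noteq> n'" using \<open>u \<noteq> v\<close> n by blast
      have "m = 0 \<or> m = b \<or> m = c" using uv(3) bc by linarith
      moreover have "{u, v} = {p 0 c, p 0 b}" if "m = 0"
      proof -
        have "n = b \<and> n' = c \<or> n = c \<and> n' = b" using n nn bc that unfolding tri_def by linarith
        then show ?thesis using n that by blast
      qed
      moreover have "{u, v} = {p b 0, p b c}" if "m = b"
      proof -
        have "n = 0 \<and> n' = c \<or> n = c \<and> n' = 0" using n nn bc that unfolding tri_def by linarith
        then show ?thesis using n that by blast
      qed
      moreover have "{u, v} = {p c b, p c 0}" if "m = c"
      proof -
        have "n = 0 \<and> n' = b \<or> n = b \<and> n' = 0" using n nn bc that unfolding tri_def by linarith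
        then show ?thesis using n that by blast
      qed
      moreover have "{u, v} \<subseteq> {x, y, z}" using uv by blast
      ultimately show False using no by metis
    qed
    show "btw H x y z = btw (chords_of D) x y z"
      unfolding D.btw_chords unfolding btw_def H_sel
      by (intro cyc_less_cong f_less xyz) (use pair xyz in blast)+
  next
    show "adjacent (chords_of D) (p 0 c) (p 0 b) ?xa" "adjacent (chords_of D) (p b 0) (p b c) ?xb"
      "adjacent (chords_of D) (p c b) (p c 0) ?xc"
      by (rule adjacent_D; use t bc0 inX in simp)+
    show "adjacent H (p 0 c) (p 0 b) (\<not> ?xa)" "adjacent H (p b 0) (p b c) (\<not> ?xb)"
      "adjacent H (p c b) (p c 0) (\<not> ?xc)"
      by (rule adjacent_H; use t bc0 inX in simp)+
    show "?o (p 0 b) = \<tau> * pm ?xa * pm ?xb" by (rule solve) (simp add: \<tau>_def)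
    show "?o (p b c) = \<tau> * pm ?xb * pm ?xc" by (rule solve[OF turn(1)])
    show "?o (p c 0) = \<tau> * pm ?xc * pm ?xa" by (rule solve[OF turn(2)])
    show "\<not> (over (chords_of D) (p 0 b) = over (chords_of D) (p b c) \<and>
       over (chords_of D) (p b c) = over (chords_of D) (p c 0))"
      unfolding D.chords_sel using bc layers under by auto
  qed (simp_all add: H_sel)
  show ?thesis unfolding phi_chords_E by (rule phi_chords_triangle[OF ijk])
qed

lemma cyclic_order:
  "(\<forall>x\<in>I 0. \<forall>y\<in>I 1. \<forall>z\<in>I 2. cyc x y z) \<or> (\<forall>x\<in>I 0. \<forall>y\<in>I 2. \<forall>z\<in>I 1. cyc x y z)"
proof -
  obtain l u where lu: "\<And>m. m < 3 \<Longrightarrow> l m < u m \<and> I m = {l m..u m}"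
    using strand by metis
  have less: "x < y \<longleftrightarrow> l m < l n" if "tri m n" "x \<in> I m" "y \<in> I n" for x y m n
  proof -
    have mn: "m < 3" "n < 3" "m \<noteq> n" using that(1) by (auto simp: tri_def)
    have eq: "I m = {l m..u m}" "I n = {l n..u n}" "l m < u m" "l n < u n" using lu mn by auto
    have "{l m..u m} \<inter> {l n..u n} = {}" using TD.disjoint[OF mn] eq by simp
    then show ?thesis by (rule less_intervals) (use that eq in auto)
  qed
  have t: "tri 0 1" "tri 1 2" "tri 2 0" "tri 0 2" "tri 2 1" "tri 1 0" by (simp_all add: tri_def)
  have l: "l m \<in> I m" if "m < 3" for m using lu[OF that] by auto
  have "l 0 \<noteq> l 1" "l 1 \<noteq> l 2" "l 0 \<noteq> l 2"
    using TD.strand_unique[of 0 1 "l 0"] TD.strand_unique[of 1 2 "l 1"] TD.strand_unique[of 0 2 "l 0"] l[of 0] l[of 1] l[of 2] by auto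
  then have "cyc (l 0) (l 1) (l 2) \<or> cyc (l 0) (l 2) (l 1)" unfolding cyc_def by linarith
  moreover have "cyc x y z = cyc (l 0) (l 1) (l 2)" if "x \<in> I 0" "y \<in> I 1" "z \<in> I 2" for x y z
    by (rule cyc_less_cong) (intro less t that)+
  moreover have "cyc x y z = cyc (l 0) (l 2) (l 1)" if "x \<in> I 0" "y \<in> I 2" "z \<in> I 1" for x y z
    by (rule cyc_less_cong) (intro less t that)+
  ultimately show ?thesis by blast
qed

end

lemma phi_chords_move3:
  assumes D: "singular_diagram D" and E: "singular_diagram E" and move: "move3 D E"
    and ijk: "i \<noteq> j" "j \<noteq> k" "i \<noteq> k"
  shows "phi_chords i j k (chords_of E) = phi_chords i j k (chords_of D)"
proof -
  obtain I p q where ch: "local_change 3 I D E" and tr: "triangle D I p" "triangle E I q" "convex_triangle D p"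
    and rev: "\<forall>m<3. \<forall>n<3. \<forall>k<3. m \<noteq> n \<and> n \<noteq> k \<and> m \<noteq> k \<longrightarrow> (p m n < p m k \<longleftrightarrow> q m k < q m n)"
    and corr: "\<forall>m<3. \<forall>n<3. m \<noteq> n \<longrightarrow> mark E (q m n) = mark D (p m n) \<and>
        sgn (cross2 (vel E (q m n)) (vel E (q n m))) = sgn (cross2 (vel D (p m n)) (vel D (p n m)))"
    and layers: "mark D (p 0 1) = Over \<and> mark D (p 0 2) = Over \<and> mark D (p 1 2) = Over \<or>
      mark D (p 0 1) = Virtual \<and> mark D (p 0 2) = Virtual \<and> mark D (p 1 2) = Virtual \<or>
      mark D (p 0 1) = Over \<and> mark D (p 0 2) = Virtual \<and> mark D (p 1 2) = Virtual"
    using move unfolding move3_def by (elim exE conjE) (rule that)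
  interpret move3_pair D E I p q
    by unfold_locales (use D E ch tr rev corr in \<open>auto simp: tri_def\<close>)
  have t: "tri 0 1" "tri 0 2" "tri 1 2" by (simp_all add: tri_def)
  show ?thesis
  proof (cases "mark D (p 0 2) = Over")
    case True
    then have o: "mark D (p 0 1) = Over" "mark D (p 0 2) = Over" "mark D (p 1 2) = Over" using layers by auto
    from cyclic_order show ?thesis
    proof
      assume "\<forall>x\<in>I 0. \<forall>y\<in>I 1. \<forall>z\<in>I 2. cyc x y z"
      then show ?thesis by (intro phi_chords_classical[of 1 2] o ijk) auto
    next
      assume "\<forall>x\<in>I 0. \<forall>y\<in>I 2. \<forall>z\<in>I 1. cyc x y z"
      then show ?thesis by (intro phi_chords_classical[of 2 1] o ijk) auto
    qed
  next
    case False
    then have v: "mark D (p 0 2) = Virtual" "mark D (p 1 2) = Virtual" using layers by auto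
    then have v': "mark D (p 2 0) = Virtual" "mark D (p 2 1) = Virtual"
      using D.marks[OF TD.corner(2)[OF t(2)]] D.marks[OF TD.corner(2)[OF t(3)]] by auto
    have only: "x = p 0 1 \<and> m = 0 \<or> x = p 1 0 \<and> m = 1" if h: "m < 3" "x \<in> X" "x \<in> I m" for m x
    proof -
      obtain n where n: "tri m n" "x = p m n" using X_on_strand[OF h(2,3,1)] by blast
      have mk: "mark D (p m n) \<in> {Over, Under}" using h(2) D.points_iff[of x] n by blast
      have "(m, n) \<in> {(0,1),(0,2),(1,2),(1,0),(2,0),(2,1)}" using n(1) unfolding tri_def by auto
      then show ?thesis using mk v v' n by auto
    qed
    show ?thesis
    proof (rule phi_chords_few_classical)
      fix m x y assume h: "m < 3" "x \<in> X" "y \<in> X" "x \<in> I m" "y \<in> I m"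
      show "x = y" using only[OF h(1,2,4)] only[OF h(1,3,5)] by auto
    qed
  qed
qed

section \<open>Finite type\<close>

lemma phi_elementary_move:
  assumes "i \<noteq> j" "j \<noteq> k" "i \<noteq> k" "elementary_move D E"
  shows "phi i j k D = phi i j k E"
proof -
  have D: "singular_diagram D" and E: "singular_diagram E"
    and m: "isotopic D E \<or> move1 D E \<or> move2 D E \<or> move3 D E"
    using assms(4) unfolding elementary_move_def virtual_diagram_def by auto
  have "phi_chords i j k (chords_of E) = phi_chords i j k (chords_of D)"
    using m phi_chords_isotopic[OF D E] phi_chords_move1[OF D E _ assms(1-3)]
      phi_chords_move2[OF D E _ assms(1-3)] phi_chords_move3[OF D E _ assms(1-3)] by metis
  then show ?thesis
    using generic_diagram.phi_eq_phi_chords[OF generic_diagram.intro[OF D] assms(1-3)]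
      generic_diagram.phi_eq_phi_chords[OF generic_diagram.intro[OF E] assms(1-3)] by simp
qed

lemma phi_invariant:
  assumes "i \<noteq> j" "j \<noteq> k" "i \<noteq> k"
  shows "virtual_knot_invariant (phi i j k)"
proof -
  have "phi i j k D = phi i j k E" if "same_virtual_knot D E" for D E
    using that unfolding same_virtual_knot_def
  proof (induction rule: equivclp_induct)
    case (step y z)
    then show ?case using phi_elementary_move[OF assms] by metis
  qed simp
  then show ?thesis unfolding virtual_knot_invariant_def by blast
qed

context generic_diagram
begin

lemma vel_resolve: "vel (resolve K S) = vel K"
  by (rule ext) (simp add: vel_def resolve_def)

lemma crossing_resolve: "crossing (resolve K S) = crossing K"
  by (intro ext) (simp add: crossing_def resolve_def)

lemma partner_resolve: "partner (resolve K S) = partner K"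
  by (rule ext) (simp add: partner_def crossing_resolve)

text \<open>As there are no triple points, the quantifier in \<open>resolve\<close> sees the other passage only.\<close>

lemma passages:
  assumes "crossing K s t" "curve K u = curve K s"
  shows "vel K u = vel K s \<or> vel K u = vel K t"
proof -
  have c: "curve K (frac u) = curve K s" using assms(2) by (simp add: at_frac)
  have "frac u \<in> {0..<1}" by (simp add: frac_lt_1)
  then have "frac u = s \<or> crossing K s (frac u)"
    using c assms(1) unfolding crossing_def by auto
  then have "frac u = s \<or> frac u = t" using crossing_unique[OF assms(1)] by blast
  then show ?thesis using at_frac(3)[of u] by auto
qed

lemma mark_resolve:
  assumes "crossing K s t"
  shows "mark (resolve K S) s = (if mark K s = Singular
    then if (cross2 (vel K s) (vel K t) > 0) = (curve K s \<notin> S) then Over else Under else mark K s)"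
proof -
  have z: "cross2 (vel K s) (vel K s) = 0" by (simp add: cross2_def)
  have ct: "curve K t = curve K s" using assms unfolding crossing_def by simp
  have "(\<exists>u. curve K u = curve K s \<and> cross2 (vel K s) (vel K u) < 0) \<longleftrightarrow> cross2 (vel K s) (vel K t) < 0"
    using passages[OF assms] ct z by (metis less_irrefl)
  moreover have "(\<exists>u. curve K u = curve K s \<and> cross2 (vel K s) (vel K u) > 0) \<longleftrightarrow> cross2 (vel K s) (vel K t) > 0"
    using passages[OF assms] ct z by (metis less_irrefl)
  moreover have "cross2 (vel K s) (vel K t) \<noteq> 0" by (rule transverse[OF assms])
  ultimately show ?thesis unfolding resolve_def by (cases "curve K s \<in> S") auto
qed

lemma singular_resolve: "singular_diagram (resolve K S)"
  unfolding singular_diagram_def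
proof (intro conjI allI impI)
  have c: "curve (resolve K S) = curve K" by (simp add: resolve_def)
  fix s t u
  show "curve (resolve K S) (t + 1) = curve (resolve K S) t" unfolding c by (rule periodic)
  show "mark (resolve K S) (t + 1) = mark (resolve K S) t"
    unfolding resolve_def diagram.sel periodic vel_periodic ..
  show "curve (resolve K S) C1_differentiable_on UNIV" "vel (resolve K S) t \<noteq> 0"
    unfolding c vel_resolve using sing unfolding singular_diagram_def by blast+
  show "finite {(s, t). crossing (resolve K S) s t}"
    unfolding crossing_resolve using sing unfolding singular_diagram_def by blast
  show "cross2 (vel (resolve K S) s) (vel (resolve K S) t) \<noteq> 0" if "crossing (resolve K S) s t"
    using that transverse unfolding vel_resolve crossing_resolve by blast
  show "t = u" if "crossing (resolve K S) s t \<and> crossing (resolve K S) s u"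
    using that crossing_unique unfolding crossing_resolve by blast
  assume "crossing (resolve K S) s t"
  then have st: "crossing K s t" "crossing K t s" unfolding crossing_resolve using crossing_sym by blast+
  have cst: "curve K t = curve K s" using st unfolding crossing_def by simp
  show "(mark (resolve K S) s, mark (resolve K S) t) \<in>
     {(Over, Under), (Under, Over), (Virtual, Virtual), (Singular, Singular)}"
    unfolding mark_resolve[OF st(1)] mark_resolve[OF st(2)] cst
    using marks[OF st(1)] transverse[OF st(1)] cross2_antisym[of "vel K t" "vel K s"] by auto
qed

definition resolved :: "complex set \<Rightarrow> real chords" where
  "resolved S = chords_of (resolve K S)"

lemma generic_resolve: "generic_diagram (resolve K S)"
  by (rule generic_diagram.intro[OF singular_resolve])

lemma resolved_sel:
  "pos (resolved S) s = s" "mate (resolved S) = partner K"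
  "ori (resolved S) = ori (chords_of K)" "over (resolved S) s \<longleftrightarrow> mark (resolve K S) s = Over"
  unfolding resolved_def by (simp_all add: chords_of_def partner_resolve vel_resolve)

lemma points_resolved: "points (resolved S) = {s. (\<exists>t. crossing K s t) \<and> mark K s \<noteq> Virtual}"
proof (intro set_eqI)
  fix s
  have "mark (resolve K S) s \<in> {Over, Under} \<longleftrightarrow> mark K s \<noteq> Virtual" if "crossing K s t" for t
    unfolding mark_resolve[OF that] by (cases "mark K s") auto
  then show "s \<in> points (resolved S) \<longleftrightarrow> s \<in> {s. (\<exists>t. crossing K s t) \<and> mark K s \<noteq> Virtual}"
    unfolding resolved_def by (auto simp: chords_of_def crossing_resolve)
qed

lemma btw_resolved: "btw (resolved S) x y z = cyc x y z"
  by (simp add: btw_def resolved_sel)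

text \<open>Indices, links and disjointness are read off the curve and ignore the resolution.\<close>

lemma resolved_invariants:
  "index (resolved S) = index (resolved S')" "link (resolved S) = link (resolved S')"
  "apart (resolved S) = apart (resolved S')"
  unfolding index_def[abs_def] link_def[abs_def] apart_def[abs_def] points_resolved resolved_sel btw_resolved
  by (rule refl)+

lemma over_resolved:
  assumes "crossing K s t"
  shows "over (resolved S) s \<longleftrightarrow>
    (if mark K s = Singular then (ori (chords_of K) s = 1) = (curve K s \<notin> S) else mark K s = Over)"
  unfolding resolved_sel mark_resolve[OF assms] ori_crossing[OF assms] by auto

lemma term_resolved_cong:
  assumes "s \<in> points (resolved {})" "t \<in> points (resolved {})"
    and "curve K s \<in> S \<longleftrightarrow> curve K s \<in> S'" "curve K t \<in> S \<longleftrightarrow> curve K t \<in> S'"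
  shows "pair_term i j k (resolved S) s t = pair_term i j k (resolved S') s t"
proof -
  have "over (resolved S) u = over (resolved S') u"
    if u: "u \<in> points (resolved {})" "curve K u \<in> S \<longleftrightarrow> curve K u \<in> S'" for u
  proof -
    obtain w where "crossing K u w" using u(1) unfolding points_resolved by blast
    then show ?thesis using over_resolved u(2) by simp
  qed
  then show ?thesis
    unfolding pair_term_def resolved_invariants[of S S'] resolved_sel(3) using assms by simp
qed

lemma finite_resolved: "finite (points (resolved S))"
proof -
  interpret R: generic_diagram "resolve K S" by (rule generic_resolve)
  show ?thesis unfolding resolved_def by (rule R.chords.finite_points)
qed

lemma phi_resolve:
  assumes "i \<noteq> j" "j \<noteq> k" "i \<noteq> k"
  shows "phi i j k (resolve K S) =
    (\<Sum>s\<in>points (resolved {}). \<Sum>t\<in>points (resolved {}). pair_term i j k (resolved S) s t)"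
  unfolding generic_diagram.phi_eq_phi_chords[OF generic_resolve assms] phi_chords_def
    resolved_def[symmetric] points_resolved ..

end

abbreviation alternating :: "'a set \<Rightarrow> ('a set \<Rightarrow> int) \<Rightarrow> int" where
  "alternating Z f \<equiv> \<Sum>S\<in>Pow Z. if even (card S) then f S else - f S"

text \<open>The terms for \<open>S\<close> and \<open>insert z S\<close> have opposite signs and cancel.\<close>

lemma alternating_eq_zero:
  assumes "finite Z" "z \<in> Z" "\<And>S. S \<subseteq> Z - {z} \<Longrightarrow> f (insert z S) = f S"
  shows "alternating Z f = 0"
proof -
  let ?P = "Pow (Z - {z})" and ?h = "\<lambda>S. if even (card S) then f S else - f S"
  have "insert z (Z - {z}) = Z" using assms(2) by blast
  then have "Pow Z = ?P \<union> insert z ` ?P" using Pow_insert[of z "Z - {z}"] by simp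
  moreover have "?P \<inter> insert z ` ?P = {}" by blast
  moreover have "inj_on (insert z) ?P" by (rule inj_onI) blast
  ultimately have "alternating Z f = (\<Sum>S\<in>?P. ?h S) + (\<Sum>S\<in>?P. ?h (insert z S))"
    using assms(1) by (simp add: sum.union_disjoint sum.reindex)
  also have "(\<Sum>S\<in>?P. ?h (insert z S)) = (\<Sum>S\<in>?P. - ?h S)"
  proof (rule sum.cong[OF refl])
    fix S assume "S \<in> ?P"
    then have S: "S \<subseteq> Z - {z}" "finite S" "z \<notin> S" using assms(1) finite_subset by auto
    then show "?h (insert z S) = - ?h S" using assms(3)[OF S(1)] by simp
  qed
  finally show ?thesis by (simp add: sum_negf)
qed

lemma alternating_sum:
  "alternating Z (\<lambda>S. \<Sum>s\<in>A. \<Sum>t\<in>B. f s t S) = (\<Sum>s\<in>A. \<Sum>t\<in>B. alternating Z (f s t))"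
proof -
  have "alternating Z (\<lambda>S. \<Sum>s\<in>A. \<Sum>t\<in>B. f s t S) =
      (\<Sum>S\<in>Pow Z. \<Sum>s\<in>A. \<Sum>t\<in>B. if even (card S) then f s t S else - f s t S)"
    by (rule sum.cong[OF refl]) (simp add: sum_negf)
  also have "\<dots> = (\<Sum>s\<in>A. \<Sum>S\<in>Pow Z. \<Sum>t\<in>B. if even (card S) then f s t S else - f s t S)"
    by (rule sum.swap)
  also have "\<dots> = (\<Sum>s\<in>A. \<Sum>t\<in>B. alternating Z (f s t))"
    by (intro sum.cong refl sum.swap)
  finally show ?thesis .
qed

lemma phi_finite_type_2:
  assumes "i \<noteq> j" "j \<noteq> k" "i \<noteq> k"
  shows "finite_type_le 2 (phi i j k)"
  unfolding finite_type_le_def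
proof (intro conjI allI impI)
  show "virtual_knot_invariant (phi i j k)" by (rule phi_invariant[OF assms])
  fix K assume K: "singular_diagram K \<and> card (singular_points K) = 2 + 1"
  then interpret generic_diagram K by unfold_locales simp
  let ?Z = "singular_points K" and ?X = "points (resolved {})"
  have fin: "finite ?Z" using K by (simp add: card_ge_0_finite)
  have zero: "alternating ?Z (\<lambda>S. pair_term i j k (resolved S) s t) = 0" if st: "s \<in> ?X" "t \<in> ?X" for s t
  proof -
    have "\<not> ?Z \<subseteq> {curve K s, curve K t}"
    proof
      assume "?Z \<subseteq> {curve K s, curve K t}"
      then have "card ?Z \<le> card {curve K s, curve K t}" by (intro card_mono) auto
      also have "\<dots> \<le> 2" by (simp add: card_insert_if)
      finally show False using K by simp
    qed
    (* A singular point on neither chord: its two resolutions contribute the same and cancel. *)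
    then obtain z where z: "z \<in> ?Z" "z \<noteq> curve K s" "z \<noteq> curve K t" by blast
    show ?thesis
      by (rule alternating_eq_zero[OF fin z(1)]) (use z st in \<open>auto intro: term_resolved_cong\<close>)
  qed
  show "alternating ?Z (\<lambda>S. phi i j k (resolve K S)) = 0"
    unfolding phi_resolve[OF assms] alternating_sum using zero by (simp add: sum.neutral)
qed

lemma weight_sign: "pm p * pm r * weight i j k p r A B C \<ge> 0"
  unfolding weight_def pm_def by auto

text \<open>
  Only the pairs consisting of both singular chords survive in the alternating sum. At a singular
  point the orientation of an end, taken with a minus sign at under ends, is the sign of the
  resolved crossing, so the sign of the resolution turns the contribution of such a pair into
  \<open>pm p * pm r * weight \<dots>\<close>, which is never negative. The pair \<open>s\<close>, \<open>t\<close> contributes 1 in the resolution that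
  makes \<open>s\<close> the over end and \<open>t\<close> the under end of their chords.
\<close>

lemma not_finite_type_1:
  assumes ijk: "i \<noteq> j" "j \<noteq> k" "i \<noteq> k"
    and K: "singular_diagram K"
  defines "G \<equiv> chords_of (resolve K {})"
  assumes card: "card (singular_points K) = 2"
    and st: "s \<in> points G" "t \<in> points G" "mark K s = Singular" "mark K t = Singular" "curve K s \<noteq> curve K t"
    and labels: "apart G s t" "\<bar>index G s - link G s t\<bar> = int i" "\<bar>index G t + link G s t\<bar> = int j"
      "\<bar>link G s t\<bar> = int k"
  shows "\<not> finite_type_le 1 (phi i j k)"
proof
  assume ft: "finite_type_le 1 (phi i j k)"
  interpret generic_diagram K by unfold_locales (rule K)
  let ?Z = "singular_points K" and ?X = "points (resolved {})"
  have G: "G = resolved {}" unfolding G_def resolved_def ..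
  have fin: "finite ?Z" using card by (simp add: card_ge_0_finite)
  let ?a = "\<lambda>s t. alternating ?Z (\<lambda>S. pair_term i j k (resolved S) s t)"
  let ?e = "\<lambda>S. if even (card S) then 1 else (- 1 :: int)"
  have sum0: "(\<Sum>s\<in>?X. \<Sum>t\<in>?X. ?a s t) = 0"
  proof -
    have "card ?Z = 1 + 1" using card by simp
    then have "alternating ?Z (\<lambda>S. phi i j k (resolve K S)) = 0"
      using ft K unfolding finite_type_le_def by blast
    then show ?thesis unfolding phi_resolve[OF ijk] alternating_sum .
  qed
  have cross: "\<exists>v. crossing K u v" if "u \<in> ?X" for u using that unfolding points_resolved by blast
  have sing_point: "curve K u \<in> ?Z \<longleftrightarrow> mark K u = Singular" if uX: "u \<in> ?X" for u
  proof
    assume "mark K u = Singular" then show "curve K u \<in> ?Z"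
      unfolding singular_points_def using cross[OF uX] by blast
  next
    assume "curve K u \<in> ?Z"
    then obtain v w where v: "curve K u = curve K v" "crossing K v w" "mark K v = Singular"
      unfolding singular_points_def by blast
    obtain u' where u': "crossing K u u'" using cross[OF uX] by blast
    have "v = u \<or> v = u'"
      using v(1,2) u' crossing_unique[OF u', of v] unfolding crossing_def by fastforce
    then show "mark K u = Singular" using v(3) marks[OF u'] by auto
  qed
  have ter: "?e S * pair_term i j k (resolved S) u v = (if apart (resolved S) u v then
      pm (over (resolved S) u) * pm (over (resolved S) v) * weight i j k (over (resolved S) u) (over (resolved S) v)
         (index (resolved S) u - link (resolved S) u v) (index (resolved S) v + link (resolved S) u v)
         (link (resolved S) u v) else 0)"
    if uv: "u \<in> ?X" "v \<in> ?X" and Z: "?Z = {curve K u, curve K v}" and S: "S \<subseteq> ?Z" for u v S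
  proof -
    have ne: "curve K u \<noteq> curve K v" using Z card by auto
    have m: "mark K u = Singular" "mark K v = Singular" using sing_point uv Z by auto
    obtain u' v' where c: "crossing K u u'" "crossing K v v'" using cross uv by blast
    let ?o = "ori (chords_of K)"
    have o: "?o w = 1 \<or> ?o w = - 1" for w by (simp add: chords_of_def)
    have sg1: "pm (over (resolved S) w) = ?o w * (if curve K w \<in> S then - 1 else 1)"
      if h: "crossing K w w'" "mark K w = Singular" for w w'
    proof -
      have ov: "over (resolved S) w \<longleftrightarrow> (?o w = 1) = (curve K w \<notin> S)"
        using over_resolved[OF h(1)] h(2) by simp
      from o[of w] show ?thesis
      proof
        assume "?o w = 1"
        then show ?thesis unfolding ov by (simp add: pm_def)
      next
        assume "?o w = - 1"
        then show ?thesis unfolding ov by (simp add: pm_def)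
      qed
    qed
    note sg = sg1[OF c(1) m(1)] sg1[OF c(2) m(2)]
    have sub: "S \<subseteq> {curve K u, curve K v}" using S unfolding Z .
    have "card S = (if curve K u \<in> S then 1 else 0) + (if curve K v \<in> S then 1 else 0)"
    proof (cases "curve K u \<in> S"; cases "curve K v \<in> S")
      assume h: "curve K u \<in> S" "curve K v \<in> S"
      then have "S = {curve K u, curve K v}" using sub by blast
      then have "card S = 2" using ne by simp
      then show ?thesis using h by simp
    next
      assume h: "curve K u \<in> S" "curve K v \<notin> S"
      then have "S = {curve K u}" using sub by blast
      then have "card S = 1" by simp
      then show ?thesis using h by simp
    next
      assume h: "curve K u \<notin> S" "curve K v \<in> S"
      then have "S = {curve K v}" using sub by blast
      then have "card S = 1" by simp
      then show ?thesis using h by simp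
    next
      assume h: "curve K u \<notin> S" "curve K v \<notin> S"
      then have "S = {}" using sub by blast
      then show ?thesis by simp
    qed
    then have e: "?e S = (if curve K u \<in> S then - 1 else 1) * (if curve K v \<in> S then - 1 else 1)"
      by simp
    have "?o u * ?o u = 1" "?o v * ?o v = 1" using o[of u] o[of v] by auto
    then have "?e S * (?o u * ?o v) = pm (over (resolved S) u) * pm (over (resolved S) v)"
      unfolding e sg by (simp add: mult.commute mult.left_commute)
    then show ?thesis unfolding pair_term_def resolved_sel(3) by (simp add: mult.assoc[symmetric])
  qed
  have alt: "?a u v = (\<Sum>S\<in>Pow ?Z. ?e S * pair_term i j k (resolved S) u v)" for u v
    by (rule sum.cong) auto
  have nonneg: "?a u v \<ge> 0" if uv: "u \<in> ?X" "v \<in> ?X" for u v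
  proof (cases "?Z \<subseteq> {curve K u, curve K v}")
    case True
    moreover have "card {curve K u, curve K v} \<le> card ?Z" unfolding card by (simp add: card_insert_if)
    ultimately have Z: "?Z = {curve K u, curve K v}" by (intro card_seteq) auto
    show ?thesis unfolding alt
      by (rule sum_nonneg) (use ter[OF uv Z] weight_sign in auto)
  next
    case False
    then obtain z where z: "z \<in> ?Z" "z \<noteq> curve K u" "z \<noteq> curve K v" by blast
    have "?a u v = 0"
      by (rule alternating_eq_zero[OF fin z(1)]) (use z uv in \<open>auto intro: term_resolved_cong\<close>)
    then show ?thesis by simp
  qed
  have stX: "s \<in> ?X" "t \<in> ?X" using st G by auto
  have Z: "?Z = {curve K s, curve K t}"
  proof -
    have "{curve K s, curve K t} \<subseteq> ?Z" using sing_point stX st by auto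
    moreover have "card ?Z \<le> card {curve K s, curve K t}" using st(5) card by simp
    ultimately show ?thesis using card_seteq[OF fin] by blast
  qed
  have pos: "?a s t > 0"
  proof -
    let ?o = "ori (chords_of K)"
    (* The resolution in which s is an over end and t is an under end. *)
    define S where "S = {x. x = curve K s \<and> ?o s \<noteq> 1 \<or> x = curve K t \<and> ?o t = 1}"
    obtain s' t' where c: "crossing K s s'" "crossing K t t'" using cross stX by blast
    have S: "S \<in> Pow ?Z" unfolding S_def Z by auto
    have "over (resolved S) s" "\<not> over (resolved S) t"
      unfolding over_resolved[OF c(1)] over_resolved[OF c(2)] using st(3-5) unfolding S_def by auto
    then have "?e S * pair_term i j k (resolved S) s t = 1"
      using ter[OF stX Z, of S] S labels unfolding G resolved_invariants[of "{}" S]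
      by (simp add: weight_def pm_def)
    moreover have "?e S * pair_term i j k (resolved S) s t \<le> ?a s t"
      unfolding alt by (rule member_le_sum[OF S]) (use ter[OF stX Z] weight_sign fin in auto)
    ultimately show ?thesis by simp
  qed
  have fX: "finite ?X"
    by (rule finite_resolved)
  have "?a s t \<le> (\<Sum>v\<in>?X. ?a s v)"
  proof (rule member_le_sum[OF stX(2) _ fX])
    fix v assume "v \<in> ?X - {t}"
    then have v: "v \<in> ?X" by blast
    show "0 \<le> ?a s v" by (rule nonneg[OF stX(1) v])
  qed
  also have "\<dots> \<le> (\<Sum>u\<in>?X. \<Sum>v\<in>?X. ?a u v)"
  proof (rule member_le_sum[OF stX(1) _ fX])
    fix u assume "u \<in> ?X - {s}"
    then have u: "u \<in> ?X" by blast
    show "0 \<le> (\<Sum>v\<in>?X. ?a u v)" by (rule sum_nonneg) (rule nonneg[OF u])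
  qed
  finally show False using pos sum0 by simp
qed

section \<open>Rosettes\<close>

lemma full_turns: "cos (x + 2 * pi * real n) = cos x" "sin (x + 2 * pi * real n) = sin x"
proof -
  have "2 * pi * real n = 2 * real n * pi" by simp
  then have "cos (2 * pi * real n) = 1" "sin (2 * pi * real n) = 0"
    using cos_2npi[of n] sin_2npi[of n] by metis+
  then show "cos (x + 2 * pi * real n) = cos x" "sin (x + 2 * pi * real n) = sin x"
    unfolding cos_add sin_add by simp_all
qed

lemma cis_eq_int:
  assumes "cos a = cos b" "sin a = sin b"
  shows "\<exists>n::int. a = b + 2 * pi * n"
  using sin_cos_eq_iff[of a b] assms by simp

text \<open>
  The curve \<open>(2 + cos (2 \<pi> q t)) exp (6 \<pi> \<i> t)\<close> with \<open>q = 3 M + 1\<close>. Two parameters give the same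
  point iff they differ by a multiple of 1/3 and have the same radius. The \<open>2 q\<close> double points
  correspond to chords of length 1/3, evenly spaced around the circle. Every second one
  is used here; these \<open>q\<close> chords are numbered by \<open>l\<close> and have the same orientation. The chords
  0 and \<open>M + 1\<close> are disjoint and become singular; the chords in \<open>C\<close> become classical. Chord \<open>l\<close>
  joins the outer arc of chord 0 with that of chord \<open>M + 1\<close> for \<open>1 \<le> l \<le> M\<close>, the latter arc with the middle
  region for \<open>M + 2 \<le> l \<le> 2 M\<close>, and the middle region with the former arc for \<open>l \<ge> 2 M + 2\<close>.
\<close>

locale rosette =
  fixes M :: nat and C :: "nat set"
  assumes M: "M \<ge> 2" and C: "C \<subseteq> {..3 * M} - {0, M + 1}"
begin

definition q :: nat where "q = 3 * M + 1"

lemma q_pos: "q > 0" "real q > 0" by (simp_all add: q_def)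

definition pt :: "nat \<Rightarrow> real" where "pt a = real a / (6 * real q)"

definition st :: "nat \<Rightarrow> real" where "st l = pt (6 * l + 2)"
definition en :: "nat \<Rightarrow> real" where "en l = pt (6 * ((l + M) mod q) + 4)"

lemma pt_less: "pt a < pt b \<longleftrightarrow> a < b"
  using q_pos by (simp add: pt_def divide_less_cancel)

lemma pt_eq: "pt a = pt b \<longleftrightarrow> a = b"
  using q_pos by (simp add: pt_def)

lemma pt_unit: "a < 6 * q \<Longrightarrow> pt a \<in> {0..<1}"
  using q_pos by (simp add: pt_def)

lemma st_unit: "l < q \<Longrightarrow> st l \<in> {0..<1}"
  unfolding st_def by (rule pt_unit) simp

lemma en_unit: "en l \<in> {0..<1}"
proof -
  have "(l + M) mod q < q" using q_pos by simp
  then show ?thesis unfolding en_def by (intro pt_unit) simp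
qed

lemma en_index: "l < q \<Longrightarrow> (l + M) mod q = (if l \<le> 2 * M then l + M else l - (2 * M + 1))"
proof -
  assume l: "l < q"
  show ?thesis
  proof (cases "l \<le> 2 * M")
    case True
    then show ?thesis by (simp add: q_def)
  next
    case False
    then have "(l + M) mod q = (l + M - q) mod q" by (intro le_mod_geq) (simp add: q_def)
    then show ?thesis using False l by (simp add: q_def)
  qed
qed

lemma st_eq: "st l = st l' \<longleftrightarrow> l = l'"
  by (simp add: st_def pt_eq)

lemma en_eq: "l < q \<Longrightarrow> l' < q \<Longrightarrow> en l = en l' \<longleftrightarrow> l = l'"
  using en_index[of l] en_index[of l'] by (auto simp: en_def pt_eq q_def split: if_splits)

lemma st_en: "st l \<noteq> en l'"
proof
  assume "st l = en l'"
  then have "6 * l + 2 = 6 * ((l' + M) mod q) + 4" by (simp only: st_def en_def pt_eq)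
  moreover have "6 * x + 2 \<noteq> 6 * y + (4 :: nat)" for x y by presburger
  ultimately show False by blast
qed

definition \<gamma> :: "real \<Rightarrow> complex" where
  "\<gamma> t = of_real (2 + cos (2 * pi * real q * t)) * cis (6 * pi * t)"

definition \<gamma>' :: "real \<Rightarrow> complex" where
  "\<gamma>' t = Complex (- 2 * pi * real q * sin (2 * pi * real q * t))
      (6 * pi * (2 + cos (2 * pi * real q * t))) * cis (6 * pi * t)"

lemma \<gamma>_deriv: "(\<gamma> has_vector_derivative \<gamma>' t) (at t)"
proof -
  have 1: "((\<lambda>t. complex_of_real (2 + cos (2 * pi * real q * t))) has_vector_derivative
      of_real (- 2 * pi * real q * sin (2 * pi * real q * t))) (at t)"
    by (rule has_vector_derivative_of_real) (auto intro!: derivative_eq_intros)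
  have 2: "((\<lambda>t. cis (6 * pi * t)) has_vector_derivative (6 * pi) *\<^sub>R (\<i> * cis (6 * pi * t))) (at t)"
  proof -
    have "((\<lambda>t. Complex (cos (6 * pi * t)) (sin (6 * pi * t))) has_vector_derivative
       Complex (- 6 * pi * sin (6 * pi * t)) (6 * pi * cos (6 * pi * t))) (at t)"
      unfolding has_vector_derivative_complex_iff
      by (auto intro!: derivative_eq_intros simp: has_real_derivative_iff_has_vector_derivative[symmetric])
    moreover have "Complex (- 6 * pi * sin (6 * pi * t)) (6 * pi * cos (6 * pi * t)) = (6 * pi) *\<^sub>R (\<i> * cis (6 * pi * t))"
      by (simp add: complex_eq_iff)
    moreover have "(\<lambda>t. Complex (cos (6 * pi * t)) (sin (6 * pi * t))) = (\<lambda>t. cis (6 * pi * t))"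
      by (simp add: fun_eq_iff complex_eq_iff)
    ultimately show ?thesis by simp
  qed
  have "\<gamma>' t = of_real (2 + cos (2 * pi * real q * t)) * ((6 * pi) *\<^sub>R (\<i> * cis (6 * pi * t)))
      + of_real (- 2 * pi * real q * sin (2 * pi * real q * t)) * cis (6 * pi * t)"
    unfolding \<gamma>'_def by (simp add: complex_eq_iff algebra_simps)
  then show ?thesis
    unfolding \<gamma>_def[abs_def] using has_vector_derivative_mult[OF 1 2] by simp
qed

lemma \<gamma>'_cont: "continuous_on UNIV \<gamma>'"
  unfolding \<gamma>'_def[abs_def] Complex_eq
  by (intro continuous_intros)

text \<open>
  The equalities say that \<open>3 (s - t)\<close> and \<open>q (s - t)\<close> are integers, hence so is
  \<open>s - t = q (s - t) - M (3 (s - t))\<close>.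
\<close>

lemma determined:
  assumes "s \<in> {0..<1}" "t \<in> {0..<1}" "cis (6 * pi * s) = cis (6 * pi * t)"
    "cos (2 * pi * real q * s) = cos (2 * pi * real q * t)" "sin (2 * pi * real q * s) = sin (2 * pi * real q * t)"
  shows "s = t"
proof -
  have "cos (6 * pi * s) = cos (6 * pi * t)" "sin (6 * pi * s) = sin (6 * pi * t)"
    using assms(3) by (simp_all add: complex_eq_iff)
  then obtain n :: int where n: "6 * pi * s = 6 * pi * t + 2 * pi * n" using cis_eq_int by blast
  obtain m :: int where m: "2 * pi * real q * s = 2 * pi * real q * t + 2 * pi * m"
    using cis_eq_int[OF assms(4,5)] by blast
  have "(2 * pi) * (3 * s) = (2 * pi) * (3 * t + n)" using n by (simp add: algebra_simps)
  then have n': "3 * s = 3 * t + n" by (subst (asm) mult_cancel_left) simp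
  have "(2 * pi) * (real q * s) = (2 * pi) * (real q * t + m)" using m by (simp add: algebra_simps)
  then have m': "real q * s = real q * t + m" by (subst (asm) mult_cancel_left) simp
  have "real M * (3 * s) = real M * (3 * t + n)" using n' by simp
  then have "s = t + (m - real M * n)" using m' by (simp add: q_def algebra_simps)
  then have "s - t = of_int (m - int M * n)" by simp
  moreover have "\<bar>s - t\<bar> < 1" using assms(1,2) by auto
  ultimately have "m - int M * n = 0" by linarith
  then show ?thesis using \<open>s - t = of_int (m - int M * n)\<close> by simp
qed

lemma \<gamma>_eq:
  "\<gamma> s = \<gamma> t \<longleftrightarrow> cos (2 * pi * real q * s) = cos (2 * pi * real q * t) \<and> cis (6 * pi * s) = cis (6 * pi * t)"
proof
  assume e: "\<gamma> s = \<gamma> t"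
  have n: "cmod (\<gamma> u) = 2 + cos (2 * pi * real q * u)" for u
  proof -
    have "2 + cos (2 * pi * real q * u) > 0" using cos_ge_minus_one[of "2 * pi * real q * u"] by linarith
    then show ?thesis unfolding \<gamma>_def by (simp only: norm_mult norm_of_real norm_cis abs_of_pos mult_1_right)
  qed
  have c: "cos (2 * pi * real q * s) = cos (2 * pi * real q * t)" using n[of s] n[of t] e by simp
  have "2 + cos (2 * pi * real q * t) \<noteq> 0" using cos_ge_minus_one[of "2 * pi * real q * t"] by linarith
  then have "complex_of_real (2 + cos (2 * pi * real q * t)) \<noteq> 0" unfolding of_real_eq_0_iff .
  then show "cos (2 * pi * real q * s) = cos (2 * pi * real q * t) \<and> cis (6 * pi * s) = cis (6 * pi * t)"
    using e c unfolding \<gamma>_def c by (simp only: mult_cancel_left) simp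
qed (simp add: \<gamma>_def)

definition mk :: "real \<Rightarrow> passage" where
  "mk t = (if frac t \<in> st ` {0, M + 1} \<union> en ` {0, M + 1} then Singular
     else if frac t \<in> st ` C then Over else if frac t \<in> en ` C then Under else Virtual)"

definition K :: diagram where "K = Diagram \<gamma> mk"

lemma vel_K: "vel K t = \<gamma>' t"
  unfolding vel_def K_def diagram.sel by (rule vector_derivative_at[OF \<gamma>_deriv])

lemma crossing_K: "crossing K s t \<longleftrightarrow> s \<in> {0..<1} \<and> t \<in> {0..<1} \<and> s \<noteq> t \<and>
    cos (2 * pi * real q * s) = cos (2 * pi * real q * t) \<and> cis (6 * pi * s) = cis (6 * pi * t)"
  unfolding crossing_def K_def diagram.sel \<gamma>_eq by blast

text \<open>
  The radius moves in opposite directions on the two branches of a double point: otherwise the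
  parameters would coincide. This gives transversality, and it excludes triple points.
\<close>

lemma crossing_sin:
  assumes "crossing K s t"
  shows "sin (2 * pi * real q * s) \<noteq> sin (2 * pi * real q * t)"
    "sin (2 * pi * real q * t) = - sin (2 * pi * real q * s)"
proof -
  have c: "cos (2 * pi * real q * s) = cos (2 * pi * real q * t)" using assms crossing_K by blast
  show ne: "sin (2 * pi * real q * s) \<noteq> sin (2 * pi * real q * t)"
    using assms determined[of s t] unfolding crossing_K by blast
  have "(sin (2 * pi * real q * t))\<^sup>2 = (sin (2 * pi * real q * s))\<^sup>2"
    unfolding sin_squared_eq c ..
  then show "sin (2 * pi * real q * t) = - sin (2 * pi * real q * s)"
    using ne unfolding power2_eq_iff by auto
qed

lemma crossing_K_unique:
  assumes "crossing K s t" "crossing K s u"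
  shows "t = u"
proof (rule determined)
  have t: "t \<in> {0..<1}" "cos (2 * pi * real q * s) = cos (2 * pi * real q * t)" "cis (6 * pi * s) = cis (6 * pi * t)"
    and u: "u \<in> {0..<1}" "cos (2 * pi * real q * s) = cos (2 * pi * real q * u)" "cis (6 * pi * s) = cis (6 * pi * u)"
    using assms unfolding crossing_K by blast+
  show "t \<in> {0..<1}" "u \<in> {0..<1}" by (rule t(1), rule u(1))
  show "cis (6 * pi * t) = cis (6 * pi * u)" by (rule trans[OF t(3)[symmetric] u(3)])
  show "cos (2 * pi * real q * t) = cos (2 * pi * real q * u)" by (rule trans[OF t(2)[symmetric] u(2)])
  show "sin (2 * pi * real q * t) = sin (2 * pi * real q * u)"
    unfolding crossing_sin(2)[OF assms(1)] crossing_sin(2)[OF assms(2)] ..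
qed

lemma cross2_K:
  assumes "crossing K s t"
  shows "cross2 (vel K s) (vel K t) = 12 * pi\<^sup>2 * real q * (2 + cos (2 * pi * real q * t)) *
    (sin (2 * pi * real q * t) - sin (2 * pi * real q * s))"
proof -
  have rot: "cross2 (z * cis x) (w * cis x) = cross2 z w" for z w x
  proof -
    have "cross2 (z * Complex c d) (w * Complex c d) = cross2 z w * (c\<^sup>2 + d\<^sup>2)" for c d
      unfolding cross2_def by (simp add: algebra_simps power2_eq_square)
    moreover have "cis x = Complex (cos x) (sin x)" by (simp add: complex_eq_iff)
    ultimately show ?thesis by simp
  qed
  have c: "cos (2 * pi * real q * s) = cos (2 * pi * real q * t)" "cis (6 * pi * s) = cis (6 * pi * t)"
    using assms crossing_K by blast+
  show ?thesis
    unfolding vel_K \<gamma>'_def c rot by (simp add: cross2_def algebra_simps power2_eq_square)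
qed

text \<open>
  In units of \<open>1 / (6 q)\<close> a chord starts at a parameter 2 and ends at a parameter 4 modulo 6, which puts the
  oscillation of the radius at the angles 120 and 240 degrees.
\<close>

lemma chord_crossing:
  assumes "l < q"
  shows "crossing K (st l) (en l)" "cross2 (vel K (st l)) (vel K (en l)) < 0"
proof -
  have ang: "2 * pi * real q * pt (6 * n + r) = 2 * pi * real n + pi * real r / 3" for n r
    using q_pos by (simp add: pt_def field_simps)
  have per: "cos (2 * pi * real n + x) = cos x" "sin (2 * pi * real n + x) = sin x" for n x
    using full_turns[of x n] by (simp_all add: add.commute)
  have x4: "pi * real 4 / 3 = pi + pi / 3" "pi * real 2 / 3 = pi - pi / 3" by (simp_all add: field_simps)
  have cs: "cos (2 * pi * real q * st l) = - (1 / 2)" "sin (2 * pi * real q * st l) = sqrt 3 / 2"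
    unfolding st_def ang unfolding per unfolding x4 unfolding cos_diff sin_diff cos_60 sin_60 by simp_all
  have ce: "cos (2 * pi * real q * en l) = - (1 / 2)" "sin (2 * pi * real q * en l) = - (sqrt 3 / 2)"
    unfolding en_def ang unfolding per unfolding x4 unfolding cos_add sin_add cos_60 sin_60 by simp_all
  have "\<exists>n::int. 6 * pi * st l = 6 * pi * en l + 2 * pi * n"
  proof (cases "l \<le> 2 * M")
    case True
    have e: "real (6 * l + 2) = real (6 * (l + M) + 4) - 2 * real q" by (simp add: q_def)
    have d: "st l = en l - 1 / 3"
      unfolding st_def en_def en_index[OF assms] pt_def if_P[OF True] e diff_divide_distrib using q_pos by simp
    have "6 * pi * st l = 6 * pi * en l + 2 * pi * (-1::int)" unfolding d by (simp add: algebra_simps)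
    then show ?thesis by blast
  next
    case False
    have e: "real (6 * l + 2) = real (6 * (l - (2 * M + 1)) + 4) + 4 * real q" using False by (simp add: q_def of_nat_diff)
    have d: "st l = en l + 2 / 3"
      unfolding st_def en_def en_index[OF assms] pt_def if_not_P[OF False] e add_divide_distrib using q_pos by simp
    have "6 * pi * st l = 6 * pi * en l + 2 * pi * (2::int)" unfolding d by (simp add: algebra_simps)
    then show ?thesis by blast
  qed
  then have "sin (6 * pi * st l) = sin (6 * pi * en l) \<and> cos (6 * pi * st l) = cos (6 * pi * en l)"
    using sin_cos_eq_iff[of "6 * pi * st l" "6 * pi * en l"] by blast
  then have "cis (6 * pi * st l) = cis (6 * pi * en l)" by (simp add: complex_eq_iff)
  then show cr: "crossing K (st l) (en l)"
    unfolding crossing_K using st_unit[OF assms] en_unit st_en cs ce by simp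
  have "12 * pi\<^sup>2 * real q * (2 - 1 / 2) * (- (sqrt 3 / 2) - sqrt 3 / 2) < 0"
    using q_pos by (intro mult_pos_neg) auto
  then show "cross2 (vel K (st l)) (vel K (en l)) < 0"
    unfolding cross2_K[OF cr] ce cs by simp
qed

text \<open>At a crossing \<open>q (s + t)\<close> and \<open>3 (s - t)\<close> are integers, so \<open>6 q s\<close> is one.\<close>

lemma finite_crossings: "finite {(s, t). crossing K s t}"
proof -
  let ?N = "6 * real q"
  have int: "\<exists>a. a < 6 * q \<and> s = pt a" if st: "crossing K s t" for s t
  proof -
    have "cos (2 * pi * real q * s) = cos (- (2 * pi * real q * t))"
      "sin (2 * pi * real q * s) = sin (- (2 * pi * real q * t))"
      using st crossing_sin(2)[OF st] unfolding crossing_K by auto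
    then obtain m :: int where m: "2 * pi * real q * s = - (2 * pi * real q * t) + 2 * pi * m"
      using cis_eq_int by blast
    have "cos (6 * pi * s) = cos (6 * pi * t)" "sin (6 * pi * s) = sin (6 * pi * t)"
      using st unfolding crossing_K by (simp_all add: complex_eq_iff)
    then obtain n :: int where n: "6 * pi * s = 6 * pi * t + 2 * pi * n" using cis_eq_int by blast
    have "(2 * pi) * (real q * (s + t)) = (2 * pi) * m" using m by (simp add: algebra_simps)
    then have m': "real q * (s + t) = m" by (subst (asm) mult_cancel_left) simp
    have "(2 * pi) * (3 * (s - t)) = (2 * pi) * n" using n by (simp add: algebra_simps)
    then have n': "3 * (s - t) = n" by (subst (asm) mult_cancel_left) simp
    have "?N * s = 3 * (real q * (s + t)) + real q * (3 * (s - t))" by (simp add: algebra_simps)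
    then have e: "?N * s = of_int (3 * m + int q * n)" unfolding m' n' by simp
    have u: "0 \<le> s" "s < 1" using st unfolding crossing_K by auto
    then have "0 \<le> ?N * s" "?N * s < ?N" using q_pos by simp_all
    then have b: "0 \<le> 3 * m + int q * n" "3 * m + int q * n < 6 * int q" unfolding e by linarith+
    have "s = pt (nat (3 * m + int q * n))"
      using e b(1) q_pos unfolding pt_def by (simp add: field_simps)
    then show ?thesis using b by (intro exI[of _ "nat (3 * m + int q * n)"]) auto
  qed
  have "{(s, t). crossing K s t} \<subseteq> (pt ` {..<6 * q}) \<times> (pt ` {..<6 * q})"
  proof
    fix x assume "x \<in> {(s, t). crossing K s t}"
    then obtain s t where x: "x = (s, t)" "crossing K s t" by auto
    have "s \<in> pt ` {..<6 * q}" using int[OF x(2)] by auto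
    moreover have "t \<in> pt ` {..<6 * q}" using int[OF crossing_sym[OF x(2)]] by auto
    ultimately show "x \<in> (pt ` {..<6 * q}) \<times> (pt ` {..<6 * q})" using x(1) by simp
  qed
  then show ?thesis by (rule finite_subset) simp
qed

definition L where "L = insert 0 (insert (M + 1) C)"

lemma L_less: "l \<in> L \<Longrightarrow> l < q"
  using C M unfolding L_def q_def by auto

lemma mk_st: "l < q \<Longrightarrow> mk (st l) = (if l \<in> {0, M + 1} then Singular else if l \<in> C then Over else Virtual)"
proof -
  assume l: "l < q"
  have f: "frac (st l) = st l" using st_unit[OF l] by (simp add: frac_eq_id)
  show ?thesis unfolding mk_def f using st_eq st_en by (auto simp: image_iff)
qed

lemma mk_en: "l < q \<Longrightarrow> mk (en l) = (if l \<in> {0, M + 1} then Singular else if l \<in> C then Under else Virtual)"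
proof -
  assume l: "l < q"
  have f: "frac (en l) = en l" using en_unit[of l] by (simp add: frac_eq_id)
  have e: "en l \<in> en ` A \<longleftrightarrow> l \<in> A" if "A \<subseteq> L" for A
  proof
    assume "en l \<in> en ` A"
    then obtain l' where "l' \<in> A" "en l = en l'" by blast
    then show "l \<in> A" using en_eq[OF l L_less[of l']] that by blast
  qed simp
  have s: "en l \<notin> st ` A" for A using st_en by (metis imageE)
  have "{0, M + 1} \<subseteq> L" "C \<subseteq> L" unfolding L_def by blast+
  note e' = e[OF this(1)] e[OF this(2)]
  show ?thesis unfolding mk_def f Un_iff e' by (simp only: s simp_thms if_False)
qed

lemma mk_other: "s \<notin> st ` L \<Longrightarrow> s \<notin> en ` L \<Longrightarrow> s \<in> {0..<1} \<Longrightarrow> mk s = Virtual"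
proof -
  assume s: "s \<notin> st ` L" "s \<notin> en ` L" "s \<in> {0..<1}"
  have f: "frac s = s" using s(3) by (simp add: frac_eq_id)
  have "st ` {0, M + 1} \<union> en ` {0, M + 1} \<subseteq> st ` L \<union> en ` L" "st ` C \<subseteq> st ` L" "en ` C \<subseteq> en ` L"
    unfolding L_def by auto
  then show ?thesis unfolding mk_def f using s(1,2) by auto
qed

lemma partner_cases:
  assumes "crossing K s t"
  obtains l where "l \<in> L" "s = st l" "t = en l" | l where "l \<in> L" "s = en l" "t = st l"
    | "mk s = Virtual" "mk t = Virtual"
proof -
  have u: "s \<in> {0..<1}" "t \<in> {0..<1}" using assms unfolding crossing_K by auto
  have cs: "crossing K t s" using assms by (rule crossing_sym)
  have st: "y = en l" if "l \<in> L" "crossing K (st l) y" for l y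
    using crossing_K_unique[OF that(2) chord_crossing(1)[OF L_less[OF that(1)]]] .
  have en: "y = st l" if "l \<in> L" "crossing K (en l) y" for l y
    using crossing_K_unique[OF that(2) crossing_sym[OF chord_crossing(1)[OF L_less[OF that(1)]]]] .
  consider "s \<in> st ` L" | "s \<in> en ` L" | "t \<in> st ` L" | "t \<in> en ` L"
    | "s \<notin> st ` L" "s \<notin> en ` L" "t \<notin> st ` L" "t \<notin> en ` L" by blast
  then show ?thesis
  proof cases
    case 1 then show ?thesis using that(1) st assms by blast
  next
    case 2 then show ?thesis using that(2) en assms by blast
  next
    case 3 then show ?thesis using that(2) st cs by blast
  next
    case 4 then show ?thesis using that(1) en cs by blast
  next
    case 5 then show ?thesis using that(3) mk_other u by blast
  qed
qed

lemma singular_K: "singular_diagram K"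
  unfolding singular_diagram_def
proof (intro conjI allI impI)
  fix s t u
  have "cos (2 * pi * real q * t + 2 * pi * real q) = cos (2 * pi * real q * t)"
    by (rule full_turns)
  moreover have "cis (6 * pi * t + 6 * pi) = cis (6 * pi * t)"
    using full_turns[of "6 * pi * t" 3] by (simp add: complex_eq_iff)
  ultimately show "curve K (t + 1) = curve K t"
    by (simp add: K_def \<gamma>_def algebra_simps)
  show "mark K (t + 1) = mark K t"
    using frac_add_of_int[of t 1] by (simp add: K_def mk_def)
  show "curve K C1_differentiable_on UNIV"
    unfolding C1_differentiable_on_def K_def diagram.sel using \<gamma>_deriv \<gamma>'_cont by blast
  show "vel K t \<noteq> 0"
  proof -
    have "2 + cos (2 * pi * real q * t) \<noteq> 0" using cos_ge_minus_one[of "2 * pi * real q * t"] by linarith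
    then have "Complex (- 2 * pi * real q * sin (2 * pi * real q * t)) (6 * pi * (2 + cos (2 * pi * real q * t))) \<noteq> 0"
      by (simp add: complex_eq_iff)
    moreover have "cis (6 * pi * t) \<noteq> 0" by (rule cis_neq_zero)
    ultimately show ?thesis unfolding vel_K \<gamma>'_def mult_eq_0_iff by blast
  qed
  show "finite {(s, t). crossing K s t}" by (rule finite_crossings)
  show "cross2 (vel K s) (vel K t) \<noteq> 0" if "crossing K s t"
  proof -
    have "2 + cos (2 * pi * real q * t) \<noteq> 0" using cos_ge_minus_one[of "2 * pi * real q * t"] by linarith
    then show ?thesis unfolding cross2_K[OF that] using crossing_sin(1)[OF that] q_pos by simp
  qed
  show "t = u" if "crossing K s t \<and> crossing K s u" using that crossing_K_unique by blast
  assume "crossing K s t"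
  then show "(mark K s, mark K t) \<in> {(Over, Under), (Under, Over), (Virtual, Virtual), (Singular, Singular)}"
  proof (rule partner_cases)
    fix l assume l: "l \<in> L" "s = st l" "t = en l"
    show ?thesis
      unfolding K_def diagram.sel l(2,3) mk_st[OF L_less[OF l(1)]] mk_en[OF L_less[OF l(1)]] by simp
  next
    fix l assume l: "l \<in> L" "s = en l" "t = st l"
    show ?thesis
      unfolding K_def diagram.sel l(2,3) mk_st[OF L_less[OF l(1)]] mk_en[OF L_less[OF l(1)]] by simp
  next
    assume "mk s = Virtual" "mk t = Virtual"
    then show ?thesis by (simp add: K_def)
  qed
qed

sublocale generic_diagram K
  by (rule generic_diagram.intro[OF singular_K])

definition G where "G = chords_of (resolve K {})"

lemma G_eq: "G = resolved {}"
  by (simp add: G_def resolved_def)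

lemma points_G: "points G = st ` L \<union> en ` L"
proof (intro set_eqI iffI)
  fix s assume "s \<in> points G"
  then obtain t where t: "crossing K s t" "mark K s \<noteq> Virtual" unfolding G_eq points_resolved by blast
  from t(1) show "s \<in> st ` L \<union> en ` L"
    by (rule partner_cases) (use t(2) in \<open>auto simp: K_def\<close>)
next
  fix s assume "s \<in> st ` L \<union> en ` L"
  then obtain l where l: "l \<in> L" "s = st l \<or> s = en l" by blast
  note c = chord_crossing(1)[OF L_less[OF l(1)]]
  have "l \<in> {0, M + 1} \<or> l \<in> C" using l(1) unfolding L_def by blast
  then have "mark K s \<noteq> Virtual"
    using l(2) mk_st[OF L_less[OF l(1)]] mk_en[OF L_less[OF l(1)]] by (auto simp: K_def split: if_splits)
  then show "s \<in> points G" unfolding G_eq points_resolved using l(2) c crossing_sym[OF c] by blast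
qed

lemma mate_G: "l \<in> L \<Longrightarrow> mate G (st l) = en l" "l \<in> L \<Longrightarrow> mate G (en l) = st l"
  unfolding G_eq resolved_sel
  using partner[OF chord_crossing(1)[OF L_less]] partner[OF crossing_sym[OF chord_crossing(1)[OF L_less]]] by blast+

lemma ori_G: "l \<in> L \<Longrightarrow> ori G (st l) = - 1" "l \<in> L \<Longrightarrow> ori G (en l) = 1"
proof -
  assume l: "l \<in> L"
  note c = chord_crossing[OF L_less[OF l]]
  show "ori G (st l) = - 1" unfolding G_eq resolved_sel ori_crossing[OF c(1)] using c(2) by simp
  show "ori G (en l) = 1"
    unfolding G_eq resolved_sel ori_crossing[OF crossing_sym[OF c(1)]]
    using c(2) cross2_antisym[of "vel K (en l)" "vel K (st l)"] by simp
qed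

lemma finite_L: "finite L"
  using finite_subset[of L "{..<q}"] L_less by auto

lemma sum_G: "(\<Sum>x\<in>points G. f x) = (\<Sum>l\<in>L. f (st l) + (f (en l) :: int))"
proof -
  have "st ` L \<inter> en ` L = {}" using st_en by (metis disjoint_iff imageE)
  moreover have "inj_on st L" by (rule inj_onI) (simp add: st_eq)
  moreover have "inj_on en L" by (rule inj_onI) (use en_eq L_less in blast)
  ultimately show ?thesis
    unfolding points_G using finite_L by (simp add: sum.union_disjoint sum.reindex sum.distrib)
qed

lemma btw_G: "btw G x y z = cyc x y z"
  unfolding G_eq by (rule btw_resolved)

lemma cyc_pt: "cyc (pt a) (pt b) (pt c) \<longleftrightarrow> a < b \<and> b < c \<or> b < c \<and> c < a \<or> c < a \<and> a < b"
  unfolding cyc_def pt_less ..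

lemma ends: "en 0 = pt (6 * M + 4)" "en (M + 1) = pt (12 * M + 10)"
  "st 0 = pt 2" "st (M + 1) = pt (6 * M + 8)"
proof -
  have "(0 + M) mod q = M" "(M + 1 + M) mod q = 2 * M + 1"
    using en_index[of 0] en_index[of "M + 1"] M by (simp_all add: q_def)
  then show "en 0 = pt (6 * M + 4)" "en (M + 1) = pt (12 * M + 10)"
    unfolding en_def by (simp_all only:) (rule arg_cong[where f = pt], simp)+
  show "st 0 = pt 2" "st (M + 1) = pt (6 * M + 8)"
    unfolding st_def by (rule arg_cong[where f = pt], simp)+
qed

lemma arcs:
  assumes "l \<in> L"
  shows "cyc (st 0) (st l) (en 0) \<longleftrightarrow> 1 \<le> l \<and> l \<le> M"
    "cyc (st 0) (en l) (en 0) \<longleftrightarrow> 2 * M + 1 \<le> l"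
    "cyc (st (M + 1)) (st l) (en (M + 1)) \<longleftrightarrow> M + 2 \<le> l \<and> l \<le> 2 * M + 1"
    "cyc (st (M + 1)) (en l) (en (M + 1)) \<longleftrightarrow> 1 \<le> l \<and> l \<le> M"
proof -
  have l: "l < q" "l \<le> 3 * M" using L_less[OF assms] by (auto simp: q_def)
  have s: "st l = pt (6 * l + 2)" by (simp add: st_def)
  have e: "en l = pt (6 * (if l \<le> 2 * M then l + M else l - (2 * M + 1)) + 4)"
    unfolding en_def en_index[OF l(1)] ..
  show "cyc (st 0) (st l) (en 0) \<longleftrightarrow> 1 \<le> l \<and> l \<le> M"
    unfolding ends s cyc_pt using M by auto
  show "cyc (st (M + 1)) (st l) (en (M + 1)) \<longleftrightarrow> M + 2 \<le> l \<and> l \<le> 2 * M + 1"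
    unfolding ends s cyc_pt using M by auto
  show "cyc (st 0) (en l) (en 0) \<longleftrightarrow> 2 * M + 1 \<le> l"
    unfolding ends e cyc_pt using M l by (cases "l \<le> 2 * M") auto
  show "cyc (st (M + 1)) (en l) (en (M + 1)) \<longleftrightarrow> 1 \<le> l \<and> l \<le> M"
    unfolding ends e cyc_pt using M l by (cases "l \<le> 2 * M") auto
qed

lemma in_L: "0 \<in> L" "M + 1 \<in> L" by (simp_all add: L_def)

lemma apart_G: "apart G (st 0) (st (M + 1))"
  unfolding apart_def mate_G(1)[OF in_L(1)] mate_G(1)[OF in_L(2)] btw_G unfolding ends cyc_pt
  using M by auto

lemma card_L: "(\<Sum>l\<in>L. if P l then a else 0) = a * int (card {l \<in> L. P l})"
  using finite_L by (simp add: sum.inter_filter[symmetric])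

lemma index_st_0: "index G (st 0) = int (card {l \<in> L. 2 * M + 1 \<le> l}) - int (card {l \<in> L. 1 \<le> l \<and> l \<le> M})"
proof -
  have "index G (st 0) = (\<Sum>l\<in>L. (if 1 \<le> l \<and> l \<le> M then - 1 else 0) + (if 2 * M + 1 \<le> l then 1 else 0))"
    unfolding index_def sum_G mate_G(1)[OF in_L(1)] btw_G by (rule sum.cong[OF refl]) (simp add: arcs ori_G)
  then show ?thesis unfolding sum.distrib card_L by simp
qed

lemma index_st_M: "index G (st (M + 1)) = int (card {l \<in> L. 1 \<le> l \<and> l \<le> M})
   - int (card {l \<in> L. M + 2 \<le> l \<and> l \<le> 2 * M + 1})"
proof -
  have "index G (st (M + 1)) = (\<Sum>l\<in>L. (if M + 2 \<le> l \<and> l \<le> 2 * M + 1 then - 1 else 0) + (if 1 \<le> l \<and> l \<le> M then 1 else 0))"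
    unfolding index_def sum_G mate_G(1)[OF in_L(2)] btw_G
    by (rule sum.cong[OF refl]) (simp only: arcs ori_G)
  then show ?thesis unfolding sum.distrib card_L by simp
qed

lemma link_G:
  assumes "2 * M + 1 \<notin> C"
  shows "link G (st 0) (st (M + 1)) = - int (card {l \<in> L. 1 \<le> l \<and> l \<le> M})"
proof -
  have n: "2 * M + 1 \<notin> L" using assms M unfolding L_def by auto
  have "link G (st 0) (st (M + 1)) = (\<Sum>l\<in>L. if 1 \<le> l \<and> l \<le> M then - 1 else 0)"
    unfolding link_def sum_G mate_G(1)[OF in_L(1)] mate_G(1)[OF in_L(2)] btw_G
  proof (rule sum.cong[OF refl])
    fix l assume l: "l \<in> L"
    then have "l \<noteq> 2 * M + 1" using n by blast
    then show "(if cyc (st 0) (st l) (en 0) \<and> cyc (st (M + 1)) (mate G (st l)) (en (M + 1)) then ori G (st l) else 0)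
      + (if cyc (st 0) (en l) (en 0) \<and> cyc (st (M + 1)) (mate G (en l)) (en (M + 1)) then ori G (en l) else 0)
      = (if 1 \<le> l \<and> l \<le> M then - 1 else 0)"
      unfolding mate_G[OF l] arcs[OF l] ori_G[OF l] by auto
  qed
  then show ?thesis unfolding card_L by simp
qed

lemma singular_points_K: "singular_points K = {curve K (st 0), curve K (st (M + 1))}"
proof (intro set_eqI iffI)
  fix z assume "z \<in> singular_points K"
  then obtain s t where z: "z = curve K s" "crossing K s t" "mk s = Singular"
    unfolding singular_points_def K_def by auto
  from z(2) show "z \<in> {curve K (st 0), curve K (st (M + 1))}"
  proof (rule partner_cases)
    fix l assume l: "l \<in> L" "s = st l" "t = en l"
    then have "l \<in> {0, M + 1}" using z(3) mk_st[OF L_less[OF l(1)]] by (auto split: if_splits)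
    then show ?thesis using z(1) l(2) by auto
  next
    fix l assume l: "l \<in> L" "s = en l" "t = st l"
    then have "l \<in> {0, M + 1}" using z(3) mk_en[OF L_less[OF l(1)]] by (auto split: if_splits)
    moreover have "z = curve K (st l)" using z(1,2) l(3) unfolding crossing_def by simp
    ultimately show ?thesis by auto
  qed (use z in auto)
next
  fix z assume "z \<in> {curve K (st 0), curve K (st (M + 1))}"
  then obtain l where l: "l \<in> L" "z = curve K (st l)" "l \<in> {0, M + 1}" using in_L by blast
  then show "z \<in> singular_points K"
    unfolding singular_points_def using chord_crossing(1)[OF L_less[OF l(1)]] mk_st[OF L_less[OF l(1)]]
    by (auto simp: K_def)
qed

lemma curve_neq: "curve K (st 0) \<noteq> curve K (st (M + 1))"
proof
  assume "curve K (st 0) = curve K (st (M + 1))"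
  then have "crossing K (st 0) (st (M + 1))"
    unfolding crossing_def using st_unit L_less in_L st_eq[of 0 "M + 1"] by simp
  then show False
    using crossing_K_unique[OF _ chord_crossing(1)[OF L_less[OF in_L(1)]]] st_en by blast
qed

end

lemma phi_not_finite_type_1:
  assumes ijk: "i \<noteq> j" "j \<noteq> k" "i \<noteq> k"
  shows "\<not> finite_type_le 1 (phi i j k)"
proof -
  (* M only has to be large enough to leave room for the chosen chords in each of the three ranges. *)
  define M where "M = i + j + k + 2"
  define C where "C = {1..k} \<union> {M + 2..<M + 2 + j} \<union> {2 * M + 2..<2 * M + 2 + i}"
  interpret rosette M C
    by unfold_locales (auto simp: M_def C_def)
  have M_le: "k \<le> M" "j + 2 \<le> M" "i + 2 \<le> M" by (simp_all add: M_def)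
  have a: "{l \<in> L. 1 \<le> l \<and> l \<le> M} = {1..k}" unfolding L_def unfolding C_def using M_le by auto
  have b: "{l \<in> L. M + 2 \<le> l \<and> l \<le> 2 * M + 1} = {M + 2..<M + 2 + j}" unfolding L_def unfolding C_def using M_le by auto
  have c: "{l \<in> L. 2 * M + 1 \<le> l} = {2 * M + 2..<2 * M + 2 + i}" unfolding L_def unfolding C_def using M_le by auto
  have "2 * M + 1 \<notin> C" unfolding C_def using M_le by auto
  note lk = link_G[OF this, unfolded a]
  note ix = index_st_0[unfolded a c] index_st_M[unfolded a b]
  show ?thesis
  proof (rule not_finite_type_1[OF ijk singular_K])
    show "card (singular_points K) = 2" unfolding singular_points_K using curve_neq by simp
    show "curve K (st 0) \<noteq> curve K (st (M + 1))" by (rule curve_neq)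
    show "mark K (st 0) = Singular" "mark K (st (M + 1)) = Singular"
      using mk_st[OF L_less[OF in_L(1)]] mk_st[OF L_less[OF in_L(2)]] by (simp_all add: K_def)
    show "st 0 \<in> points (chords_of (resolve K {}))" "st (M + 1) \<in> points (chords_of (resolve K {}))"
      unfolding G_def[symmetric] points_G using in_L by blast+
    show "apart (chords_of (resolve K {})) (st 0) (st (M + 1))"
      unfolding G_def[symmetric] by (rule apart_G)
  qed (unfold G_def[symmetric] lk ix, simp_all)
qed

theorem theorem10:
  fixes i j k :: nat
  assumes "i \<noteq> j" and "j \<noteq> k" and "i \<noteq> k"
  shows "finite_type_le 2 (phi i j k) \<and> \<not> finite_type_le 1 (phi i j k)"
  using phi_finite_type_2[OF assms] phi_not_finite_type_1[OF assms] by blast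

end
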